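(* Let $G$ be an arbitrary chordal graph on the vertex set $[n]$. Let $\Gamma:=\Gamma(G)$ be the clique complex of $G$, let $d:=\dim(\Gamma)+1$, and let $f(\Gamma)=(f_{-1},f_0,\ldots,f_{d-1})$ be the $f$-vector of $\Gamma$. Let $\overline{G}$ be the complement of $G$ and let $p:=\mathrm{pdim}(R/I(\overline{G}))$ be the projective dimension of the $R$-module $R/I(\overline G)$, where $R=\mathbb{Q}[x_1,\ldots,x_n]$. Then $$-\sum_{i=1}^{p+1} (-1)^i\, i\binom{f_0}{i+1}+ \sum_{j=1}^{p+1} (-1)^{j+p}f_j \binom{f_0-j-2}{p-j+1} =1,$$ and $$\sum_{k=1}^{p+1} (-1)^k f_k \left( \sum_{i=k-1}^p (-1)^i (2+i)^j \binom{f_0-k-1}{i-k+1} \right)+\sum_{i=0}^p (-1)^i (2+i)^j (i+1)\binom{f_0}{i+2}=0$$ for each $j=1,\ldots,n-d-1$.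
   Context: Graphs are finite and simple. A graph is chordal if each cycle of length $>3$ has a chord. The complement $\overline G$ has vertex set $[n]=\{1,\ldots,n\}$ and its edges are the pairs $\{i,j\}$, $i\neq j$, that are not edges of $G$. The edge ideal of a graph $H$ on $[n]$ is $I(H)=\langle x_ix_j : \{i,j\}\in E(H)\rangle\subseteq R=\mathbb{Q}[x_1,\ldots,x_n]$. The clique complex $\Gamma(G)$ is the simplicial complex on $[n]$ whose faces are the cliques of $G$, i.e. the subsets $F\subseteq[n]$ with $\{i,j\}\in E(G)$ for all distinct $i,j\in F$ (including the empty set and all singletons). The dimension of a face is its cardinality minus one, and the dimension of a complex is the maximal dimension of a face. $f_i$ denotes the number of $i$-dimensional faces of $\Gamma$; in particular $f_0=n$, and $f_i=0$ for $i\geq d$. For an integer $b\ge 0$, $\binom{a}{b}=\frac{1}{b!}a(a-1)\cdots(a-b+1)$.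
   Formalization: The graph G is assumed not to be complete: for complete G one has I = 0, p = 0, d = n, the left side of the first identity is 0 instead of 1, and the second family is vacuous. *)

theory Defs
  imports
    "HOL-Library.Poly_Mapping"
    "HOL-Library.Ramsey"
    "HOL-Library.Extended_Nat"
    "HOL-Algebra.Algebra"
begin

section \<open>Finite simple graphs and clique complexes\<close>

text \<open>A simple graph on the vertex set \<open>V\<close> is given by its set \<open>E\<close> of two-element subsets of \<open>V\<close>.\<close>

definition simple_graph :: "'v set \<Rightarrow> 'v set set \<Rightarrow> bool" where
  "simple_graph V E \<longleftrightarrow> finite V \<and> E \<subseteq> nsets V 2"

definition graph_complement :: "'v set \<Rightarrow> 'v set set \<Rightarrow> 'v set set" where
  "graph_complement V E = nsets V 2 - E"

text \<open>The list \<open>vs\<close> enumerates the vertices of a cycle in cyclic order; \<open>length vs\<close> is the length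
  of the cycle.\<close>

definition is_cycle :: "'v set set \<Rightarrow> 'v list \<Rightarrow> bool" where
  "is_cycle E vs \<longleftrightarrow> length vs \<ge> 3 \<and> distinct vs \<and>
     (\<forall>i < length vs. {vs ! i, vs ! (Suc i mod length vs)} \<in> E)"

text \<open>A chord is an edge joining two vertices that are not consecutive on the cycle.\<close>

definition has_chord :: "'v set set \<Rightarrow> 'v list \<Rightarrow> bool" where
  "has_chord E vs \<longleftrightarrow> (\<exists>i < length vs. \<exists>j < length vs.
     i \<noteq> j \<and> j \<noteq> Suc i mod length vs \<and> i \<noteq> Suc j mod length vs \<and> {vs ! i, vs ! j} \<in> E)"

definition chordal :: "'v set set \<Rightarrow> bool" where
  "chordal E \<longleftrightarrow> (\<forall>vs. is_cycle E vs \<and> length vs > 3 \<longrightarrow> has_chord E vs)"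

definition clique_complex :: "'v set \<Rightarrow> 'v set set \<Rightarrow> 'v set set" where
  "clique_complex V E = {F. F \<subseteq> V \<and> clique F E}"

text \<open>Dimensions are integers, since the empty face has dimension \<open>-1\<close>.\<close>

definition face_dim :: "'v set \<Rightarrow> int" where
  "face_dim F = int (card F) - 1"

definition complex_dim :: "'v set set \<Rightarrow> int" where
  "complex_dim \<Delta> = Max (face_dim ` \<Delta>)"

definition face_number :: "'v set set \<Rightarrow> int \<Rightarrow> nat" where
  "face_number \<Delta> i = card {F \<in> \<Delta>. face_dim F = i}"


section \<open>Polynomial rings and edge ideals\<close>

text \<open>A monomial is a finitely supported exponent vector \<open>'v \<Rightarrow>\<^sub>0 nat\<close>, a polynomial a finitely
  supported family of coefficients indexed by monomials. The carrier consists of the polynomials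
  in which only the variables indexed by \<open>V\<close> occur.\<close>

definition mpoly_ring :: "'v set \<Rightarrow> (('v \<Rightarrow>\<^sub>0 nat) \<Rightarrow>\<^sub>0 'k::comm_ring_1) ring" where
  "mpoly_ring V = \<lparr>carrier = {q. \<forall>m \<in> Poly_Mapping.keys q. Poly_Mapping.keys m \<subseteq> V},
     monoid.mult = (*), one = 1, ring.zero = 0, add = (+)\<rparr>"

definition mpoly_var :: "'v \<Rightarrow> (('v \<Rightarrow>\<^sub>0 nat) \<Rightarrow>\<^sub>0 'k::comm_ring_1)" where
  "mpoly_var v = Poly_Mapping.single (Poly_Mapping.single v 1) 1"

definition edge_ideal :: "'v set \<Rightarrow> 'v set set \<Rightarrow> (('v \<Rightarrow>\<^sub>0 nat) \<Rightarrow>\<^sub>0 'k::comm_ring_1) set" where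
  "edge_ideal V E = genideal (mpoly_ring V) {mpoly_var u * mpoly_var v | u v. u \<noteq> v \<and> {u, v} \<in> E}"


section \<open>Projective dimension of modules\<close>

text \<open>The fields \<open>mult\<close> and \<open>one\<close> of the record type \<open>module\<close> are irrelevant to the locale
  \<open>module\<close>.\<close>

definition quotient_module :: "('a, 'm) ring_scheme \<Rightarrow> 'a set \<Rightarrow> ('a, 'a set) module" where
  "quotient_module R I = \<lparr>carrier = carrier (R Quot I), monoid.mult = monoid.mult (R Quot I), one = one (R Quot I),
     ring.zero = ring.zero (R Quot I), add = add (R Quot I),
     smult = (\<lambda>a C. (I +>\<^bsub>R\<^esub> a) \<otimes>\<^bsub>R Quot I\<^esub> C)\<rparr>"

definition mod_hom ::
  "('a, 'm) ring_scheme \<Rightarrow> ('a, 'b, 'n) module_scheme \<Rightarrow> ('a, 'c, 'o) module_scheme \<Rightarrow> ('b \<Rightarrow> 'c) set"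
  where
  "mod_hom R M N = {h \<in> carrier M \<rightarrow> carrier N.
     (\<forall>x \<in> carrier M. \<forall>y \<in> carrier M. h (x \<oplus>\<^bsub>M\<^esub> y) = h x \<oplus>\<^bsub>N\<^esub> h y) \<and>
     (\<forall>r \<in> carrier R. \<forall>x \<in> carrier M. h (r \<odot>\<^bsub>M\<^esub> x) = r \<odot>\<^bsub>N\<^esub> h x)}"

definition mod_ker :: "('a, 'b, 'n) module_scheme \<Rightarrow> ('a, 'c, 'o) module_scheme \<Rightarrow> ('b \<Rightarrow> 'c) \<Rightarrow> 'b set"
  where "mod_ker M N h = {x \<in> carrier M. h x = \<zero>\<^bsub>N\<^esub>}"

text \<open>The free module with basis indexed by \<open>I\<close>: finitely supported functions from \<open>I\<close> to \<open>R\<close>,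
  extended by zero outside \<open>I\<close>.\<close>

definition free_module :: "('a, 'm) ring_scheme \<Rightarrow> 'i set \<Rightarrow> ('a, 'i \<Rightarrow> 'a) module" where
  "free_module R I = \<lparr>carrier = {c. (\<forall>i. c i \<in> carrier R) \<and> finite {i. c i \<noteq> \<zero>\<^bsub>R\<^esub>} \<and> {i. c i \<noteq> \<zero>\<^bsub>R\<^esub>} \<subseteq> I},
     monoid.mult = (\<lambda>b c i. b i \<otimes>\<^bsub>R\<^esub> c i), one = (\<lambda>_. \<one>\<^bsub>R\<^esub>),
     ring.zero = (\<lambda>_. \<zero>\<^bsub>R\<^esub>), add = (\<lambda>b c i. b i \<oplus>\<^bsub>R\<^esub> c i),
     smult = (\<lambda>r c i. r \<otimes>\<^bsub>R\<^esub> c i)\<rparr>"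

text \<open>A module is projective if it is (isomorphic to) a direct summand of a free module, that is,
  if there are homomorphisms to a free module and back whose composition is the identity. It is
  no restriction that the basis is indexed by elements of the type \<open>'p\<close> of \<open>P\<close>: a projective
  module is a direct summand of the free module on any generating set, for instance its carrier.\<close>

definition projective_module :: "('a, 'm) ring_scheme \<Rightarrow> ('a, 'p) module \<Rightarrow> bool" where
  "projective_module R P \<longleftrightarrow> module R P \<and>
     (\<exists>(I :: 'p set) s r. s \<in> mod_hom R P (free_module R I) \<and>
        r \<in> mod_hom R (free_module R I) P \<and> (\<forall>x \<in> carrier P. r (s x) = x))"

text \<open>The complex \<open>\<dots> \<rightarrow> P 2 \<rightarrow> P 1 \<rightarrow> P 0 \<rightarrow> M \<rightarrow> 0\<close>, with differentials \<open>\<delta> i : P (i + 1) \<rightarrow> P i\<close> and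
  augmentation \<open>\<epsilon> : P 0 \<rightarrow> M\<close>, is exact with projective \<open>P i\<close>.\<close>

definition projective_resolution ::
  "('a, 'm) ring_scheme \<Rightarrow> ('a, 'b, 'n) module_scheme \<Rightarrow> (nat \<Rightarrow> ('a, 'p) module) \<Rightarrow>
   (nat \<Rightarrow> 'p \<Rightarrow> 'p) \<Rightarrow> ('p \<Rightarrow> 'b) \<Rightarrow> bool" where
  "projective_resolution R M P \<delta> \<epsilon> \<longleftrightarrow>
     (\<forall>i. projective_module R (P i)) \<and>
     \<epsilon> \<in> mod_hom R (P 0) M \<and> \<epsilon> ` carrier (P 0) = carrier M \<and>
     (\<forall>i. \<delta> i \<in> mod_hom R (P (Suc i)) (P i)) \<and>
     \<delta> 0 ` carrier (P 1) = mod_ker (P 0) M \<epsilon> \<and>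
     (\<forall>i. \<delta> (Suc i) ` carrier (P (Suc (Suc i))) = mod_ker (P (Suc i)) (P i) (\<delta> i))"

text \<open>The least length of a projective resolution, \<open>\<infinity>\<close> if there is no finite one. Types cannot be
  quantified over, so the modules \<open>P i\<close> are taken with elements in \<open>nat \<Rightarrow> 'a\<close>, where \<open>'a\<close> is the
  type of the ring. Every countably generated module has an isomorphic copy there, so for a
  finitely generated module over a Noetherian ring this is the usual projective dimension: if some
  projective resolution of length \<open>l\<close> exists, then the \<open>l\<close>-th syzygy of any resolution by finitely
  generated free modules is projective and truncates it to one of length \<open>l\<close>.
  The zero module gets dimension \<open>0\<close>.\<close>

definition projective_dimension ::
  "('a, 'm) ring_scheme \<Rightarrow> ('a, 'b, 'n) module_scheme \<Rightarrow> enat" where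
  "projective_dimension R M = Inf {enat l | l.
     \<exists>(P :: nat \<Rightarrow> ('a, nat \<Rightarrow> 'a) module) \<delta> \<epsilon>.
       projective_resolution R M P \<delta> \<epsilon> \<and> (\<forall>i > l. carrier (P i) = {\<zero>\<^bsub>P i\<^esub>})}"

end

(* Let a_k be the number of cliques of size k and let c_m be the coefficient of t^m in
   K(t) = sum_k a_k t^k (1 - t)^(n - k), the numerator of the Hilbert series of R/I, where I is the
   edge ideal of the complement. If no clique has more than d vertices, (1 - t)^(n - d) divides K,
   so sum_m c_m m^j = 0 for j < n - d. The two identities are these equations, cut off at m = p + 2
   and rearranged using a_0 = 1 and a_1 = n; so it suffices that c_m = 0 for m > p + 2.

   Up to sign, c_m is the sum of the reduced Euler characteristics of the clique complexes of the
   induced subgraphs on m vertices. For a connected chordal graph this number vanishes, by induction: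
   if v is not a cut vertex, both G - v and the neighbourhood of v are connected and chordal. Hence
   c_m <> 0 yields an m-element set W that splits into parts A and B without edges of G between them.
   Then x_v (v in A), 0 (v in B) is a nontrivial Koszul 1-cocycle of R/I for the variables in W.
   Koszul cohomology of projective modules vanishes below degree m, and shifting degrees along a
   resolution of length l kills the cohomology of R/I below degree m - l; thus m <= l + 1. Finally
   p really is the length of some resolution, because the Taylor resolution is finite. *)
theory Submission
  imports Defs "HOL-Library.Countable"
begin

section \<open>Koszul cochains\<close>

text \<open>The length \<open>l\<close> belongs to an arbitrary projective resolution, neither
  graded nor minimal. Graded Betti numbers and Hochster's formula are therefore bypassed: a single
  inequality for disconnected vertex sets is enough. Koszul cochains suit this because they make
  sense over any module, are functorial, and turn whatever resolution is given into a dimension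
  shift, so that no derived functor has to be constructed. Nonvanishing is needed only in degree 1,
  where cocycles and coboundaries are explicit. That \<open>G\<close> is not complete gives d < n,
  which is exactly what the exponent j = 0 requires. For a complete graph p = 0 and the left-hand
  side of the first identity is 0 instead of 1. The cutoff m = p + 2 is dictated by the summation
  ranges of the identities; the cohomological bound is stronger by one.\<close>

abbreviation weight :: "bool list \<Rightarrow> nat" where
  "weight s \<equiv> count_list s True"

lemma weight_le_length: "weight s \<le> length s"
  by (rule count_le_length)

lemma weight_eq_length_iff: "weight s = length s \<longleftrightarrow> s = replicate (length s) True"
proof (induction s)
  case (Cons b s)
  then show ?case
    using weight_le_length[of s] by (cases b) auto
qed simp

lemma weight_eq_0_iff: "weight s = 0 \<longleftrightarrow> s = replicate (length s) False"
  by (induction s) auto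

text \<open>A Koszul cochain of \<open>M\<close> for a sequence \<open>xs\<close> assigns an element of \<open>M\<close> to each subset of the
  positions of \<open>xs\<close>, encoded as a Boolean string; the cohomological degree is the weight of the
  string. The recursion exhibits the complex of \<open>x # xs\<close> as the mapping cone of \<open>x\<close> on that of
  \<open>xs\<close>, so that no explicit signs are needed.\<close>

fun koszul_diff ::
  "('a, 'b, 'm) module_scheme \<Rightarrow> 'a list \<Rightarrow> (bool list \<Rightarrow> 'b) \<Rightarrow> bool list \<Rightarrow> 'b" where
  "koszul_diff M (x # xs) c (False # s) = koszul_diff M xs (\<lambda>t. c (False # t)) s"
| "koszul_diff M (x # xs) c (True # s) =
     x \<odot>\<^bsub>M\<^esub> c (False # s) \<ominus>\<^bsub>M\<^esub> koszul_diff M xs (\<lambda>t. c (True # t)) s"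
| "koszul_diff M _ c _ = \<zero>\<^bsub>M\<^esub>"

lemma koszul_diff_Nil [simp]: "koszul_diff M xs c [] = \<zero>\<^bsub>M\<^esub>"
  by (cases xs) auto

lemma koszul_diff_Cons: "koszul_diff M (x # xs) c (b # s) =
    (if b then x \<odot>\<^bsub>M\<^esub> c (False # s) \<ominus>\<^bsub>M\<^esub> koszul_diff M xs (\<lambda>t. c (True # t)) s
     else koszul_diff M xs (\<lambda>t. c (False # t)) s)"
  by (cases b) auto

text \<open>Only values in the degree just below that of \<open>s\<close> enter. Cochains are total
  functions on all strings, so this homogeneity is what allows changing or truncating them in the
  other degrees.\<close>

lemma koszul_diff_cong:
  assumes "length s = length xs"
    and "\<And>t. length t = length xs \<Longrightarrow> Suc (weight t) = weight s \<Longrightarrow> c t = c' t"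
  shows "koszul_diff M xs c s = koszul_diff M xs c' s"
  using assms
proof (induction xs arbitrary: c c' s)
  case (Cons x xs)
  obtain b u where s: "s = b # u" "length u = length xs"
    using Cons.prems(1) by (cases s) auto
  have "koszul_diff M xs (\<lambda>t. c (b # t)) u = koszul_diff M xs (\<lambda>t. c' (b # t)) u"
    by (rule Cons.IH) (use s Cons.prems(2) in auto)
  then show ?case
    using s Cons.prems(2)[of "False # u"] by (cases b) auto
qed simp

lemma koszul_diff_weight_0:
  "length s = length xs \<Longrightarrow> weight s = 0 \<Longrightarrow> koszul_diff M xs c s = \<zero>\<^bsub>M\<^esub>"
  by (induction M xs c s rule: koszul_diff.induct) auto

context module
begin

lemma koszul_diff_closed [intro, simp]:
  "set xs \<subseteq> carrier R \<Longrightarrow> (\<And>t. c t \<in> carrier M) \<Longrightarrow> koszul_diff M xs c s \<in> carrier M"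
proof (induction xs arbitrary: c s)
  case (Cons x xs)
  then show ?case
    by (cases s) (auto simp: koszul_diff_Cons)
qed simp

lemma diff_diff_eq_zero:
  "a \<in> carrier M \<Longrightarrow> b \<in> carrier M \<Longrightarrow> a \<ominus>\<^bsub>M\<^esub> (a \<ominus>\<^bsub>M\<^esub> b) = b"
  by (simp add: M.minus_add M.minus_minus M.r_neg1 M.r_neg2 a_minus_def)

lemma diff_eq_zero_iff:
  "a \<in> carrier M \<Longrightarrow> b \<in> carrier M \<Longrightarrow> a \<ominus>\<^bsub>M\<^esub> b = \<zero>\<^bsub>M\<^esub> \<longleftrightarrow> a = b"
  using diff_diff_eq_zero[of a b] by (auto simp: a_minus_def M.r_neg)

lemma diff_diff_interchange:
  "a \<in> carrier M \<Longrightarrow> b \<in> carrier M \<Longrightarrow> c \<in> carrier M \<Longrightarrow> d \<in> carrier M \<Longrightarrow>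
    (a \<ominus>\<^bsub>M\<^esub> b) \<ominus>\<^bsub>M\<^esub> (c \<ominus>\<^bsub>M\<^esub> d) = (a \<ominus>\<^bsub>M\<^esub> c) \<ominus>\<^bsub>M\<^esub> (b \<ominus>\<^bsub>M\<^esub> d)"
  by (simp add: M.minus_add M.minus_minus M.a_ac a_minus_def)

lemma smult_r_diff:
  "a \<in> carrier R \<Longrightarrow> x \<in> carrier M \<Longrightarrow> y \<in> carrier M \<Longrightarrow>
    a \<odot>\<^bsub>M\<^esub> (x \<ominus>\<^bsub>M\<^esub> y) = a \<odot>\<^bsub>M\<^esub> x \<ominus>\<^bsub>M\<^esub> a \<odot>\<^bsub>M\<^esub> y"
  by (simp add: a_minus_def smult_r_distr smult_r_minus)

lemma koszul_diff_smult:
  assumes "set xs \<subseteq> carrier R" "\<And>t. c t \<in> carrier M" "a \<in> carrier R"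
  shows "koszul_diff M xs (\<lambda>t. a \<odot>\<^bsub>M\<^esub> c t) s = a \<odot>\<^bsub>M\<^esub> koszul_diff M xs c s"
  using assms
proof (induction xs arbitrary: c s)
  case (Cons x xs)
  then show ?case
    by (cases s) (auto simp: koszul_diff_Cons smult_r_diff smult_assoc1[symmetric] R.m_comm)
qed simp

lemma koszul_diff_diff:
  assumes "set xs \<subseteq> carrier R" "\<And>t. c t \<in> carrier M" "\<And>t. c' t \<in> carrier M"
  shows "koszul_diff M xs (\<lambda>t. c t \<ominus>\<^bsub>M\<^esub> c' t) s = koszul_diff M xs c s \<ominus>\<^bsub>M\<^esub> koszul_diff M xs c' s"
  using assms
proof (induction xs arbitrary: c c' s)
  case Nil
  then show ?case by (metis M.zero_closed diff_eq_zero_iff koszul_diff.simps(3))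
next
  case (Cons x xs)
  then show ?case
    by (cases s) (auto simp: koszul_diff_Cons smult_r_diff diff_diff_interchange diff_eq_zero_iff[THEN iffD2])
qed

text \<open>On the \<open>True\<close> part of the cone the two copies of \<open>x\<close> times the
  differential of the \<open>False\<close> part cancel; what remains is the square of the
  differential for \<open>xs\<close>.\<close>

lemma koszul_diff_koszul_diff:
  assumes "set xs \<subseteq> carrier R" "\<And>t. c t \<in> carrier M"
  shows "koszul_diff M xs (koszul_diff M xs c) s = \<zero>\<^bsub>M\<^esub>"
  using assms
proof (induction xs arbitrary: c s)
  case (Cons x xs)
  show ?case
  proof (cases s)
    case s: (Cons b u)
    have IH: "koszul_diff M xs (koszul_diff M xs (\<lambda>t. c (b # t))) u = \<zero>\<^bsub>M\<^esub>" for b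
      using Cons by simp
    show ?thesis
      using Cons.prems IH[of False] IH[of True]
      by (simp add: s koszul_diff_Cons koszul_diff_diff koszul_diff_smult diff_diff_eq_zero)
  qed simp
qed simp

end

section \<open>Homomorphisms and naturality of the Koszul differential\<close>

lemma mod_homD:
  assumes "h \<in> mod_hom R M N"
  shows mod_hom_closed: "x \<in> carrier M \<Longrightarrow> h x \<in> carrier N"
    and mod_hom_add: "x \<in> carrier M \<Longrightarrow> y \<in> carrier M \<Longrightarrow> h (x \<oplus>\<^bsub>M\<^esub> y) = h x \<oplus>\<^bsub>N\<^esub> h y"
    and mod_hom_smult: "r \<in> carrier R \<Longrightarrow> x \<in> carrier M \<Longrightarrow> h (r \<odot>\<^bsub>M\<^esub> x) = r \<odot>\<^bsub>N\<^esub> h x"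
  using assms by (auto simp: mod_hom_def)

lemma mod_hom_zero:
  assumes "module R M" "module R N" "h \<in> mod_hom R M N"
  shows "h \<zero>\<^bsub>M\<^esub> = \<zero>\<^bsub>N\<^esub>"
proof -
  interpret M: module R M by fact
  interpret N: module R N by fact
  show ?thesis
    using mod_homD[OF assms(3)] by (metis M.M.l_zero M.M.zero_closed N.M.add.l_cancel_one')
qed

lemma mod_hom_diff:
  assumes "module R M" "module R N" "h \<in> mod_hom R M N" "x \<in> carrier M" "y \<in> carrier M"
  shows "h (x \<ominus>\<^bsub>M\<^esub> y) = h x \<ominus>\<^bsub>N\<^esub> h y"
proof -
  interpret M: module R M by fact
  interpret N: module R N by fact
  note h = mod_homD[OF assms(3)]
  have "h (x \<ominus>\<^bsub>M\<^esub> y) \<oplus>\<^bsub>N\<^esub> h y = h x"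
    using assms(4,5) h(2)[of "x \<ominus>\<^bsub>M\<^esub> y" y] by (simp add: M.M.a_assoc M.M.l_neg a_minus_def)
  then show ?thesis
    using assms(4,5) h(1) by (metis M.M.minus_closed N.M.add.inv_solve_right' a_minus_def)
qed

lemma koszul_diff_hom:
  assumes "module R M" "module R N" "h \<in> mod_hom R M N" "set xs \<subseteq> carrier R"
    and "\<And>t. c t \<in> carrier M"
  shows "koszul_diff N xs (\<lambda>t. h (c t)) s = h (koszul_diff M xs c s)"
proof -
  interpret M: module R M by fact
  note h = mod_homD[OF assms(3)] and h0 = mod_hom_zero[OF assms(1-3)] and hm = mod_hom_diff[OF assms(1-3)]
  show ?thesis
    using assms(4,5)
  proof (induction xs arbitrary: c s)
    case (Cons x xs)
    then show ?case
      by (cases s) (simp_all add: koszul_diff_Cons hm h(3) h0)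
  qed (simp add: h0)
qed

text \<open>Taking a subset \<open>Z\<close> of \<open>M\<close> rather than a module allows for kernels without restricting the
  record \<open>M\<close> to them. In degree \<open>0\<close> exactness means that the cocycle vanishes, as there
  \<open>koszul_diff\<close> is zero.\<close>

definition koszul_exact_below ::
  "('a, 'b, 'm) module_scheme \<Rightarrow> 'b set \<Rightarrow> 'a list \<Rightarrow> nat \<Rightarrow> bool" where
  "koszul_exact_below M Z xs t \<longleftrightarrow> (\<forall>j < t. \<forall>c. (\<forall>s. c s \<in> Z) \<and>
     (\<forall>s. length s = length xs \<and> weight s = Suc j \<longrightarrow> koszul_diff M xs c s = \<zero>\<^bsub>M\<^esub>) \<longrightarrow>
     (\<exists>b. (\<forall>s. b s \<in> Z) \<and>
       (\<forall>s. length s = length xs \<and> weight s = j \<longrightarrow> koszul_diff M xs b s = c s)))"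

lemma koszul_exact_belowD:
  assumes "koszul_exact_below M Z xs t" "j < t" "\<And>s. c s \<in> Z"
    and "\<And>s. length s = length xs \<Longrightarrow> weight s = Suc j \<Longrightarrow> koszul_diff M xs c s = \<zero>\<^bsub>M\<^esub>"
  shows "\<exists>b. (\<forall>s. b s \<in> Z) \<and>
    (\<forall>s. length s = length xs \<and> weight s = j \<longrightarrow> koszul_diff M xs b s = c s)"
  using assms unfolding koszul_exact_below_def by blast

text \<open>Since the complex of \<open>x # xs\<close> is a mapping cone, exactness reduces to injectivity of \<open>x\<close> on
  the top cohomology of \<open>xs\<close>, which is the quotient of \<open>M\<close> by the submodule \<open>(xs)M\<close>.\<close>

lemma (in module) koszul_exact_below_length:
  assumes "set xs \<subseteq> carrier R"
    and "\<And>us x ys y b. xs = us @ x # ys \<Longrightarrow> y \<in> carrier M \<Longrightarrow> (\<And>s. b s \<in> carrier M) \<Longrightarrow>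
      x \<odot>\<^bsub>M\<^esub> y = koszul_diff M ys b (replicate (length ys) True) \<Longrightarrow>
      \<exists>e. (\<forall>s. e s \<in> carrier M) \<and> y = koszul_diff M ys e (replicate (length ys) True)"
  shows "koszul_exact_below M (carrier M) xs (length xs)"
  using assms
proof (induction xs)
  case Nil
  then show ?case by (simp add: koszul_exact_below_def)
next
  case (Cons x xs)
  have x: "x \<in> carrier R" and xs: "set xs \<subseteq> carrier R"
    using Cons.prems by auto
  have IH: "koszul_exact_below M (carrier M) xs (length xs)"
  proof (rule Cons.IH[OF xs])
    fix us x' ys y b
    assume "xs = us @ x' # ys" "y \<in> carrier M" "\<And>s. b s \<in> carrier M"
      "x' \<odot>\<^bsub>M\<^esub> y = koszul_diff M ys b (replicate (length ys) True)"
    then show "\<exists>e. (\<forall>s. e s \<in> carrier M) \<and> y = koszul_diff M ys e (replicate (length ys) True)"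
      by (intro Cons.prems(2)[of "x # us" x' ys y b]) auto
  qed
  show ?case
    unfolding koszul_exact_below_def
  proof (intro allI impI, elim conjE)
    fix j c
    assume j: "j < length (x # xs)" and c: "\<forall>s. c s \<in> carrier M"
      and cocycle: "\<forall>s. length s = length (x # xs) \<and> weight s = Suc j \<longrightarrow>
        koszul_diff M (x # xs) c s = \<zero>\<^bsub>M\<^esub>"
    have cF: "koszul_diff M xs (\<lambda>t. c (False # t)) s = \<zero>\<^bsub>M\<^esub>"
      if "length s = length xs" "weight s = Suc j" for s
      using cocycle[rule_format, of "False # s"] that by simp
    have cT: "x \<odot>\<^bsub>M\<^esub> c (False # s) = koszul_diff M xs (\<lambda>t. c (True # t)) s"
      if "length s = length xs" "weight s = j" for s
      by (rule iffD1[OF diff_eq_zero_iff]) (use cocycle[rule_format, of "True # s"] that c x xs in auto)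
    have "\<exists>e. (\<forall>s. e s \<in> carrier M) \<and>
        (\<forall>s. length s = length xs \<and> weight s = j \<longrightarrow> koszul_diff M xs e s = c (False # s))"
    proof (cases "j < length xs")
      case True
      then show ?thesis
        by (rule koszul_exact_belowD[OF IH]) (use cF c in auto)
    next
      case False
      \<comment> \<open>The top degree of \<open>xs\<close> has a single string \<open>?T\<close>.
        By \<open>cT\<close>, \<open>x\<close> maps the class of \<open>c (False # ?T)\<close> to
        zero there, so the injectivity hypothesis makes it a boundary.\<close>
      then have j: "j = length xs" using j by simp
      let ?T = "replicate (length xs) True"
      obtain e where "\<forall>s. e s \<in> carrier M" "c (False # ?T) = koszul_diff M xs e ?T"
        by (rule exE, rule Cons.prems(2)[of "[]" x xs "c (False # ?T)" "\<lambda>s. c (True # s)"])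
          (use c cT[of ?T] j weight_eq_length_iff[of ?T] in auto)
      moreover have "s = ?T" if "length s = length xs" "weight s = j" for s
        using that weight_eq_length_iff[of s] j by simp
      ultimately show ?thesis by (intro exI[of _ e]) auto
    qed
    then obtain e where e: "\<And>s. e s \<in> carrier M"
      and ec: "\<And>s. length s = length xs \<Longrightarrow> weight s = j \<Longrightarrow> koszul_diff M xs e s = c (False # s)"
      by blast
    \<comment> \<open>The cochain \<open>e\<close> settles the \<open>False\<close> part. The error
      it leaves on the \<open>True\<close> part is a cocycle for \<open>xs\<close> of degree
      \<open>j - 1\<close>; for \<open>j = 0\<close> there are no strings to consider.\<close>
    have "\<exists>g. (\<forall>s. g s \<in> carrier M) \<and> (\<forall>s. length s = length xs \<and> Suc (weight s) = j \<longrightarrow>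
        koszul_diff M xs g s = x \<odot>\<^bsub>M\<^esub> e s \<ominus>\<^bsub>M\<^esub> c (True # s))"
    proof (cases j)
      case 0
      then show ?thesis using c by auto
    next
      case (Suc i)
      then have i: "i < length xs" using j by simp
      let ?c = "\<lambda>s. x \<odot>\<^bsub>M\<^esub> e s \<ominus>\<^bsub>M\<^esub> c (True # s)"
      have "koszul_diff M xs ?c s = \<zero>\<^bsub>M\<^esub>" if "length s = length xs" "weight s = Suc i" for s
        using that c x xs e ec[of s] cT[of s] Suc
        by (simp add: koszul_diff_diff koszul_diff_smult diff_eq_zero_iff[THEN iffD2])
      moreover have "?c s \<in> carrier M" for s
        using e c x by simp
      ultimately show ?thesis
        using koszul_exact_belowD[OF IH i, of ?c] Suc by simp
    qed
    then obtain g where g: "\<And>s. g s \<in> carrier M"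
      and gc: "\<And>s. length s = length xs \<Longrightarrow> Suc (weight s) = j \<Longrightarrow>
        koszul_diff M xs g s = x \<odot>\<^bsub>M\<^esub> e s \<ominus>\<^bsub>M\<^esub> c (True # s)"
      by blast
    \<comment> \<open>On \<open>True\<close> strings the cone formula subtracts the differential of
      \<open>g\<close>, which is the error, from \<open>x\<close> times \<open>e\<close>; this gives
      back \<open>c\<close>.\<close>
    let ?b = "\<lambda>s. case s of [] \<Rightarrow> \<zero>\<^bsub>M\<^esub> | b # t \<Rightarrow> if b then g t else e t"
    have "?b s \<in> carrier M" for s
      using e g by (auto split: list.split)
    moreover have "koszul_diff M (x # xs) ?b s = c s"
      if "length s = length (x # xs)" "weight s = j" for s
    proof (cases s)
      case s: (Cons b t)
      show ?thesis
        using that e c x ec[of t] gc[of t] by (cases b) (auto simp: s diff_diff_eq_zero)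
    qed (use that in simp)
    ultimately show "\<exists>b. (\<forall>s. b s \<in> carrier M) \<and>
        (\<forall>s. length s = length (x # xs) \<and> weight s = j \<longrightarrow> koszul_diff M (x # xs) b s = c s)"
      by blast
  qed
qed

text \<open>Dimension shift along 0 -> ker h -> P -> im h -> 0: where the cohomology of
  \<open>P\<close> vanishes in degree \<open>j\<close>, that of the image embeds into the cohomology
  of the kernel in degree \<open>j + 1\<close>. The proof chases this connecting map:
  \<open>b\<close> lifts \<open>c\<close>, and \<open>z\<close> corrects \<open>b\<close> to a
  cocycle.\<close>

lemma koszul_exact_below_image:
  assumes "module R P" "module R N" and h: "h \<in> mod_hom R P N" and xs: "set xs \<subseteq> carrier R"
    and P: "koszul_exact_below P (carrier P) xs m"
    and Z: "koszul_exact_below P (mod_ker P N h) xs (Suc t)" and "t \<le> m"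
  shows "koszul_exact_below N (h ` carrier P) xs t"
  unfolding koszul_exact_below_def
proof (intro allI impI, elim conjE)
  interpret P: module R P by fact
  interpret N: module R N by fact
  fix j c
  assume j: "j < t" and c: "\<forall>s. c s \<in> h ` carrier P"
    and cocycle: "\<forall>s. length s = length xs \<and> weight s = Suc j \<longrightarrow> koszul_diff N xs c s = \<zero>\<^bsub>N\<^esub>"
  have "\<forall>s. \<exists>y. y \<in> carrier P \<and> c s = h y"
    using c by blast
  then have "\<exists>b. \<forall>s. b s \<in> carrier P \<and> c s = h (b s)"
    by (rule choice)
  then obtain b where b: "\<And>s. b s \<in> carrier P" and cb: "c = (\<lambda>s. h (b s))"
    by blast
  note hom = koszul_diff_hom[OF assms(1,2) h xs]
  \<comment> \<open>All values must lie in the kernel, but the differential of \<open>b\<close> is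
    known to do so only in degree \<open>j + 1\<close>, where \<open>c\<close> satisfies the cocycle
    condition. Hence the truncation by zero.\<close>
  let ?z = "\<lambda>s. if length s = length xs \<and> weight s = Suc j then koszul_diff P xs b s else \<zero>\<^bsub>P\<^esub>"
  have "?z s \<in> mod_ker P N h" for s
    using cocycle b xs hom[of b s] mod_hom_zero[OF assms(1,2) h] by (auto simp: mod_ker_def cb)
  moreover have "koszul_diff P xs ?z s = \<zero>\<^bsub>P\<^esub>" if "length s = length xs" "weight s = Suc (Suc j)" for s
  proof -
    have "koszul_diff P xs ?z s = koszul_diff P xs (koszul_diff P xs b) s"
      by (rule koszul_diff_cong) (use that in auto)
    then show ?thesis
      using P.koszul_diff_koszul_diff[OF xs b] by simp
  qed
  ultimately have "\<exists>z. (\<forall>s. z s \<in> mod_ker P N h) \<and>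
      (\<forall>s. length s = length xs \<and> weight s = Suc j \<longrightarrow> koszul_diff P xs z s = ?z s)"
    using j by (intro koszul_exact_belowD[OF Z]) blast+
  then obtain z where z: "\<And>s. z s \<in> mod_ker P N h"
    and zb: "\<And>s. length s = length xs \<Longrightarrow> weight s = Suc j \<Longrightarrow> koszul_diff P xs z s = ?z s"
    by blast
  have zP: "z s \<in> carrier P" and hz: "h (z s) = \<zero>\<^bsub>N\<^esub>" for s
    using z[of s] by (auto simp: mod_ker_def)
  \<comment> \<open>Still a lift of \<open>c\<close>, since \<open>h\<close> kills \<open>z\<close>,
    and now a cocycle of \<open>P\<close>.\<close>
  let ?y = "\<lambda>s. b s \<ominus>\<^bsub>P\<^esub> z s"
  have "koszul_diff P xs ?y s = \<zero>\<^bsub>P\<^esub>" if "length s = length xs" "weight s = Suc j" for s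
    using that b zP xs zb[of s] by (simp add: P.koszul_diff_diff P.diff_eq_zero_iff)
  moreover have "?y s \<in> carrier P" for s
    using b zP by simp
  ultimately have "\<exists>e. (\<forall>s. e s \<in> carrier P) \<and>
      (\<forall>s. length s = length xs \<and> weight s = j \<longrightarrow> koszul_diff P xs e s = ?y s)"
    using j \<open>t \<le> m\<close> by (intro koszul_exact_belowD[OF P]) simp_all
  then obtain e where e: "\<And>s. e s \<in> carrier P"
    and ey: "\<And>s. length s = length xs \<Longrightarrow> weight s = j \<Longrightarrow> koszul_diff P xs e s = ?y s"
    by blast
  have "koszul_diff N xs (\<lambda>t. h (e t)) s = c s" if "length s = length xs" "weight s = j" for s
    using that hom[of e s] e ey b zP mod_hom_diff[OF assms(1,2) h b zP] hz mod_homD(1)[OF h b]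
    by (simp add: cb a_minus_def)
  then show "\<exists>b. (\<forall>s. b s \<in> h ` carrier P) \<and>
      (\<forall>s. length s = length xs \<and> weight s = j \<longrightarrow> koszul_diff N xs b s = c s)"
    using e by (intro exI[of _ "\<lambda>t. h (e t)"]) auto
qed

section \<open>Vanishing along projective resolutions\<close>

lemma koszul_exact_below_singleton_zero:
  assumes "module R M" "set xs \<subseteq> carrier R"
  shows "koszul_exact_below M {\<zero>\<^bsub>M\<^esub>} xs t"
proof -
  interpret M: module R M by fact
  have "koszul_diff M xs (\<lambda>_. \<zero>\<^bsub>M\<^esub>) s = \<zero>\<^bsub>M\<^esub>" for s
    using M.koszul_diff_smult[OF assms(2), of "\<lambda>_. \<zero>\<^bsub>M\<^esub>" "\<zero>\<^bsub>R\<^esub>" s] M.koszul_diff_closed[OF assms(2), of "\<lambda>_. \<zero>\<^bsub>M\<^esub>" s]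
    by simp
  then show ?thesis
    unfolding koszul_exact_below_def by (intro allI impI exI[of _ "\<lambda>_. \<zero>\<^bsub>M\<^esub>"]) auto
qed

text \<open>Push a cocycle into \<open>F\<close>, bound it there, and pull the bounding cochain back
  along \<open>r\<close>. This carries vanishing from free to projective modules.\<close>

lemma koszul_exact_below_retract:
  assumes "module R M" "module R F" "set xs \<subseteq> carrier R"
    and s: "s \<in> mod_hom R M F" and r: "r \<in> mod_hom R F M" and rs: "\<And>x. x \<in> carrier M \<Longrightarrow> r (s x) = x"
    and F: "koszul_exact_below F (carrier F) xs t"
  shows "koszul_exact_below M (carrier M) xs t"
  unfolding koszul_exact_below_def
proof (intro allI impI, elim conjE)
  fix j c
  assume j: "j < t" and c: "\<forall>u. c u \<in> carrier M"
    and cocycle: "\<forall>u. length u = length xs \<and> weight u = Suc j \<longrightarrow> koszul_diff M xs c u = \<zero>\<^bsub>M\<^esub>"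
  have "s (c u) \<in> carrier F" for u
    using c mod_hom_closed[OF s] by blast
  moreover have "koszul_diff F xs (\<lambda>u. s (c u)) u = \<zero>\<^bsub>F\<^esub>" if "length u = length xs" "weight u = Suc j" for u
    using koszul_diff_hom[OF assms(1,2) s assms(3), of c u] cocycle that mod_hom_zero[OF assms(1,2) s] c
    by simp
  ultimately have "\<exists>b. (\<forall>u. b u \<in> carrier F) \<and>
     (\<forall>u. length u = length xs \<and> weight u = j \<longrightarrow> koszul_diff F xs b u = s (c u))"
    using j by (intro koszul_exact_belowD[OF F]) blast+
  then obtain b where b: "\<And>u. b u \<in> carrier F"
    and bc: "\<And>u. length u = length xs \<Longrightarrow> weight u = j \<Longrightarrow> koszul_diff F xs b u = s (c u)"
    by blast
  have "koszul_diff M xs (\<lambda>u. r (b u)) u = c u" if "length u = length xs" "weight u = j" for u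
    using koszul_diff_hom[OF assms(2,1) r assms(3), of b u] b bc that rs c by simp
  moreover have "r (b u) \<in> carrier M" for u
    using b mod_hom_closed[OF r] by blast
  ultimately show "\<exists>b. (\<forall>u. b u \<in> carrier M) \<and>
      (\<forall>u. length u = length xs \<and> weight u = j \<longrightarrow> koszul_diff M xs b u = c u)"
    by (intro exI[of _ "\<lambda>u. r (b u)"]) blast
qed

lemma koszul_exact_below_resolved:
  fixes P :: "nat \<Rightarrow> ('a, 'p) module"
  assumes "module R M" and xs: "set xs \<subseteq> carrier R"
    and res: "projective_resolution R M P \<delta> \<epsilon>"
    and trivial: "\<And>i. i > l \<Longrightarrow> carrier (P i) = {\<zero>\<^bsub>P i\<^esub>}"
    and free: "\<And>I :: 'p set. module R (free_module R I)"
      "\<And>I :: 'p set. koszul_exact_below (free_module R I) (carrier (free_module R I)) xs m"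
    and "l \<le> m"
  shows "koszul_exact_below M (carrier M) xs (m - l)"
proof -
  have modP: "module R (P i)" and \<epsilon>: "\<epsilon> \<in> mod_hom R (P 0) M" and surj: "\<epsilon> ` carrier (P 0) = carrier M"
    and \<delta>: "\<delta> i \<in> mod_hom R (P (Suc i)) (P i)"
    and ker0: "\<delta> 0 ` carrier (P 1) = mod_ker (P 0) M \<epsilon>"
    and ker: "\<delta> (Suc i) ` carrier (P (Suc (Suc i))) = mod_ker (P (Suc i)) (P i) (\<delta> i)" for i
    using res unfolding projective_resolution_def projective_module_def by auto
  have P: "koszul_exact_below (P i) (carrier (P i)) xs m" for i
  proof -
    have "projective_module R (P i)"
      using res by (simp add: projective_resolution_def)
    then obtain I :: "'p set" and s r where "s \<in> mod_hom R (P i) (free_module R I)"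
      "r \<in> mod_hom R (free_module R I) (P i)" "\<forall>x \<in> carrier (P i). r (s x) = x"
      unfolding projective_module_def by blast
    then show ?thesis
      using koszul_exact_below_retract[OF modP free(1) xs _ _ _ free(2)] by blast
  qed
  \<comment> \<open>Descending induction from the zero image at \<open>i = l\<close>. Every step
    towards \<open>P 0\<close> costs one degree; the starting value \<open>Suc m\<close> pays in
    advance for the final step along \<open>\<epsilon>\<close>.\<close>
  have "koszul_exact_below (P i) (\<delta> i ` carrier (P (Suc i))) xs (Suc (m - (l - i)))" if "i \<le> l" for i
    using that
  proof (induction rule: inc_induct)
    case base
    have "\<delta> l ` carrier (P (Suc l)) = {\<zero>\<^bsub>P l\<^esub>}"
      using trivial[of "Suc l"] mod_hom_zero[OF modP modP \<delta>] by simp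
    then show ?case
      using koszul_exact_below_singleton_zero[OF modP xs] by simp
  next
    case (step i)
    have "koszul_exact_below (P (Suc i)) (mod_ker (P (Suc i)) (P i) (\<delta> i)) xs (Suc (m - (l - Suc i)))"
      using step.IH ker by simp
    from koszul_exact_below_image[OF modP modP \<delta> xs P this]
    show ?case
      using step.hyps \<open>l \<le> m\<close> by (simp add: Suc_diff_le Suc_diff_Suc)
  qed
  from this[of 0] have "koszul_exact_below (P 0) (mod_ker (P 0) M \<epsilon>) xs (Suc (m - l))"
    using ker0 by simp
  from koszul_exact_below_image[OF modP assms(1) \<epsilon> xs P this] show ?thesis
    using surj by simp
qed

text \<open>The vanishing of first cohomology in coordinates: a 1-cochain is a family
  \<open>y\<close>, the hypothesis \<open>sym\<close> is the cocycle condition, and the conclusion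
  says that the family is a coboundary. The work lies in passing between vertices and strings of
  weight 1.\<close>

lemma koszul_exact_degree_1:
  assumes "module R M" and f: "f ` set vs \<subseteq> carrier R" and y: "y ` set vs \<subseteq> carrier M"
    and exact: "koszul_exact_below M (carrier M) (map f vs) t" and t: "1 < t"
    and sym: "\<And>u v. u \<in> set vs \<Longrightarrow> v \<in> set vs \<Longrightarrow> f u \<odot>\<^bsub>M\<^esub> y v = f v \<odot>\<^bsub>M\<^esub> y u"
  shows "\<exists>r \<in> carrier M. \<forall>v \<in> set vs. y v = f v \<odot>\<^bsub>M\<^esub> r"
proof -
  interpret M: module R M by fact
  \<comment> \<open>The position of the first \<open>True\<close> selects the vertex; only strings
    of weight 1 matter. The list is a parameter so that one can induct on it, and the zero default
    keeps all values in the carrier.\<close>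
  define c where "c vs s = (if True \<in> set s \<and> length s = length vs
    then y (vs ! length (takeWhile Not s)) else \<zero>\<^bsub>M\<^esub>)" for vs s
  have less: "length (takeWhile Not s) < length s" if "True \<in> set s" for s
    using that by (induction s) auto
  have c_closed: "c us s \<in> carrier M" if "set us \<subseteq> set vs" for us s
    using that y less[of s] nth_mem[of "length (takeWhile Not s)" us] unfolding c_def
    by (smt (verit) M.zero_closed image_subset_iff subset_iff)
  have c_False: "c (u # us) (False # s) = c us s" for u us s
    by (auto simp: c_def)
  have c_True: "c (u # us) (True # s) = y u" if "length s = length us" for u us s
    using that by (auto simp: c_def)
  \<comment> \<open>A string of weight 1 marks one vertex \<open>v\<close>, and a 1-coboundary takes
    there the value \<open>f v\<close> times the unique value in degree 0. No sign arises, because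
    the subtracted term of the cone has degree 0 where \<open>v\<close> is marked.\<close>
  have degree_1: "\<exists>v \<in> set us. c us s = y v \<and>
      (\<forall>b. (\<forall>s. b s \<in> carrier M) \<longrightarrow> koszul_diff M (map f us) b s = f v \<odot>\<^bsub>M\<^esub> b (replicate (length us) False))"
    if "length s = length us" "weight s = 1" "set us \<subseteq> set vs" for us s
    using that
  proof (induction us arbitrary: s)
    case (Cons u us)
    then obtain b s' where s: "s = b # s'" "length s' = length us" by (cases s) auto
    show ?case
    proof (cases b)
      case True
      then have "weight s' = 0" using Cons.prems s by simp
      then have "s' = replicate (length us) False" "koszul_diff M (map f us) e s' = \<zero>\<^bsub>M\<^esub>" for e
        using s weight_eq_0_iff[of s'] koszul_diff_weight_0[of s' "map f us" M e] by auto
      then show ?thesis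
        using s True Cons.prems f by (auto simp: c_True a_minus_def)
    next
      case False
      obtain v where v: "v \<in> set us" "c us s' = y v"
        "\<And>b. (\<forall>s. b s \<in> carrier M) \<Longrightarrow>
          koszul_diff M (map f us) b s' = f v \<odot>\<^bsub>M\<^esub> b (replicate (length us) False)"
        using Cons.IH[of s'] s False Cons.prems by auto
      show ?thesis
        by (rule bexI[of _ v]) (use v s False in \<open>auto simp: c_False\<close>)
    qed
  qed simp
  have degree_1_conv: "\<exists>s. length s = length us \<and> weight s = 1 \<and> c us s = y v \<and>
      (\<forall>b. (\<forall>s. b s \<in> carrier M) \<longrightarrow> koszul_diff M (map f us) b s = f v \<odot>\<^bsub>M\<^esub> b (replicate (length us) False))"
    if "v \<in> set us" "set us \<subseteq> set vs" for v us
    using that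
  proof (induction us)
    case (Cons u us)
    show ?case
    proof (cases "v = u")
      case True
      have "koszul_diff M (map f us) e (replicate (length us) False) = \<zero>\<^bsub>M\<^esub>" for e
        by (rule koszul_diff_weight_0) (auto simp: weight_eq_0_iff)
      moreover have "weight (replicate (length us) False) = 0"
        by (simp add: weight_eq_0_iff)
      ultimately show ?thesis
        using True Cons.prems f
        by (intro exI[of _ "True # replicate (length us) False"]) (auto simp: c_True a_minus_def)
    next
      case False
      then obtain s where s: "length s = length us" "weight s = 1" "c us s = y v"
        "\<And>b. (\<forall>s. b s \<in> carrier M) \<Longrightarrow>
          koszul_diff M (map f us) b s = f v \<odot>\<^bsub>M\<^esub> b (replicate (length us) False)"
        using Cons by auto
      show ?thesis
        by (rule exI[of _ "False # s"]) (use s in \<open>auto simp: c_False\<close>)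
    qed
  qed simp
  have cocycle: "koszul_diff M (map f us) (c us) s = \<zero>\<^bsub>M\<^esub>"
    if "length s = length us" "weight s = 2" "set us \<subseteq> set vs" for us s
    using that
  proof (induction us arbitrary: s)
    case (Cons u us)
    then obtain b s' where s: "s = b # s'" "length s' = length us" by (cases s) auto
    show ?case
    proof (cases b)
      case True
      then have "weight s' = 1" using Cons.prems s by simp
      then obtain v where v: "v \<in> set us" "c us s' = y v"
        "\<And>b. (\<forall>s. b s \<in> carrier M) \<Longrightarrow>
          koszul_diff M (map f us) b s' = f v \<odot>\<^bsub>M\<^esub> b (replicate (length us) False)"
        using degree_1[of s' us] s Cons.prems by auto
      \<comment> \<open>With \<open>u\<close> and \<open>v\<close> marked, the differential is the
        difference of \<open>f u\<close> times \<open>y v\<close> and \<open>f v\<close> times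
        \<open>y u\<close>, which \<open>sym\<close> annihilates.\<close>
      have "koszul_diff M (map f us) (\<lambda>t. c (u # us) (True # t)) s' = f v \<odot>\<^bsub>M\<^esub> y u"
        using v(3)[of "\<lambda>t. c (u # us) (True # t)"] c_closed[of "u # us"] Cons.prems by (auto simp: c_True)
      moreover have "f u \<odot>\<^bsub>M\<^esub> y v = f v \<odot>\<^bsub>M\<^esub> y u"
        using sym v Cons.prems by auto
      moreover have "f v \<odot>\<^bsub>M\<^esub> y u \<in> carrier M"
        using v(1) Cons.prems f y by (intro M.smult_closed) auto
      ultimately show ?thesis
        using True s v(2) by (simp add: c_False M.diff_eq_zero_iff)
    next
      case False
      then show ?thesis
        using s Cons by (simp add: c_False)
    qed
  qed simp
  have "\<exists>b. (\<forall>s. b s \<in> carrier M) \<and>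
      (\<forall>s. length s = length (map f vs) \<and> weight s = 1 \<longrightarrow> koszul_diff M (map f vs) b s = c vs s)"
    using c_closed[of vs] cocycle[of _ vs] by (intro koszul_exact_belowD[OF exact t]) auto
  then obtain b where b: "\<And>s. b s \<in> carrier M"
    and bc: "\<And>s. length s = length vs \<Longrightarrow> weight s = 1 \<Longrightarrow> koszul_diff M (map f vs) b s = c vs s"
    by auto
  have "y v = f v \<odot>\<^bsub>M\<^esub> b (replicate (length vs) False)" if "v \<in> set vs" for v
    using degree_1_conv[OF that order_refl] b bc by metis
  then show ?thesis
    using b by blast
qed

section \<open>Free modules\<close>

lemma free_module_simps [simp]:
  "\<zero>\<^bsub>free_module R I\<^esub> = (\<lambda>_. \<zero>\<^bsub>R\<^esub>)"
  "b \<oplus>\<^bsub>free_module R I\<^esub> c = (\<lambda>i. b i \<oplus>\<^bsub>R\<^esub> c i)"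
  "r \<odot>\<^bsub>free_module R I\<^esub> c = (\<lambda>i. r \<otimes>\<^bsub>R\<^esub> c i)"
  by (simp_all add: free_module_def)

lemma carrier_free_module:
  "carrier (free_module R I) =
     {c. (\<forall>i. c i \<in> carrier R) \<and> finite {i. c i \<noteq> \<zero>\<^bsub>R\<^esub>} \<and> {i. c i \<noteq> \<zero>\<^bsub>R\<^esub>} \<subseteq> I}"
  by (simp add: free_module_def)

lemma module_free_module:
  assumes "cring R"
  shows "module R (free_module R I)"
proof -
  interpret R: cring R by fact
  have add: "(\<lambda>i. b i \<oplus>\<^bsub>R\<^esub> c i) \<in> carrier (free_module R I)"
    if "b \<in> carrier (free_module R I)" "c \<in> carrier (free_module R I)" for b c
  proof -
    have "{i. b i \<oplus>\<^bsub>R\<^esub> c i \<noteq> \<zero>\<^bsub>R\<^esub>} \<subseteq> {i. b i \<noteq> \<zero>\<^bsub>R\<^esub>} \<union> {i. c i \<noteq> \<zero>\<^bsub>R\<^esub>}"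
      by auto
    then show ?thesis
      using that by (auto simp: carrier_free_module intro: finite_subset)
  qed
  have smult: "(\<lambda>i. a \<otimes>\<^bsub>R\<^esub> c i) \<in> carrier (free_module R I)"
    if "a \<in> carrier R" "c \<in> carrier (free_module R I)" for a c
  proof -
    have "{i. a \<otimes>\<^bsub>R\<^esub> c i \<noteq> \<zero>\<^bsub>R\<^esub>} \<subseteq> {i. c i \<noteq> \<zero>\<^bsub>R\<^esub>}"
      using that by auto
    then show ?thesis
      using that by (auto simp: carrier_free_module intro: finite_subset)
  qed
  have inv: "\<exists>y\<in>carrier (free_module R I). (\<lambda>i. y i \<oplus>\<^bsub>R\<^esub> c i) = (\<lambda>_. \<zero>\<^bsub>R\<^esub>)"
    if "c \<in> carrier (free_module R I)" for c
    using that smult[of "\<ominus>\<^bsub>R\<^esub> \<one>\<^bsub>R\<^esub>" c]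
    by (intro bexI[of _ "\<lambda>i. (\<ominus>\<^bsub>R\<^esub> \<one>\<^bsub>R\<^esub>) \<otimes>\<^bsub>R\<^esub> c i"]) (auto simp: carrier_free_module R.l_minus R.l_neg)
  show ?thesis
    by (intro moduleI abelian_groupI)
      (use add smult inv in \<open>auto simp: carrier_free_module R.a_ac R.l_distr R.r_distr R.m_assoc assms\<close>)
qed

section \<open>Monomials\<close>

abbreviation monoms :: "(('v \<Rightarrow>\<^sub>0 nat) \<Rightarrow>\<^sub>0 'k::zero) \<Rightarrow> ('v \<Rightarrow>\<^sub>0 nat) set" where
  "monoms q \<equiv> Poly_Mapping.keys q"

abbreviation vars :: "('v \<Rightarrow>\<^sub>0 nat) \<Rightarrow> 'v set" where
  "vars t \<equiv> Poly_Mapping.keys t"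

lemma vars_add: "vars (s + t) = vars s \<union> vars t"
  by (auto simp: in_keys_iff lookup_add)

lemma sum_monomials: "(\<Sum>t\<in>Poly_Mapping.keys q. Poly_Mapping.single t (Poly_Mapping.lookup q t)) = q"
  by (rule poly_mapping_eqI) (auto simp: lookup_sum lookup_single when_def in_keys_iff)

lemma single_1_mult:
  fixes q :: "('a::cancel_comm_monoid_add) \<Rightarrow>\<^sub>0 'k::comm_semiring_1"
  shows "Poly_Mapping.single m 1 * q =
    (\<Sum>t\<in>Poly_Mapping.keys q. Poly_Mapping.single (m + t) (Poly_Mapping.lookup q t))"
  by (subst (1) sum_monomials[of q, symmetric]) (simp add: sum_distrib_left mult_single)

lemma lookup_single_1_mult:
  fixes q :: "('a::cancel_comm_monoid_add) \<Rightarrow>\<^sub>0 'k::comm_semiring_1"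
  shows "Poly_Mapping.lookup (Poly_Mapping.single m 1 * q) (m + t) = Poly_Mapping.lookup q t"
  by (auto simp: single_1_mult lookup_sum lookup_single when_def in_keys_iff)

lemma keys_single_1_mult:
  fixes q :: "('a::cancel_comm_monoid_add) \<Rightarrow>\<^sub>0 'k::comm_semiring_1"
  shows "Poly_Mapping.keys (Poly_Mapping.single m 1 * q) = (+) m ` Poly_Mapping.keys q"
proof
  show "Poly_Mapping.keys (Poly_Mapping.single m 1 * q) \<subseteq> (+) m ` Poly_Mapping.keys q"
    unfolding single_1_mult by (rule order_trans[OF keys_sum]) auto
  show "(+) m ` Poly_Mapping.keys q \<subseteq> Poly_Mapping.keys (Poly_Mapping.single m 1 * q)"
    by (auto simp: in_keys_iff lookup_single_1_mult)
qed

definition squarefree_monom :: "'v set \<Rightarrow> 'v \<Rightarrow>\<^sub>0 nat" where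
  "squarefree_monom S = (\<Sum>v\<in>S. Poly_Mapping.single v 1)"

lemma lookup_squarefree_monom: "finite S \<Longrightarrow> Poly_Mapping.lookup (squarefree_monom S) v = (if v \<in> S then 1 else 0)"
  by (simp add: squarefree_monom_def lookup_sum lookup_single when_def)

lemma vars_squarefree_monom: "finite S \<Longrightarrow> vars (squarefree_monom S) = S"
  by (simp add: set_eq_iff in_keys_iff lookup_squarefree_monom)

text \<open>Subtraction of exponents is truncated; it inverts addition here because every variable
  of \<open>S\<close> occurs in \<open>t\<close>.\<close>

lemma squarefree_monom_add_diff:
  assumes "finite S" "S \<subseteq> vars t"
  shows "squarefree_monom S + (t - squarefree_monom S) = t"
proof (rule poly_mapping_eqI)
  fix v
  have "v \<in> S \<Longrightarrow> Poly_Mapping.lookup t v > 0"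
    using assms by (auto simp: in_keys_iff)
  then show "Poly_Mapping.lookup (squarefree_monom S + (t - squarefree_monom S)) v = Poly_Mapping.lookup t v"
    using assms by (simp add: lookup_add minus_poly_mapping.rep_eq lookup_squarefree_monom)
qed

lemma squarefree_monom_dvd:
  fixes q :: "('v \<Rightarrow>\<^sub>0 nat) \<Rightarrow>\<^sub>0 'k::comm_semiring_1"
  assumes "finite S" "\<And>t. t \<in> monoms q \<Longrightarrow> S \<subseteq> vars t"
  obtains q' where "q = Poly_Mapping.single (squarefree_monom S) 1 * q'"
proof
  let ?m = "squarefree_monom S"
  have "Poly_Mapping.single ?m 1 * (\<Sum>t\<in>monoms q. Poly_Mapping.single (t - ?m) (Poly_Mapping.lookup q t)) =
      (\<Sum>t\<in>monoms q. Poly_Mapping.single t (Poly_Mapping.lookup q t))"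
    unfolding sum_distrib_left mult_single
    by (rule sum.cong) (use assms squarefree_monom_add_diff[of S] in simp_all)
  then show "q = Poly_Mapping.single ?m 1 * (\<Sum>t\<in>monoms q. Poly_Mapping.single (t - ?m) (Poly_Mapping.lookup q t))"
    by (simp add: sum_monomials)
qed

lemma mpoly_var_eq: "mpoly_var v = Poly_Mapping.single (squarefree_monom {v}) 1"
  by (simp add: mpoly_var_def squarefree_monom_def)

lemma monoms_mpoly_var_mult:
  "monoms (mpoly_var v * (q :: ('v \<Rightarrow>\<^sub>0 nat) \<Rightarrow>\<^sub>0 'k::comm_ring_1)) = (+) (squarefree_monom {v}) ` monoms q"
  by (simp add: mpoly_var_eq keys_single_1_mult)

text \<open>The projection onto the span of the monomials satisfying \<open>Q\<close>. It is
  additive, which is all that commuting with \<open>taylor_diff\<close> takes, but in general not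
  linear over the polynomial ring.\<close>

definition restrict_monoms ::
  "(('v \<Rightarrow>\<^sub>0 nat) \<Rightarrow> bool) \<Rightarrow> (('v \<Rightarrow>\<^sub>0 nat) \<Rightarrow>\<^sub>0 'k::zero) \<Rightarrow> (('v \<Rightarrow>\<^sub>0 nat) \<Rightarrow>\<^sub>0 'k)" where
  "restrict_monoms Q q = Poly_Mapping.mapp (\<lambda>t c. c when Q t) q"

lemma lookup_restrict_monoms: "Poly_Mapping.lookup (restrict_monoms Q q) t = (Poly_Mapping.lookup q t when Q t)"
  by (simp add: restrict_monoms_def lookup_mapp when_def in_keys_iff)

lemma monoms_restrict_monoms: "monoms (restrict_monoms Q q) = {t \<in> monoms q. Q t}"
  by (auto simp: in_keys_iff lookup_restrict_monoms)

lemma restrict_monoms_diff: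
  "restrict_monoms Q (p - q) = restrict_monoms Q p - restrict_monoms Q (q :: _ \<Rightarrow>\<^sub>0 'k::ab_group_add)"
  by (rule poly_mapping_eqI) (simp add: lookup_restrict_monoms lookup_minus when_def)

lemma restrict_monoms_split:
  "restrict_monoms Q q + restrict_monoms (\<lambda>t. \<not> Q t) q = (q :: _ \<Rightarrow>\<^sub>0 'k::monoid_add)"
  by (rule poly_mapping_eqI) (simp add: lookup_restrict_monoms lookup_add when_def)

section \<open>The polynomial ring\<close>

lemma mpoly_ring_simps [simp]:
  "x \<otimes>\<^bsub>mpoly_ring V\<^esub> y = x * y" "\<one>\<^bsub>mpoly_ring V\<^esub> = 1"
  "\<zero>\<^bsub>mpoly_ring V\<^esub> = 0" "x \<oplus>\<^bsub>mpoly_ring V\<^esub> y = x + y"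
  by (simp_all add: mpoly_ring_def)

lemma carrier_mpoly_ring: "carrier (mpoly_ring V) = {q. \<forall>t \<in> monoms q. vars t \<subseteq> V}"
  by (simp add: mpoly_ring_def)

lemma cring_mpoly_ring: "cring (mpoly_ring V :: (('v \<Rightarrow>\<^sub>0 nat) \<Rightarrow>\<^sub>0 'k::comm_ring_1) ring)"
proof (rule cringI)
  have add: "x + y \<in> carrier (mpoly_ring V)"
    if "x \<in> carrier (mpoly_ring V)" "y \<in> carrier (mpoly_ring V)" for x y :: "('v \<Rightarrow>\<^sub>0 nat) \<Rightarrow>\<^sub>0 'k"
    using that keys_add[of x y] by (auto simp: carrier_mpoly_ring)
  have "\<exists>y \<in> carrier (mpoly_ring V). y + x = 0"
    if "x \<in> carrier (mpoly_ring V)" for x :: "('v \<Rightarrow>\<^sub>0 nat) \<Rightarrow>\<^sub>0 'k"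
    using that by (intro bexI[of _ "- x"]) (auto simp: carrier_mpoly_ring in_keys_iff)
  then show "abelian_group (mpoly_ring V :: (('v \<Rightarrow>\<^sub>0 nat) \<Rightarrow>\<^sub>0 'k) ring)"
    by (intro abelian_groupI) (auto simp: add add_ac, simp add: carrier_mpoly_ring)
  have mult: "x * y \<in> carrier (mpoly_ring V)"
    if "x \<in> carrier (mpoly_ring V)" "y \<in> carrier (mpoly_ring V)" for x y :: "('v \<Rightarrow>\<^sub>0 nat) \<Rightarrow>\<^sub>0 'k"
    using that keys_mult[of x y] by (auto simp: carrier_mpoly_ring vars_add subset_iff) (metis UnE vars_add)
  show "comm_monoid (mpoly_ring V :: (('v \<Rightarrow>\<^sub>0 nat) \<Rightarrow>\<^sub>0 'k) ring)"
    by (intro comm_monoidI) (auto simp: mult mult_ac, simp add: carrier_mpoly_ring)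
qed (simp add: distrib_right)

lemma mpoly_ring_uminus_closed:
  "(q :: ('v \<Rightarrow>\<^sub>0 nat) \<Rightarrow>\<^sub>0 'k::comm_ring_1) \<in> carrier (mpoly_ring V) \<Longrightarrow> - q \<in> carrier (mpoly_ring V)"
  by (auto simp: carrier_mpoly_ring in_keys_iff)

lemma a_inv_mpoly_ring:
  fixes q :: "('v \<Rightarrow>\<^sub>0 nat) \<Rightarrow>\<^sub>0 'k::comm_ring_1"
  assumes "q \<in> carrier (mpoly_ring V)"
  shows "\<ominus>\<^bsub>mpoly_ring V\<^esub> q = - q"
proof -
  interpret R: cring "mpoly_ring V :: (('v \<Rightarrow>\<^sub>0 nat) \<Rightarrow>\<^sub>0 'k) ring" by (rule cring_mpoly_ring)
  show ?thesis
    by (rule R.minus_equality) (use assms mpoly_ring_uminus_closed in auto)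
qed

lemma a_minus_mpoly_ring:
  fixes p q :: "('v \<Rightarrow>\<^sub>0 nat) \<Rightarrow>\<^sub>0 'k::comm_ring_1"
  assumes "q \<in> carrier (mpoly_ring V)"
  shows "p \<ominus>\<^bsub>mpoly_ring V\<^esub> q = p - q"
  using assms by (simp add: a_minus_def a_inv_mpoly_ring)

lemma mpoly_var_closed:
  "v \<in> V \<Longrightarrow> (mpoly_var v :: ('v \<Rightarrow>\<^sub>0 nat) \<Rightarrow>\<^sub>0 'k::comm_ring_1) \<in> carrier (mpoly_ring V)"
  by (simp add: carrier_mpoly_ring mpoly_var_eq vars_squarefree_monom)

lemma a_minus_free_module:
  fixes b c :: "'i \<Rightarrow> ('v \<Rightarrow>\<^sub>0 nat) \<Rightarrow>\<^sub>0 'k::comm_ring_1"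
  assumes "b \<in> carrier (free_module (mpoly_ring V) I)" "c \<in> carrier (free_module (mpoly_ring V) I)"
  shows "b \<ominus>\<^bsub>free_module (mpoly_ring V) I\<^esub> c = (\<lambda>i. b i - c i)"
proof -
  interpret F: module "mpoly_ring V" "free_module (mpoly_ring V) I :: (_, 'i \<Rightarrow> _) module"
    by (intro module_free_module cring_mpoly_ring)
  let ?d = "b \<ominus>\<^bsub>free_module (mpoly_ring V) I\<^esub> c"
  have "?d \<oplus>\<^bsub>free_module (mpoly_ring V) I\<^esub> c = b"
    using assms by (simp only: a_minus_def F.M.a_assoc F.M.l_neg F.M.a_inv_closed F.M.r_zero)
  then have "?d i + c i = b i" for i
    by (simp add: fun_eq_iff)
  then show ?thesis
    by (metis (no_types) add_diff_cancel_right' ext)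
qed

text \<open>The top Koszul cohomology of a free module for the variables \<open>vs\<close> is its quotient by the ideal
  they generate, which consists of the polynomials all of whose monomials involve one of them.\<close>

lemma koszul_diff_top_imp:
  fixes b :: "bool list \<Rightarrow> 'i \<Rightarrow> ('v \<Rightarrow>\<^sub>0 nat) \<Rightarrow>\<^sub>0 'k::comm_ring_1"
  assumes "set vs \<subseteq> V" "\<And>s. b s \<in> carrier (free_module (mpoly_ring V) I)"
    and "t \<in> monoms (koszul_diff (free_module (mpoly_ring V) I) (map mpoly_var vs) b
      (replicate (length vs) True) i)"
  shows "vars t \<inter> set vs \<noteq> {}"
  using assms
proof (induction vs arbitrary: b)
  case (Cons v vs)
  interpret F: module "mpoly_ring V" "free_module (mpoly_ring V) I :: (_, 'i \<Rightarrow> _) module"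
    by (intro module_free_module cring_mpoly_ring)
  let ?F = "free_module (mpoly_ring V) I :: (_, 'i \<Rightarrow> _) module"
  let ?T = "replicate (length vs) True"
  let ?d = "koszul_diff ?F (map mpoly_var vs) (\<lambda>t. b (True # t)) ?T"
  have v: "mpoly_var v \<in> carrier (mpoly_ring V)" and vs: "set (map mpoly_var vs) \<subseteq> carrier (mpoly_ring V)"
    using Cons.prems(1) by (auto intro: mpoly_var_closed)
  have "mpoly_var v \<odot>\<^bsub>?F\<^esub> b (False # ?T) \<in> carrier ?F"
    using v Cons.prems(2) by (rule F.smult_closed)
  moreover have "?d \<in> carrier ?F"
    using vs Cons.prems(2) by (intro F.koszul_diff_closed)
  ultimately have "t \<in> monoms (mpoly_var v * b (False # ?T) i - ?d i)"
    using Cons.prems(3) by (simp add: a_minus_free_module)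
  then consider "t \<in> monoms (mpoly_var v * b (False # ?T) i)" | "t \<in> monoms (?d i)"
    by (fastforce simp: in_keys_iff lookup_minus)
  then show ?case
  proof cases
    case 1
    then show ?thesis
      by (auto simp: monoms_mpoly_var_mult vars_add vars_squarefree_monom)
  next
    case 2
    then show ?thesis
      using Cons.IH[of "\<lambda>t. b (True # t)"] Cons.prems by auto
  qed
qed simp

lemma koszul_diff_top_exists:
  fixes y :: "'i \<Rightarrow> ('v \<Rightarrow>\<^sub>0 nat) \<Rightarrow>\<^sub>0 'k::comm_ring_1"
  assumes "set vs \<subseteq> V" "y \<in> carrier (free_module (mpoly_ring V) I)"
    and "\<And>i t. t \<in> monoms (y i) \<Longrightarrow> vars t \<inter> set vs \<noteq> {}"
  shows "\<exists>b. (\<forall>s. b s \<in> carrier (free_module (mpoly_ring V) I)) \<and>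
    y = koszul_diff (free_module (mpoly_ring V) I) (map mpoly_var vs) b (replicate (length vs) True)"
  using assms
proof (induction vs arbitrary: y)
  case Nil
  interpret F: module "mpoly_ring V" "free_module (mpoly_ring V) I :: (_, 'i \<Rightarrow> _) module"
    by (intro module_free_module cring_mpoly_ring)
  have "y i = 0" for i
    using Nil.prems(3)[of _ i] by (metis Int_empty_right all_not_in_conv empty_set keys_eq_empty)
  then show ?case
    using F.M.zero_closed by (intro exI[of _ "\<lambda>_. \<zero>\<^bsub>free_module (mpoly_ring V) I\<^esub>"]) auto
next
  case (Cons v vs)
  interpret F: module "mpoly_ring V" "free_module (mpoly_ring V) I :: (_, 'i \<Rightarrow> _) module"
    by (intro module_free_module cring_mpoly_ring)
  let ?F = "free_module (mpoly_ring V) I :: (_, 'i \<Rightarrow> _) module"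
  let ?T = "replicate (length vs) True"
  \<comment> \<open>Monomials containing \<open>v\<close> form a multiple of the variable; each of
    the others must contain a variable of the remaining list and is left to the induction. The sign
    in \<open>y2\<close> is that of the cone differential.\<close>
  define y1 where "y1 i = restrict_monoms (\<lambda>t. v \<in> vars t) (y i)" for i
  define y2 where "y2 i = - restrict_monoms (\<lambda>t. v \<notin> vars t) (y i)" for i
  have y: "y i = y1 i - y2 i" for i
    by (simp add: y1_def y2_def restrict_monoms_split)
  have "\<exists>q. y1 i = mpoly_var v * q" for i
    unfolding mpoly_var_eq
    by (rule squarefree_monom_dvd[of "{v}" "y1 i"]) (auto simp: y1_def monoms_restrict_monoms)
  then obtain q where q: "\<And>i. y1 i = mpoly_var v * q i"
    by metis
  have mono_q: "squarefree_monom {v} + t \<in> monoms (y i)" if "t \<in> monoms (q i)" for t i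
  proof -
    have "squarefree_monom {v} + t \<in> monoms (y1 i)"
      using that by (simp add: q monoms_mpoly_var_mult)
    then show ?thesis by (simp add: y1_def monoms_restrict_monoms)
  qed
  have mono_y2: "t \<in> monoms (y i) \<and> v \<notin> vars t" if "t \<in> monoms (y2 i)" for t i
    using that by (auto simp: y2_def in_keys_iff lookup_restrict_monoms when_def split: if_splits)
  have yF: "\<And>i t. t \<in> monoms (y i) \<Longrightarrow> vars t \<subseteq> V" "finite {i. y i \<noteq> 0}" "{i. y i \<noteq> 0} \<subseteq> I"
    using Cons.prems(2) by (auto simp: carrier_free_module carrier_mpoly_ring)
  \<comment> \<open>Finite support inside \<open>I\<close> is inherited from \<open>y\<close>, so
    that only the supports have to be compared.\<close>
  have memF: "z \<in> carrier ?F"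
    if z: "\<And>i t. t \<in> monoms (z i) \<Longrightarrow> vars t \<subseteq> V \<and> y i \<noteq> 0" for z :: "'i \<Rightarrow> ('v \<Rightarrow>\<^sub>0 nat) \<Rightarrow>\<^sub>0 'k"
  proof -
    have "{i. z i \<noteq> 0} \<subseteq> {i. y i \<noteq> 0}"
      using z by (simp add: Collect_mono_iff) (metis ex_in_conv keys_eq_empty)
    then have "finite {i. z i \<noteq> 0}" "{i. z i \<noteq> 0} \<subseteq> I"
      using yF(2,3) by (blast intro: finite_subset)+
    then show ?thesis
      using z by (simp add: carrier_free_module carrier_mpoly_ring)
  qed
  have y2F: "y2 \<in> carrier ?F"
    using mono_y2 yF(1) by (intro memF) force
  have qF: "q \<in> carrier ?F"
  proof (rule memF)
    fix i t assume "t \<in> monoms (q i)"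
    from mono_q[OF this] show "vars t \<subseteq> V \<and> y i \<noteq> 0"
      using yF(1)[of _ i] by (fastforce simp: vars_add)
  qed
  have "\<exists>b. (\<forall>s. b s \<in> carrier ?F) \<and> y2 = koszul_diff ?F (map mpoly_var vs) b ?T"
    by (rule Cons.IH) (use Cons.prems(1,3) y2F mono_y2 in fastforce)+
  then obtain b where b: "\<And>s. b s \<in> carrier ?F" and y2: "y2 = koszul_diff ?F (map mpoly_var vs) b ?T"
    by blast
  let ?b = "\<lambda>s. case s of [] \<Rightarrow> q | a # t \<Rightarrow> if a then b t else q"
  have "?b s \<in> carrier ?F" for s
    using b qF by (auto split: list.split)
  moreover have "y = koszul_diff ?F (map mpoly_var (v # vs)) ?b (replicate (length (v # vs)) True)"
  proof -
    have v: "mpoly_var v \<in> carrier (mpoly_ring V)"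
      using Cons.prems(1) by (auto intro: mpoly_var_closed)
    then have "mpoly_var v \<odot>\<^bsub>?F\<^esub> q \<in> carrier ?F"
      using qF by (rule F.smult_closed)
    then show ?thesis
      using y2F by (simp add: a_minus_free_module y2[symmetric] y q fun_eq_iff)
  qed
  ultimately show ?case
    by blast
qed

text \<open>Distinct variables form a regular sequence: multiplication by the variable of
  \<open>v\<close> adds no variable of the later list, so if the product lies in the ideal generated
  by those, the factor already did.\<close>

lemma koszul_exact_below_free_module:
  assumes "distinct vs" "set vs \<subseteq> V"
  shows "koszul_exact_below (free_module (mpoly_ring V :: (('v \<Rightarrow>\<^sub>0 nat) \<Rightarrow>\<^sub>0 'k::comm_ring_1) ring) I)
    (carrier (free_module (mpoly_ring V) I)) (map mpoly_var vs) (length vs)"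
proof -
  let ?F = "free_module (mpoly_ring V :: (('v \<Rightarrow>\<^sub>0 nat) \<Rightarrow>\<^sub>0 'k) ring) I"
  interpret F: module "mpoly_ring V" ?F
    by (intro module_free_module cring_mpoly_ring)
  let ?xs = "map mpoly_var vs :: (('v \<Rightarrow>\<^sub>0 nat) \<Rightarrow>\<^sub>0 'k) list"
  have "koszul_exact_below ?F (carrier ?F) ?xs (length ?xs)"
  proof (rule F.koszul_exact_below_length)
    show "set ?xs \<subseteq> carrier (mpoly_ring V)"
      using assms by (auto intro: mpoly_var_closed)
  next
    fix us x ys y b
    assume split: "?xs = us @ x # ys" and y: "y \<in> carrier ?F" and b: "\<And>s. b s \<in> carrier ?F"
      and eq: "x \<odot>\<^bsub>?F\<^esub> y = koszul_diff ?F ys b (replicate (length ys) True)"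
    from split obtain us' v vs' where vs: "vs = us' @ v # vs'" and x: "x = mpoly_var v" and ys: "ys = map mpoly_var vs'"
      by (auto simp: map_eq_append_conv Cons_eq_map_conv eq_commute[of "_ # _"])
    have "vars t \<inter> set vs' \<noteq> {}" if "t \<in> monoms (y i)" for i t
    proof -
      have "squarefree_monom {v} + t \<in> monoms (mpoly_var v * y i)"
        using that by (simp add: monoms_mpoly_var_mult)
      then have "squarefree_monom {v} + t \<in> monoms (koszul_diff ?F (map mpoly_var vs') b (replicate (length vs') True) i)"
        using eq by (simp add: x ys fun_eq_iff)
      then have "vars (squarefree_monom {v} + t) \<inter> set vs' \<noteq> {}"
        using koszul_diff_top_imp[of vs' V b I] b assms(2) vs by auto
      then show ?thesis
        using assms(1) vs by (auto simp: vars_add vars_squarefree_monom)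
    qed
    then show "\<exists>e. (\<forall>s. e s \<in> carrier ?F) \<and> y = koszul_diff ?F ys e (replicate (length ys) True)"
      using koszul_diff_top_exists[of vs' V y I] y assms(2) vs by (simp add: ys)
  qed
  then show ?thesis by simp
qed

section \<open>Edge ideals and quotient modules\<close>

text \<open>A monomial ideal contains a polynomial exactly if it contains each of its monomials.
  From here on membership in the edge ideal is tested on supports and the generators are not
  mentioned again.\<close>

lemma edge_ideal_eq:
  assumes E: "E \<subseteq> nsets V 2"
  shows "(edge_ideal V E :: (('v \<Rightarrow>\<^sub>0 nat) \<Rightarrow>\<^sub>0 'k::comm_ring_1) set) =
    {q \<in> carrier (mpoly_ring V). \<forall>t \<in> monoms q. \<exists>e \<in> E. e \<subseteq> vars t}" (is "_ = ?J")
proof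
  interpret R: cring "mpoly_ring V :: (('v \<Rightarrow>\<^sub>0 nat) \<Rightarrow>\<^sub>0 'k) ring" by (rule cring_mpoly_ring)
  let ?R = "mpoly_ring V :: (('v \<Rightarrow>\<^sub>0 nat) \<Rightarrow>\<^sub>0 'k) ring"
  let ?I = "edge_ideal V E :: (('v \<Rightarrow>\<^sub>0 nat) \<Rightarrow>\<^sub>0 'k) set"
  let ?G = "{mpoly_var u * mpoly_var v | u v. u \<noteq> v \<and> {u, v} \<in> E} :: (('v \<Rightarrow>\<^sub>0 nat) \<Rightarrow>\<^sub>0 'k) set"
  have gen: "mpoly_var u * mpoly_var v = (Poly_Mapping.single (squarefree_monom {u, v}) 1 :: ('v \<Rightarrow>\<^sub>0 nat) \<Rightarrow>\<^sub>0 'k)"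
    if "u \<noteq> v" for u v
    using that by (simp add: mpoly_var_def squarefree_monom_def mult_single)
  have edge: "finite e" "e \<subseteq> V" "\<exists>u v. u \<noteq> v \<and> e = {u, v}" if "e \<in> E" for e
    using that E by (auto simp: nsets_def card_2_iff)
  have G: "?G \<subseteq> ?J"
  proof
    fix g assume "g \<in> ?G"
    then obtain u v where "u \<noteq> v" "{u, v} \<in> E" and g: "g = mpoly_var u * mpoly_var v"
      by blast
    then show "g \<in> ?J"
      using edge(2)[of "{u, v}"] by (auto simp: gen carrier_mpoly_ring vars_squarefree_monom)
  qed
  have add: "p + q \<in> ?J" if "p \<in> ?J" "q \<in> ?J" for p q
    using that keys_add[of p q] R.a_closed[of p q] by auto
  have mult: "p * q \<in> ?J" if "p \<in> carrier ?R" "q \<in> ?J" for p q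
  proof -
    have "\<exists>e \<in> E. e \<subseteq> vars t" if t: "t \<in> monoms (p * q)" for t
    proof -
      obtain a b where "t = a + b" "b \<in> monoms q"
        using t keys_mult[of p q] by blast
      then show ?thesis
        using \<open>q \<in> ?J\<close> by (simp add: vars_add) (meson le_supI2)
    qed
    then show ?thesis
      using that R.m_closed[of p q] by simp
  qed
  have "ideal ?J ?R"
  proof (rule idealI)
    show "subgroup ?J (add_monoid ?R)"
    proof (rule R.add.subgroupI)
      show "?J \<noteq> {}"
        using R.zero_closed by (intro ex_in_conv[THEN iffD1] exI[of _ 0]) simp
      fix q assume q: "q \<in> ?J"
      have "- 1 \<in> carrier ?R"
        using mpoly_ring_uminus_closed[of 1 V] R.one_closed by simp
      then have "- q \<in> ?J"
        using mult[OF _ q, of "- 1"] by simp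
      moreover have "\<ominus>\<^bsub>?R\<^esub> q = - q"
        using q by (intro a_inv_mpoly_ring) blast
      ultimately show "\<ominus>\<^bsub>?R\<^esub> q \<in> ?J"
        by (simp only:)
      fix p assume p: "p \<in> ?J"
      show "q \<oplus>\<^bsub>?R\<^esub> p \<in> ?J"
        using add[OF q p] by simp
    qed blast
    show "q \<otimes>\<^bsub>?R\<^esub> p \<in> ?J" if "q \<in> ?J" "p \<in> carrier ?R" for p q
      using mult[OF that(2,1)] by (simp add: mult.commute)
  qed (use mult R.ring_axioms in auto)
  then show "edge_ideal V E \<subseteq> ?J"
    unfolding edge_ideal_def using G by (rule R.genideal_minimal)
  have "?G \<subseteq> carrier ?R"
    using G by blast
  then have ideal: "ideal (?I) ?R" and gens: "?G \<subseteq> ?I"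
    unfolding edge_ideal_def by (rule R.genideal_ideal, rule R.genideal_self)
  interpret I: ideal "?I" ?R by (rule ideal)
  show "?J \<subseteq> ?I"
  proof
    fix q assume q: "q \<in> ?J"
    have single: "Poly_Mapping.single t (Poly_Mapping.lookup q t) \<in> ?I" if tq: "t \<in> monoms q" for t
    proof -
      obtain e where e: "e \<in> E" "e \<subseteq> vars t"
        using q tq by blast
      let ?m = "squarefree_monom e"
      obtain u v where uv: "u \<noteq> v" "e = {u, v}"
        using edge(3)[OF e(1)] by blast
      have "Poly_Mapping.single ?m 1 = (mpoly_var u * mpoly_var v :: ('v \<Rightarrow>\<^sub>0 nat) \<Rightarrow>\<^sub>0 'k)"
        unfolding uv(2) by (rule gen[OF uv(1), symmetric])
      then have "Poly_Mapping.single ?m 1 \<in> ?G"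
        using e(1) uv by (intro CollectI exI[of _ u] exI[of _ v] conjI) simp_all
      then have m: "Poly_Mapping.single ?m 1 \<in> ?I"
        by (rule subsetD[OF gens])
      have t: "?m + (t - ?m) = t"
        by (rule squarefree_monom_add_diff[OF edge(1)[OF e(1)] e(2)])
      then have "vars (t - ?m) \<subseteq> vars t"
        by (metis Un_upper2 vars_add)
      then have "Poly_Mapping.single (t - ?m) (Poly_Mapping.lookup q t) \<in> carrier ?R"
        using q tq by (auto simp: carrier_mpoly_ring)
      then have "Poly_Mapping.single ?m 1 * Poly_Mapping.single (t - ?m) (Poly_Mapping.lookup q t) \<in> ?I"
        using I.I_r_closed[OF m] by simp
      then show ?thesis
        by (simp add: mult_single t)
    qed
    have "(\<Sum>t\<in>T. Poly_Mapping.single t (Poly_Mapping.lookup q t)) \<in> ?I" if "finite T" "T \<subseteq> monoms q" for T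
      using that
    proof (induction T)
      case empty
      then show ?case using I.zero_closed by simp
    next
      case (insert t T)
      then show ?case
        using single[of t] I.a_closed[of "Poly_Mapping.single t (Poly_Mapping.lookup q t)"] by simp
    qed
    from this[of "monoms q"] show "q \<in> ?I"
      by (simp add: sum_monomials)
  qed
qed

lemma ideal_edge_ideal:
  assumes "E \<subseteq> nsets V 2"
  shows "ideal (edge_ideal V E) (mpoly_ring V :: (('v \<Rightarrow>\<^sub>0 nat) \<Rightarrow>\<^sub>0 'k::comm_ring_1) ring)"
proof -
  interpret R: cring "mpoly_ring V :: (('v \<Rightarrow>\<^sub>0 nat) \<Rightarrow>\<^sub>0 'k) ring" by (rule cring_mpoly_ring)
  have "u \<in> V" "v \<in> V" if "{u, v} \<in> E" for u v
    using that assms by (auto simp: nsets_def)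
  then have "{mpoly_var u * mpoly_var v | u v. u \<noteq> v \<and> {u, v} \<in> E} \<subseteq> carrier (mpoly_ring V :: (('v \<Rightarrow>\<^sub>0 nat) \<Rightarrow>\<^sub>0 'k) ring)"
    using R.m_closed by (auto intro!: mpoly_var_closed R.m_closed[simplified])
  then show ?thesis
    unfolding edge_ideal_def by (rule R.genideal_ideal)
qed

section \<open>Quotient modules and the lower bound for resolutions\<close>

lemma carrier_FactRing: "carrier (R Quot I) = (+>\<^bsub>R\<^esub>) I ` carrier R"
  by (auto simp: FactRing_def A_RCOSETS_def')

lemma quotient_module_simps [simp]:
  "carrier (quotient_module R I) = carrier (R Quot I)"
  "\<zero>\<^bsub>quotient_module R I\<^esub> = \<zero>\<^bsub>R Quot I\<^esub>"
  "x \<oplus>\<^bsub>quotient_module R I\<^esub> y = x \<oplus>\<^bsub>R Quot I\<^esub> y"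
  "a \<odot>\<^bsub>quotient_module R I\<^esub> x = (I +>\<^bsub>R\<^esub> a) \<otimes>\<^bsub>R Quot I\<^esub> x"
  by (simp_all add: quotient_module_def)

lemma module_quotient_module:
  assumes "cring R" "ideal I R"
  shows "module R (quotient_module R I)"
proof -
  interpret R: cring R by fact
  interpret I: ideal I R by fact
  interpret Q: cring "R Quot I" by (rule I.quotient_is_cring[OF assms(1)])
  interpret h: ring_hom_cring R "R Quot I" "(+>\<^bsub>R\<^esub>) I" by (rule I.rcos_ring_hom_cring[OF assms(1)])
  show ?thesis
  proof (rule moduleI)
    show "abelian_group (quotient_module R I)"
      using Q.add.m_assoc Q.add.m_comm Q.add.l_inv_ex
      by (intro abelian_groupI) auto
  qed (auto simp: assms Q.l_distr Q.r_distr Q.m_assoc)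
qed

lemma a_r_coset_eq_iff:
  assumes "ring R" "ideal I R" "a \<in> carrier R" "b \<in> carrier R"
  shows "I +>\<^bsub>R\<^esub> a = I +>\<^bsub>R\<^esub> b \<longleftrightarrow> a \<ominus>\<^bsub>R\<^esub> b \<in> I"
proof -
  interpret R: ring R by fact
  interpret I: ideal I R by fact
  have "a \<in> I +>\<^bsub>R\<^esub> b \<longleftrightarrow> a \<ominus>\<^bsub>R\<^esub> b \<in> I"
    using I.a_rcos_module_minus[OF assms(1,4,3)] .
  then show ?thesis
    using I.a_rcos_self[OF assms(3)] I.a_repr_independence'[of a b] assms by auto
qed

text \<open>If \<open>E\<close> contains the complete bipartite graph between \<open>A\<close> and \<open>B\<close>, then \<open>y\<^sub>v = x\<^sub>v\<close> for
  \<open>v \<in> A\<close> and \<open>y\<^sub>v = 0\<close> for \<open>v \<in> B\<close> defines a nonzero class in the first Koszul cohomology of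
  \<open>R/I(E)\<close>.\<close>

lemma resolution_length_ge:
  fixes P :: "nat \<Rightarrow> (('v \<Rightarrow>\<^sub>0 nat) \<Rightarrow>\<^sub>0 'k::comm_ring_1, 'p) module"
  assumes E: "E \<subseteq> nsets V 2" and V: "A \<subseteq> V" "B \<subseteq> V" "finite A" "finite B"
    and AB: "A \<noteq> {}" "B \<noteq> {}" "A \<inter> B = {}" "\<And>a b. a \<in> A \<Longrightarrow> b \<in> B \<Longrightarrow> {a, b} \<in> E"
    and res: "projective_resolution (mpoly_ring V) (quotient_module (mpoly_ring V) (edge_ideal V E)) P \<delta> \<epsilon>"
    and trivial: "\<And>i. i > l \<Longrightarrow> carrier (P i) = {\<zero>\<^bsub>P i\<^esub>}"
  shows "card (A \<union> B) \<le> l + 1"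
proof (rule ccontr)
  let ?R = "mpoly_ring V :: (('v \<Rightarrow>\<^sub>0 nat) \<Rightarrow>\<^sub>0 'k) ring"
  let ?I = "edge_ideal V E :: (('v \<Rightarrow>\<^sub>0 nat) \<Rightarrow>\<^sub>0 'k) set"
  let ?M = "quotient_module ?R ?I"
  let ?x = "mpoly_var :: 'v \<Rightarrow> ('v \<Rightarrow>\<^sub>0 nat) \<Rightarrow>\<^sub>0 'k"
  assume less: "\<not> card (A \<union> B) \<le> l + 1"
  interpret R: cring ?R by (rule cring_mpoly_ring)
  interpret I: ideal ?I ?R by (rule ideal_edge_ideal[OF E])
  have M: "module ?R ?M"
    by (rule module_quotient_module[OF cring_mpoly_ring ideal_edge_ideal[OF E]])
  interpret h: ring_hom_cring ?R "?R Quot ?I" "(+>\<^bsub>?R\<^esub>) ?I"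
    by (rule I.rcos_ring_hom_cring[OF cring_mpoly_ring])
  obtain vs where vs: "set vs = A \<union> B" "distinct vs"
    using finite_distinct_list V by (metis finite_UnI)
  have len: "length vs = card (A \<union> B)"
    using vs distinct_card by fastforce
  have xs: "?x v \<in> carrier ?R" if "v \<in> set vs" for v
    using that vs V by (intro mpoly_var_closed) auto
  have mem: "?I +>\<^bsub>?R\<^esub> a = ?I +>\<^bsub>?R\<^esub> b \<longleftrightarrow> a - b \<in> ?I" if "a \<in> carrier ?R" "b \<in> carrier ?R" for a b
    using a_r_coset_eq_iff[OF R.ring_axioms ideal_edge_ideal[OF E] that] that by (simp add: a_minus_mpoly_ring)
  \<comment> \<open>The negated claim says that \<open>length vs - l\<close> is at least 2, so that
    the vanishing reaches degree 1.\<close>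
  have exact: "koszul_exact_below ?M (carrier ?M) (map ?x vs) (length vs - l)"
    by (rule koszul_exact_below_resolved[OF M _ res trivial module_free_module[OF cring_mpoly_ring]
          koszul_exact_below_free_module]) (use xs vs V less len in auto)
  define y where "y v = (if v \<in> A then ?x v else 0)" for v
  have y: "y v \<in> carrier ?R" if "v \<in> set vs" for v
    using that xs R.zero_closed by (auto simp: y_def)
  have xx: "?x u * ?x v - 0 \<in> ?I" "0 - ?x u * ?x v \<in> ?I" if uv: "u \<in> A" "v \<in> B" for u v
  proof -
    have "u \<noteq> v" "{u, v} \<in> E" and x: "?x u \<in> carrier ?R" "?x v \<in> carrier ?R"
      using uv AB xs vs by auto
    have "?x u * ?x v \<in> carrier ?R"
      using R.m_closed[OF x] by simp
    moreover have "monoms (?x u * ?x v) \<subseteq> {squarefree_monom {u} + squarefree_monom {v}}"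
      by (simp add: mpoly_var_eq mult_single)
    moreover have "{u, v} \<subseteq> vars (squarefree_monom {u} + squarefree_monom {v})"
      by (simp add: vars_add vars_squarefree_monom)
    ultimately have "?x u * ?x v \<in> ?I"
      using \<open>{u, v} \<in> E\<close> unfolding edge_ideal_eq[OF E] by blast
    then show "?x u * ?x v - 0 \<in> ?I" "0 - ?x u * ?x v \<in> ?I"
      using I.a_inv_closed[of "?x u * ?x v"] a_inv_mpoly_ring[OF I.a_Hcarr[of "?x u * ?x v"]] by simp_all
  qed
  have "\<exists>r \<in> carrier ?M. \<forall>v \<in> set vs. ?I +>\<^bsub>?R\<^esub> y v = ?x v \<odot>\<^bsub>?M\<^esub> r"
  proof (rule koszul_exact_degree_1[OF M _ _ exact])
    show "1 < length vs - l"
      using len less by simp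
    show "?x ` set vs \<subseteq> carrier ?R" "(\<lambda>v. ?I +>\<^bsub>?R\<^esub> y v) ` set vs \<subseteq> carrier ?M"
      using xs y by auto
    fix u v assume uv: "u \<in> set vs" "v \<in> set vs"
    have "?x u * y v - ?x v * y u \<in> ?I"
      using uv vs(1) AB(3) xx[of u v] xx[of v u] I.zero_closed by (auto simp: y_def mult.commute)
    then show "?x u \<odot>\<^bsub>?M\<^esub> (?I +>\<^bsub>?R\<^esub> y v) = ?x v \<odot>\<^bsub>?M\<^esub> (?I +>\<^bsub>?R\<^esub> y u)"
      using mem[of "?x u * y v" "?x v * y u"] h.hom_mult xs y uv R.m_closed by simp
  qed
  then obtain r where r: "r \<in> carrier (?R Quot ?I)"
    and yr: "\<And>v. v \<in> set vs \<Longrightarrow> ?I +>\<^bsub>?R\<^esub> y v = ?x v \<odot>\<^bsub>?M\<^esub> r"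
    by auto
  obtain q where q: "q \<in> carrier ?R" "r = ?I +>\<^bsub>?R\<^esub> q"
    using r unfolding carrier_FactRing by blast
  have diff: "y v - ?x v * q \<in> ?I" if "v \<in> set vs" for v
    using yr[OF that] mem[of "y v" "?x v * q"] q h.hom_mult xs[OF that] y[OF that] R.m_closed by simp
  \<comment> \<open>Every edge has two vertices, so no element of the edge ideal has a linear
    term.\<close>
  have linear: "Poly_Mapping.lookup (y v - ?x v * q) (squarefree_monom {v}) = 0" if "v \<in> set vs" for v
  proof -
    have "\<not> e \<subseteq> vars (squarefree_monom {v})" if "e \<in> E" for e
      using that E by (auto simp: nsets_def vars_squarefree_monom subset_singleton_iff)
    then have "squarefree_monom {v} \<notin> monoms (y v - ?x v * q)"
      using diff[OF that] unfolding edge_ideal_eq[OF E] by blast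
    then show ?thesis
      by (simp add: in_keys_iff)
  qed
  have lookup: "Poly_Mapping.lookup (?x v * q) (squarefree_monom {v}) = Poly_Mapping.lookup q 0" for v
    using lookup_single_1_mult[of "squarefree_monom {v}" q 0] by (simp add: mpoly_var_eq)
  obtain a b where a: "a \<in> A" and b: "b \<in> B"
    using AB by blast
  \<comment> \<open>If the cocycle were the coboundary of \<open>q\<close>, the vertices of
    \<open>B\<close> would force the constant term of \<open>q\<close> to be 0 and those of
    \<open>A\<close> would force it to be 1.\<close>
  have "Poly_Mapping.lookup q 0 = 0"
  proof -
    have "y b = 0" using b AB(3) by (auto simp: y_def)
    then show ?thesis
      using linear[of b] b vs lookup by (simp add: lookup_minus)
  qed
  moreover have "Poly_Mapping.lookup q 0 = 1"
    using linear[of a] a vs lookup by (simp add: y_def lookup_minus) (simp add: mpoly_var_eq)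
  ultimately show False
    by simp
qed

section \<open>The Taylor resolution\<close>

text \<open>Dually to \<open>koszul_diff\<close>, this is the simplicial boundary operator of the full simplex. All
  coefficients are \<open>\<plusminus>1\<close> since the basis element of a set of monomials is represented by
  their least common multiple rather than by \<open>1\<close>.\<close>

fun taylor_diff :: "(bool list \<Rightarrow> 'a::ab_group_add) \<Rightarrow> bool list \<Rightarrow> 'a" where
  "taylor_diff c [] = 0"
| "taylor_diff c (False # s) = c (True # s) - taylor_diff (\<lambda>t. c (False # t)) s"
| "taylor_diff c (True # s) = taylor_diff (\<lambda>t. c (True # t)) s"

lemma taylor_diff_cong:
  assumes "\<And>t. length t = length s \<Longrightarrow> weight t = Suc (weight s) \<Longrightarrow> c t = c' t"
  shows "taylor_diff c s = taylor_diff c' s"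
  using assms
proof (induction s arbitrary: c c')
  case (Cons b s)
  have "taylor_diff (\<lambda>t. c (b # t)) s = taylor_diff (\<lambda>t. c' (b # t)) s"
    by (rule Cons.IH) (use Cons.prems in auto)
  then show ?case
    using Cons.prems[of "True # s"] by (cases b) auto
qed simp

lemma taylor_diff_hom:
  assumes "\<And>a b. h (a - b) = h a - h b"
  shows "taylor_diff (\<lambda>t. h (c t)) s = h (taylor_diff c s)"
proof -
  have "h 0 = 0"
    using assms[of 0 0] by simp
  then show ?thesis
    by (induction c s rule: taylor_diff.induct) (auto simp: assms)
qed

lemma taylor_diff_diff:
  "taylor_diff (\<lambda>t. c t - c' t) s = taylor_diff c s - taylor_diff c' s"
proof (induction s arbitrary: c c')
  case (Cons b s)
  then show ?case by (cases b) auto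
qed simp

text \<open>The same cancellation in a cone as for \<open>koszul_diff\<close>, now on the
  \<open>False\<close> part.\<close>

lemma taylor_diff_taylor_diff: "taylor_diff (taylor_diff c) s = 0"
proof (induction s arbitrary: c)
  case (Cons b s)
  have "taylor_diff (\<lambda>t. taylor_diff c (False # t)) s = taylor_diff (\<lambda>t. c (True # t)) s"
    by (simp add: taylor_diff_diff Cons.IH)
  then show ?case
    by (cases b) (auto simp: Cons.IH)
qed simp

text \<open>The support of the least common multiple of the selected edge monomials.\<close>

fun selected_union :: "'v set list \<Rightarrow> bool list \<Rightarrow> 'v set" where
  "selected_union (e # es) (b # s) = (if b then e else {}) \<union> selected_union es s"
| "selected_union _ _ = {}"

lemma finite_selected_union: "\<forall>e \<in> set es. finite e \<Longrightarrow> finite (selected_union es s)"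
  by (induction es s rule: selected_union.induct) auto

text \<open>For a finite subset \<open>S\<close> of \<open>V\<close> this is the principal ideal of
  the squarefree monomial of \<open>S\<close>. Taking the ideal itself as a summand of the Taylor
  module, instead of a copy of the ring, is what keeps monomial coefficients out of the
  boundary.\<close>

definition multiples :: "'v set \<Rightarrow> 'v set \<Rightarrow> (('v \<Rightarrow>\<^sub>0 nat) \<Rightarrow>\<^sub>0 'k::zero) set" where
  "multiples V S = {q. \<forall>t \<in> monoms q. S \<subseteq> vars t \<and> vars t \<subseteq> V}"

lemma multiples_antimono: "S \<subseteq> S' \<Longrightarrow> multiples V S' \<subseteq> multiples V S"
  by (auto simp: multiples_def)

lemma multiples_subset_carrier: "multiples V S \<subseteq> carrier (mpoly_ring V)"
  by (auto simp: multiples_def carrier_mpoly_ring)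

lemma zero_in_multiples [simp]: "0 \<in> multiples V S"
  by (simp add: multiples_def)

lemma multiples_add: "p \<in> multiples V S \<Longrightarrow> q \<in> multiples V S \<Longrightarrow> p + q \<in> multiples V S"
  using keys_add[of p q] unfolding multiples_def by blast

lemma multiples_uminus:
  "(q :: _ \<Rightarrow>\<^sub>0 'k::ab_group_add) \<in> multiples V S \<Longrightarrow> - q \<in> multiples V S"
  by (simp add: multiples_def in_keys_iff)

lemma multiples_diff:
  "(p :: _ \<Rightarrow>\<^sub>0 'k::ab_group_add) \<in> multiples V S \<Longrightarrow> q \<in> multiples V S \<Longrightarrow> p - q \<in> multiples V S"
  using multiples_add[OF _ multiples_uminus] by (metis add_uminus_conv_diff)

lemma multiples_mult:
  assumes "p \<in> carrier (mpoly_ring V)" "q \<in> multiples V S"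
  shows "p * q \<in> multiples V S"
  unfolding multiples_def
proof (intro CollectI ballI)
  fix t assume "t \<in> monoms (p * q)"
  then obtain a b where "t = a + b" "a \<in> monoms p" "b \<in> monoms q"
    using keys_mult[of p q] by blast
  moreover have "S \<subseteq> vars b" "vars b \<subseteq> V" "vars a \<subseteq> V"
    using assms calculation by (simp_all add: multiples_def carrier_mpoly_ring)
  ultimately show "S \<subseteq> vars t \<and> vars t \<subseteq> V"
    by (auto simp: vars_add)
qed

lemma multiples_restrict_monoms: "q \<in> multiples V S \<Longrightarrow> restrict_monoms Q q \<in> multiples V S"
  by (simp add: multiples_def monoms_restrict_monoms)

text \<open>Deselecting an edge shrinks the union and enlarges the ideal. The set \<open>S\<close>
  collects the edges selected earlier in the string, which the induction on \<open>es\<close> would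
  otherwise forget.\<close>

lemma taylor_diff_multiples:
  fixes c :: "bool list \<Rightarrow> ('v \<Rightarrow>\<^sub>0 nat) \<Rightarrow>\<^sub>0 'k::ab_group_add"
  assumes "length s = length es" "\<And>t. length t = length es \<Longrightarrow> c t \<in> multiples V (S \<union> selected_union es t)"
  shows "taylor_diff c s \<in> multiples V (S \<union> selected_union es s)"
  using assms
proof (induction es arbitrary: c s S)
  case (Cons e es)
  obtain b u where s: "s = b # u" "length u = length es"
    using Cons.prems(1) by (cases s) auto
  have "taylor_diff (\<lambda>t. c (b # t)) u \<in> multiples V ((S \<union> (if b then e else {})) \<union> selected_union es u)"
    by (rule Cons.IH) (use s Cons.prems(2)[of "b # _"] in \<open>simp_all add: Un_assoc\<close>)
  moreover have "c (True # u) \<in> multiples V (S \<union> selected_union es u)"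
    using Cons.prems(2)[of "True # u"] s multiples_antimono[of "S \<union> selected_union es u" "S \<union> (e \<union> selected_union es u)" V]
    by auto
  ultimately show ?case
    using s by (cases b) (auto simp: Un_assoc intro: multiples_diff)
qed simp

text \<open>In degree 0 the boundary is a combination of the values at single edges, each divisible
  by the monomial of its edge. Hence the image of the first boundary lies in the edge ideal.\<close>

lemma taylor_diff_weight_0:
  fixes c :: "bool list \<Rightarrow> ('v \<Rightarrow>\<^sub>0 nat) \<Rightarrow>\<^sub>0 'k::ab_group_add"
  assumes "\<And>s. length s = length es \<Longrightarrow> c s \<in> multiples V (selected_union es s)"
    and "t \<in> monoms (taylor_diff c (replicate (length es) False))"
  shows "\<exists>e \<in> set es. e \<subseteq> vars t"
  using assms
proof (induction es arbitrary: c)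
  case (Cons e es)
  let ?F = "replicate (length es) False"
  let ?d = "taylor_diff (\<lambda>s. c (False # s)) ?F"
  have "t \<in> monoms (c (True # ?F) - ?d)"
    using Cons.prems(2) by simp
  then have "t \<in> monoms (c (True # ?F)) \<or> t \<in> monoms ?d"
    by (metis diff_zero in_keys_iff lookup_minus)
  then show ?case
  proof
    assume "t \<in> monoms (c (True # ?F))"
    then have "e \<subseteq> vars t"
      using Cons.prems(1)[of "True # ?F"] by (simp add: multiples_def)
    then show ?thesis by simp
  next
    assume t: "t \<in> monoms ?d"
    have "\<exists>e \<in> set es. e \<subseteq> vars t"
      by (rule Cons.IH[OF _ t]) (use Cons.prems(1)[of "False # _"] in simp)
    then show ?thesis by simp
  qed
qed simp

text \<open>Induction on \<open>es\<close>: the part of a cycle consisting of multiples of \<open>e\<close> is a boundary in the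
  cone over \<open>e\<close>; the rest is a cycle for the remaining generators.\<close>

lemma taylor_exact:
  fixes c :: "bool list \<Rightarrow> ('v \<Rightarrow>\<^sub>0 nat) \<Rightarrow>\<^sub>0 'k::ab_group_add"
  assumes c: "\<And>s. length s = length es \<Longrightarrow> c s \<in> multiples V (selected_union es s)"
    and cycle: "\<And>s. length s = length es \<Longrightarrow> Suc (weight s) = j \<Longrightarrow> taylor_diff c s = 0"
    and ideal: "\<And>t. j = 0 \<Longrightarrow> t \<in> monoms (c (replicate (length es) False)) \<Longrightarrow> \<exists>e \<in> set es. e \<subseteq> vars t"
  shows "\<exists>b. (\<forall>s. length s = length es \<longrightarrow> b s \<in> multiples V (selected_union es s)) \<and>
    (\<forall>s. length s = length es \<and> weight s = j \<longrightarrow> taylor_diff b s = c s)"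
  using assms
proof (induction es arbitrary: c j)
  case Nil
  have "c [] = 0" if "j = 0"
    using Nil.prems(3)[OF that] by (metis empty_iff empty_set ex_in_conv keys_eq_empty list.size(3) replicate_0)
  then show ?case
    by (intro exI[of _ "\<lambda>_. 0"]) auto
next
  case (Cons e es)
  let ?c1 = "\<lambda>s. restrict_monoms (\<lambda>t. e \<subseteq> vars t) (c (False # s))"
  let ?c2 = "\<lambda>s. restrict_monoms (\<lambda>t. \<not> e \<subseteq> vars t) (c (False # s))"
  have cF: "c (False # s) \<in> multiples V (selected_union es s)" if "length s = length es" for s
    using Cons.prems(1)[of "False # s"] that by simp
  have cT: "c (True # s) \<in> multiples V (e \<union> selected_union es s)" if "length s = length es" for s
    using Cons.prems(1)[of "True # s"] that by simp
  have split: "?c1 s + ?c2 s = c (False # s)" for s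
    by (rule restrict_monoms_split)
  \<comment> \<open>The cycle condition equates the boundary of the \<open>False\<close> part with
    the \<open>True\<close> part, which consists of multiples of \<open>e\<close>; discarding such
    monomials commutes with the boundary and leaves zero.\<close>
  have d2: "taylor_diff ?c2 s = 0" if s: "length s = length es" "Suc (weight s) = j" for s
  proof -
    have "taylor_diff ?c2 s = restrict_monoms (\<lambda>t. \<not> e \<subseteq> vars t) (taylor_diff (\<lambda>s. c (False # s)) s)"
      by (rule taylor_diff_hom) (rule restrict_monoms_diff)
    also have "taylor_diff (\<lambda>s. c (False # s)) s = c (True # s)"
      using Cons.prems(2)[of "False # s"] s by simp
    also have "restrict_monoms (\<lambda>t. \<not> e \<subseteq> vars t) (c (True # s)) = 0"
    proof -
      have "monoms (restrict_monoms (\<lambda>t. \<not> e \<subseteq> vars t) (c (True # s))) = {}"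
        using cT[OF s(1)] by (auto simp: monoms_restrict_monoms multiples_def)
      then show ?thesis by simp
    qed
    finally show ?thesis .
  qed
  have "\<exists>b. (\<forall>s. length s = length es \<longrightarrow> b s \<in> multiples V (selected_union es s)) \<and>
    (\<forall>s. length s = length es \<and> weight s = j \<longrightarrow> taylor_diff b s = ?c2 s)"
  proof (rule Cons.IH)
    show "?c2 s \<in> multiples V (selected_union es s)" if "length s = length es" for s
      using cF[OF that] by (rule multiples_restrict_monoms)
    show "\<exists>e \<in> set es. e \<subseteq> vars t" if "j = 0" "t \<in> monoms (?c2 (replicate (length es) False))" for t
      using Cons.prems(3)[of t] that by (auto simp: monoms_restrict_monoms)
  qed (rule d2)
  then obtain b where b: "\<And>s. length s = length es \<Longrightarrow> b s \<in> multiples V (selected_union es s)"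
    and bc: "\<And>s. length s = length es \<Longrightarrow> weight s = j \<Longrightarrow> taylor_diff b s = ?c2 s"
    by blast
  have d1: "taylor_diff ?c1 s = c (True # s)" if s: "length s = length es" "Suc (weight s) = j" for s
  proof -
    have "?c1 = (\<lambda>s. c (False # s) - ?c2 s)"
      using split by (simp add: fun_eq_iff eq_diff_eq)
    then have "taylor_diff ?c1 s = taylor_diff (\<lambda>s. c (False # s)) s - taylor_diff ?c2 s"
      by (simp only: taylor_diff_diff)
    then show ?thesis
      using d2[OF s] Cons.prems(2)[of "False # s"] s by simp
  qed
  \<comment> \<open>On \<open>True\<close> strings the boundary is that of \<open>?c1\<close>, which
    is \<open>c\<close> by \<open>d1\<close>. On \<open>False\<close> strings it is
    \<open>?c1\<close> plus the boundary of \<open>b\<close>, thus the sum of both parts of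
    \<open>c\<close>.\<close>
  let ?b = "\<lambda>s. case s of [] \<Rightarrow> 0 | a # t \<Rightarrow> if a then ?c1 t else - b t"
  have "?b s \<in> multiples V (selected_union (e # es) s)" if "length s = length (e # es)" for s
  proof (cases s)
    case s: (Cons a t)
    have t: "length t = length es"
      using that s by simp
    show ?thesis
    proof (cases a)
      case True
      then show ?thesis
        using cF[OF t] by (auto simp: s multiples_def monoms_restrict_monoms)
    next
      case False
      then show ?thesis
        using multiples_uminus[OF b[OF t]] by (simp add: s)
    qed
  qed (use that in simp)
  moreover have "taylor_diff ?b s = c s" if "length s = length (e # es)" "weight s = j" for s
  proof (cases s)
    case s: (Cons a t)
    have neg: "taylor_diff (\<lambda>t. - b t) t = - taylor_diff b t"
      by (rule taylor_diff_hom) simp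
    show ?thesis
    proof (cases a)
      case True
      then show ?thesis
        using d1[of t] s that by simp
    next
      case False
      then show ?thesis
        using bc[of t] s that split[of t] by (simp add: neg)
    qed
  qed (use that in simp)
  ultimately show ?case
    by blast
qed

text \<open>The inverse of a bijective homomorphism is again one, so \<open>P\<close> is a retract
  of the free module. The index set has the element type of \<open>P\<close> because
  \<open>projective_module\<close> insists on it.\<close>

lemma projective_module_if_free:
  fixes P :: "('a, 'p) module" and I :: "'p set"
  assumes "cring R" "module R P" and g: "g \<in> mod_hom R (free_module R I) P"
    and bij: "bij_betw g (carrier (free_module R I)) (carrier P)"
  shows "projective_module R P"
proof -
  let ?F = "free_module R I"
  let ?s = "inv_into (carrier ?F) g"
  interpret F: module R ?F by (rule module_free_module[OF assms(1)])
  interpret P: module R P by fact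
  have inj: "inj_on g (carrier ?F)" and im: "g ` carrier ?F = carrier P"
    using bij by (auto simp: bij_betw_def)
  have s: "?s x \<in> carrier ?F" "g (?s x) = x" if "x \<in> carrier P" for x
    using that im inv_into_into[of x g "carrier ?F"] f_inv_into_f[of x g "carrier ?F"] by auto
  have sg: "?s y = x" if "x \<in> carrier ?F" "g x = y" for x y
    using inv_into_f_f[OF inj] that by auto
  have "?s \<in> mod_hom R P ?F"
    unfolding mod_hom_def
  proof (intro CollectI conjI ballI)
    show "?s \<in> carrier P \<rightarrow> carrier ?F"
      using s(1) by blast
    fix x y assume xy: "x \<in> carrier P" "y \<in> carrier P"
    show "?s (x \<oplus>\<^bsub>P\<^esub> y) = ?s x \<oplus>\<^bsub>?F\<^esub> ?s y"
      by (rule sg[OF F.M.a_closed[OF s(1) s(1)]])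
        (simp_all only: mod_hom_add[OF g s(1) s(1)] s(2) xy)
  next
    fix r x assume rx: "r \<in> carrier R" "x \<in> carrier P"
    show "?s (r \<odot>\<^bsub>P\<^esub> x) = r \<odot>\<^bsub>?F\<^esub> ?s x"
      by (rule sg[OF F.smult_closed[OF _ s(1)]])
        (simp_all only: mod_hom_smult[OF g _ s(1)] s(2) rx)
  qed
  then show ?thesis
    unfolding projective_module_def using g s(2) assms(2) by blast
qed

section \<open>The Taylor modules over the polynomial ring\<close>

definition strings :: "nat \<Rightarrow> nat \<Rightarrow> bool list set" where
  "strings N i = {s. length s = N \<and> weight s = i}"

lemma finite_strings: "finite (strings N i)"
  by (rule finite_subset[OF _ finite_lists_length_eq[of "UNIV :: bool set" N]]) (auto simp: strings_def)

text \<open>Strings are encoded as natural numbers because \<open>projective_dimension\<close> requires modules with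
  elements in \<open>nat \<Rightarrow> 'a\<close>.\<close>

definition taylor_module :: "'v set \<Rightarrow> 'v set list \<Rightarrow> nat \<Rightarrow>
    (('v \<Rightarrow>\<^sub>0 nat) \<Rightarrow>\<^sub>0 'k::comm_ring_1, nat \<Rightarrow> ('v \<Rightarrow>\<^sub>0 nat) \<Rightarrow>\<^sub>0 'k) module" where
  "taylor_module V es i = (free_module (mpoly_ring V) UNIV)
     \<lparr>carrier := {\<phi>. (\<forall>s. length s = length es \<longrightarrow> \<phi> (to_nat s) \<in> multiples V (selected_union es s)) \<and>
        (\<forall>k. k \<notin> to_nat ` strings (length es) i \<longrightarrow> \<phi> k = 0)}\<rparr>"

text \<open>The index \<open>i\<close> is the degree of the target, as for the differentials in
  \<open>projective_resolution\<close>. Codes of other degrees are sent to zero so that the values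
  lie in the Taylor module of degree \<open>i\<close>.\<close>

definition taylor_boundary ::
  "nat \<Rightarrow> nat \<Rightarrow> (nat \<Rightarrow> 'a::ab_group_add) \<Rightarrow> nat \<Rightarrow> 'a" where
  "taylor_boundary N i \<phi> k =
     (if k \<in> to_nat ` strings N i then taylor_diff (\<lambda>s. \<phi> (to_nat s)) (from_nat k) else 0)"

lemma taylor_module_simps [simp]:
  "\<zero>\<^bsub>taylor_module V es i\<^esub> = (\<lambda>_. 0)"
  "b \<oplus>\<^bsub>taylor_module V es i\<^esub> c = (\<lambda>k. b k + c k)"
  "r \<odot>\<^bsub>taylor_module V es i\<^esub> c = (\<lambda>k. r * c k)"
  by (simp_all add: taylor_module_def)

lemma carrier_taylor_module:
  "carrier (taylor_module V es i) =
    {\<phi>. (\<forall>s. length s = length es \<longrightarrow> \<phi> (to_nat s) \<in> multiples V (selected_union es s)) \<and>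
        (\<forall>k. k \<notin> to_nat ` strings (length es) i \<longrightarrow> \<phi> k = 0)}"
  by (simp add: taylor_module_def)

lemma carrier_taylor_moduleI:
  assumes "\<And>s. s \<in> strings (length es) i \<Longrightarrow> \<phi> (to_nat s) \<in> multiples V (selected_union es s)"
    and "\<And>k. k \<notin> to_nat ` strings (length es) i \<Longrightarrow> \<phi> k = 0"
  shows "\<phi> \<in> carrier (taylor_module V es i)"
  unfolding carrier_taylor_module
proof (intro CollectI conjI allI impI)
  fix s :: "bool list"
  assume "length s = length es"
  show "\<phi> (to_nat s) \<in> multiples V (selected_union es s)"
  proof (cases "s \<in> strings (length es) i")
    case True
    then show ?thesis by (rule assms(1))
  next
    case False
    then have "to_nat s \<notin> to_nat ` strings (length es) i"
      by auto
    then show ?thesis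
      by (simp add: assms(2))
  qed
qed (rule assms(2))

text \<open>Obtained as a submodule of a free module on all natural numbers, which saves checking
  the module axioms.\<close>

lemma module_taylor_module:
  "module (mpoly_ring V) (taylor_module V es i :: (('v \<Rightarrow>\<^sub>0 nat) \<Rightarrow>\<^sub>0 'k::comm_ring_1, _) module)"
proof -
  let ?R = "mpoly_ring V :: (('v \<Rightarrow>\<^sub>0 nat) \<Rightarrow>\<^sub>0 'k) ring"
  let ?F = "free_module ?R (UNIV :: nat set)"
  let ?H = "carrier (taylor_module V es i :: (('v \<Rightarrow>\<^sub>0 nat) \<Rightarrow>\<^sub>0 'k, _) module)"
  interpret R: cring ?R by (rule cring_mpoly_ring)
  interpret F: module ?R ?F by (rule module_free_module[OF cring_mpoly_ring])
  have sub: "?H \<subseteq> carrier ?F"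
  proof
    fix \<phi> assume \<phi>: "\<phi> \<in> ?H"
    have "\<phi> k \<in> carrier ?R" for k
    proof (cases "k \<in> to_nat ` strings (length es) i")
      case True
      then obtain s where "s \<in> strings (length es) i" "k = to_nat s"
        by blast
      then have "\<phi> k \<in> multiples V (selected_union es s)"
        using \<phi> by (simp add: carrier_taylor_module strings_def)
      then show ?thesis
        using multiples_subset_carrier by blast
    next
      case False
      then have "\<phi> k = 0"
        using \<phi> by (simp add: carrier_taylor_module)
      then show ?thesis
        using R.zero_closed by simp
    qed
    moreover have "{k. \<phi> k \<noteq> 0} \<subseteq> to_nat ` strings (length es) i"
      using \<phi> by (auto simp: carrier_taylor_module)
    then have "finite {k. \<phi> k \<noteq> 0}"
      by (rule finite_subset) (simp add: finite_strings)
    ultimately show "\<phi> \<in> carrier ?F"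
      by (simp add: carrier_free_module)
  qed
  have smult: "a \<odot>\<^bsub>?F\<^esub> x \<in> ?H" if "a \<in> carrier ?R" "x \<in> ?H" for a x
    using that by (simp add: carrier_taylor_module multiples_mult)
  have "submodule ?H ?R ?F"
  proof (rule F.submoduleI[OF sub])
    show "\<zero>\<^bsub>?F\<^esub> \<in> ?H"
      by (simp add: carrier_taylor_module)
    show "a \<oplus>\<^bsub>?F\<^esub> b \<in> ?H" if "a \<in> ?H" "b \<in> ?H" for a b
      using that by (simp add: carrier_taylor_module multiples_add)
    fix a assume a: "a \<in> ?H"
    have "\<ominus>\<^bsub>?F\<^esub> a = (\<ominus>\<^bsub>?R\<^esub> \<one>\<^bsub>?R\<^esub>) \<odot>\<^bsub>?F\<^esub> a"
      using F.smult_l_minus[OF R.one_closed subsetD[OF sub a]] F.smult_one[OF subsetD[OF sub a]] by (simp only:)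
    then show "\<ominus>\<^bsub>?F\<^esub> a \<in> ?H"
      using smult[OF R.a_inv_closed[OF R.one_closed] a] by (simp only:)
  qed (rule smult)
  from submodule.submodule_is_module[OF this F.module_axioms]
  show ?thesis
    by (simp add: taylor_module_def)
qed

lemma projective_taylor_module:
  assumes es: "\<forall>e \<in> set es. finite e \<and> e \<subseteq> V"
  shows "projective_module (mpoly_ring V) (taylor_module V es i :: (('v \<Rightarrow>\<^sub>0 nat) \<Rightarrow>\<^sub>0 'k::comm_ring_1, _) module)"
proof -
  let ?R = "mpoly_ring V :: (('v \<Rightarrow>\<^sub>0 nat) \<Rightarrow>\<^sub>0 'k) ring"
  let ?P = "taylor_module V es i :: (('v \<Rightarrow>\<^sub>0 nat) \<Rightarrow>\<^sub>0 'k, _) module"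
  let ?K = "to_nat ` strings (length es) i"
  \<comment> \<open>The basis must consist of elements of the type of the module, so the code
    \<open>k\<close> is represented by its Kronecker delta. The map \<open>g\<close> multiplies the
    coordinate of \<open>k\<close> by the monomial \<open>m k\<close>, a generator of the
    corresponding summand.\<close>
  define \<iota> :: "nat \<Rightarrow> nat \<Rightarrow> ('v \<Rightarrow>\<^sub>0 nat) \<Rightarrow>\<^sub>0 'k" where "\<iota> k = (\<lambda>j. if j = k then 1 else 0)" for k
  define m where "m k = squarefree_monom (selected_union es (from_nat k))" for k
  define g :: "((nat \<Rightarrow> ('v \<Rightarrow>\<^sub>0 nat) \<Rightarrow>\<^sub>0 'k) \<Rightarrow> ('v \<Rightarrow>\<^sub>0 nat) \<Rightarrow>\<^sub>0 'k) \<Rightarrow> nat \<Rightarrow> ('v \<Rightarrow>\<^sub>0 nat) \<Rightarrow>\<^sub>0 'k" where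
    "g c k = (if k \<in> ?K then Poly_Mapping.single (m k) 1 * c (\<iota> k) else 0)" for c k
  let ?F = "free_module ?R (\<iota> ` ?K)"
  have inj_\<iota>: "\<iota> k = \<iota> l \<longleftrightarrow> k = l" for k l
    by (metis (mono_tags) \<iota>_def zero_neq_one)
  have union: "finite (selected_union es s)" "selected_union es s \<subseteq> V" for s
  proof -
    show "finite (selected_union es s)"
      using es by (intro finite_selected_union) blast
    show "selected_union es s \<subseteq> V"
      using es by (induction es s rule: selected_union.induct) auto
  qed
  have keys_m: "monoms (Poly_Mapping.single (m k) 1 * q) = (+) (m k) ` monoms q"
    "vars (m k) = selected_union es (from_nat k)" for k and q :: "('v \<Rightarrow>\<^sub>0 nat) \<Rightarrow>\<^sub>0 'k"
    by (simp_all add: keys_single_1_mult m_def vars_squarefree_monom union)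
  have g_closed: "g c \<in> carrier ?P" if "c \<in> carrier ?F" for c
  proof (rule carrier_taylor_moduleI)
    fix s :: "bool list" assume "s \<in> strings (length es) i"
    moreover have "c (\<iota> (to_nat s)) \<in> carrier ?R"
      using that by (simp add: carrier_free_module)
    ultimately show "g c (to_nat s) \<in> multiples V (selected_union es s)"
      using union by (auto simp: g_def multiples_def keys_m vars_add carrier_mpoly_ring)
  qed (simp add: g_def)
  have "g \<in> mod_hom ?R ?F ?P"
    using g_closed by (auto simp: mod_hom_def g_def fun_eq_iff distrib_left mult.left_commute)
  moreover have "bij_betw g (carrier ?F) (carrier ?P)"
    unfolding bij_betw_def
  proof
    show "inj_on g (carrier ?F)"
    proof (rule inj_onI)
      fix b c assume b: "b \<in> carrier ?F" and c: "c \<in> carrier ?F" and eq: "g b = g c"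
      have "b (\<iota> k) = c (\<iota> k)" if "k \<in> ?K" for k
      proof (rule poly_mapping_eqI)
        fix t
        have "Poly_Mapping.single (m k) 1 * b (\<iota> k) = Poly_Mapping.single (m k) 1 * c (\<iota> k)"
          using fun_cong[OF eq, of k] that by (simp add: g_def)
        then show "Poly_Mapping.lookup (b (\<iota> k)) t = Poly_Mapping.lookup (c (\<iota> k)) t"
          by (metis lookup_single_1_mult)
      qed
      moreover have "b p = 0" "c p = 0" if "p \<notin> \<iota> ` ?K" for p
        using b c that by (auto simp: carrier_free_module)
      ultimately show "b = c"
        by (metis ext imageE)
    qed
    show "g ` carrier ?F = carrier ?P"
    proof
      show "g ` carrier ?F \<subseteq> carrier ?P"
        using g_closed by blast
      show "carrier ?P \<subseteq> g ` carrier ?F"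
      proof
        fix \<phi> assume \<phi>: "\<phi> \<in> carrier ?P"
        have "\<exists>q. \<phi> k = Poly_Mapping.single (m k) 1 * q \<and> q \<in> carrier ?R" if k: "k \<in> ?K" for k
        proof -
          obtain s :: "bool list" where s: "k = to_nat s" "length s = length es"
            using k unfolding strings_def by blast
          have \<phi>k: "\<phi> k \<in> multiples V (selected_union es s)"
            using \<phi> s by (simp add: carrier_taylor_module)
          have "\<And>t. t \<in> monoms (\<phi> k) \<Longrightarrow> selected_union es s \<subseteq> vars t" and m: "m k = squarefree_monom (selected_union es s)"
            using \<phi>k by (auto simp: multiples_def m_def s)
          then obtain q where q: "\<phi> k = Poly_Mapping.single (m k) 1 * q"
            using squarefree_monom_dvd[OF union(1)] unfolding m by blast
          have "vars t \<subseteq> V" if "t \<in> monoms q" for t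
          proof -
            have "m k + t \<in> monoms (\<phi> k)"
              using that by (simp add: q keys_m)
            then have "vars (m k + t) \<subseteq> V"
              using \<phi>k unfolding multiples_def by blast
            then show ?thesis
              by (simp add: vars_add)
          qed
          then show ?thesis
            using q by (auto simp: carrier_mpoly_ring)
        qed
        then obtain q where q: "\<And>k. k \<in> ?K \<Longrightarrow> \<phi> k = Poly_Mapping.single (m k) 1 * q k"
          "\<And>k. k \<in> ?K \<Longrightarrow> q k \<in> carrier ?R"
          by metis
        define c where "c p = (if p \<in> \<iota> ` ?K then q (inv_into ?K \<iota> p) else 0)" for p
        have c\<iota>: "c (\<iota> k) = q k" if "k \<in> ?K" for k
        proof -
          have "inv_into ?K \<iota> (\<iota> k) = k"
            by (rule inv_into_f_f) (use that inj_\<iota> in \<open>auto simp: inj_on_def\<close>)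
          then show ?thesis
            using that by (simp add: c_def)
        qed
        have "c p \<in> carrier ?R" for p
        proof (cases "p \<in> \<iota> ` ?K")
          case True
          then show ?thesis using c\<iota> q(2) by (metis imageE)
        next
          case False
          then show ?thesis by (simp add: c_def carrier_mpoly_ring)
        qed
        moreover have "{p. c p \<noteq> 0} \<subseteq> \<iota> ` ?K"
          by (auto simp: c_def)
        moreover from this have "finite {p. c p \<noteq> 0}"
          by (rule finite_subset) (simp add: finite_strings)
        ultimately have "c \<in> carrier ?F"
          by (simp add: carrier_free_module)
        moreover have "g c k = \<phi> k" for k
          using \<phi> q(1) c\<iota> by (simp add: g_def carrier_taylor_module)
        ultimately show "\<phi> \<in> g ` carrier ?F"
          by (metis ext image_eqI)
      qed
    qed
  qed
  ultimately show ?thesis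
    by (rule projective_module_if_free[OF cring_mpoly_ring module_taylor_module])
qed

text \<open>The content is \<open>taylor_exact\<close>; the rest transports it to coded strings and
  to single degrees. Only strings of weight 0 touch the edge ideal, which is where the augmentation
  enters.\<close>

lemma taylor_resolution:
  fixes E :: "'v set set"
  assumes E: "set es = E" "E \<subseteq> nsets V 2"
  defines "I \<equiv> edge_ideal V E :: (('v \<Rightarrow>\<^sub>0 nat) \<Rightarrow>\<^sub>0 'k::comm_ring_1) set"
  shows "projective_resolution (mpoly_ring V) (quotient_module (mpoly_ring V) I)
    (taylor_module V es) (taylor_boundary (length es))
    (\<lambda>\<phi>. I +>\<^bsub>mpoly_ring V\<^esub> \<phi> (to_nat (replicate (length es) False)))"
    (is "projective_resolution ?R ?M ?P ?\<delta> ?\<epsilon>")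
proof -
  interpret R: cring ?R by (rule cring_mpoly_ring)
  have ideal: "ideal I ?R"
    unfolding I_def by (rule ideal_edge_ideal[OF E(2)])
  interpret I: ideal I ?R by (rule ideal)
  interpret h: ring_hom_cring ?R "?R Quot I" "(+>\<^bsub>?R\<^esub>) I"
    by (rule I.rcos_ring_hom_cring[OF cring_mpoly_ring])
  let ?N = "length es"
  let ?F = "replicate ?N False"
  have I_iff: "q \<in> I \<longleftrightarrow> q \<in> carrier ?R \<and> (\<forall>t \<in> monoms q. \<exists>e \<in> set es. e \<subseteq> vars t)" for q
    unfolding I_def edge_ideal_eq[OF E(2)] E(1) by simp
  have PF: "\<phi> (to_nat s) \<in> multiples V (selected_union es s)" "\<phi> (to_nat s) \<in> carrier ?R"
    if "\<phi> \<in> carrier (?P i)" "length s = ?N" for \<phi> s i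
    using that multiples_subset_carrier unfolding carrier_taylor_module by blast+
  have P0: "\<phi> k = 0" if "\<phi> \<in> carrier (?P i)" "k \<notin> to_nat ` strings ?N i" for \<phi> k i
    using that by (simp add: carrier_taylor_module)
  have \<delta>_eq: "?\<delta> i \<phi> (to_nat s) = taylor_diff (\<lambda>s. \<phi> (to_nat s)) s" if "s \<in> strings ?N i" for i \<phi> s
    using that by (simp add: taylor_boundary_def)
  have \<delta>_0: "?\<delta> i \<phi> k = 0" if "k \<notin> to_nat ` strings ?N i" for i \<phi> k
    using that by (simp add: taylor_boundary_def)
  have \<delta>_closed: "?\<delta> i \<phi> \<in> carrier (?P i)" if \<phi>: "\<phi> \<in> carrier (?P (Suc i))" for i \<phi>
  proof (rule carrier_taylor_moduleI)
    fix s :: "bool list" assume s: "s \<in> strings ?N i"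
    have "taylor_diff (\<lambda>s. \<phi> (to_nat s)) s \<in> multiples V ({} \<union> selected_union es s)"
      by (rule taylor_diff_multiples) (use s PF(1)[OF \<phi>] in \<open>auto simp: strings_def\<close>)
    then show "?\<delta> i \<phi> (to_nat s) \<in> multiples V (selected_union es s)"
      using s by (simp add: \<delta>_eq)
  qed (rule \<delta>_0)
  have \<delta>_hom: "?\<delta> i \<in> mod_hom ?R (?P (Suc i)) (?P i)" for i
    unfolding mod_hom_def
  proof (intro CollectI conjI ballI)
    show "?\<delta> i \<in> carrier (?P (Suc i)) \<rightarrow> carrier (?P i)"
      using \<delta>_closed by blast
    fix \<phi> \<psi> :: "nat \<Rightarrow> ('v \<Rightarrow>\<^sub>0 nat) \<Rightarrow>\<^sub>0 'k"
    have "taylor_diff (\<lambda>s. \<phi> (to_nat s) + \<psi> (to_nat s)) s =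
        taylor_diff (\<lambda>s. \<phi> (to_nat s)) s + taylor_diff (\<lambda>s. \<psi> (to_nat s)) s" for s :: "bool list"
      using taylor_diff_diff[of "\<lambda>s. \<phi> (to_nat s) + \<psi> (to_nat s)" "\<lambda>s. \<psi> (to_nat s)" s] by (simp add: eq_diff_eq)
    then show "?\<delta> i (\<phi> \<oplus>\<^bsub>?P (Suc i)\<^esub> \<psi>) = ?\<delta> i \<phi> \<oplus>\<^bsub>?P i\<^esub> ?\<delta> i \<psi>"
      by (simp add: taylor_boundary_def fun_eq_iff)
  next
    fix r :: "('v \<Rightarrow>\<^sub>0 nat) \<Rightarrow>\<^sub>0 'k" and \<phi>
    have "taylor_diff (\<lambda>s. r * \<phi> (to_nat s)) s = r * taylor_diff (\<lambda>s. \<phi> (to_nat s)) s" for s :: "bool list"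
      by (rule taylor_diff_hom) (rule right_diff_distrib)
    then show "?\<delta> i (r \<odot>\<^bsub>?P (Suc i)\<^esub> \<phi>) = r \<odot>\<^bsub>?P i\<^esub> ?\<delta> i \<phi>"
      by (simp add: taylor_boundary_def fun_eq_iff)
  qed
  \<comment> \<open>Serves both kernels: for \<open>j = 0\<close> the cycle condition is void and
    membership in the edge ideal takes its place; for positive \<open>j\<close> it is the other way
    round.\<close>
  have exact: "\<exists>\<psi> \<in> carrier (?P (Suc j)). ?\<delta> j \<psi> = \<phi>"
    if \<phi>: "\<phi> \<in> carrier (?P j)"
      and cycle: "\<And>s. length s = ?N \<Longrightarrow> Suc (weight s) = j \<Longrightarrow> taylor_diff (\<lambda>s. \<phi> (to_nat s)) s = 0"
      and ideal: "\<And>t. j = 0 \<Longrightarrow> t \<in> monoms (\<phi> (to_nat ?F)) \<Longrightarrow> \<exists>e \<in> set es. e \<subseteq> vars t" for j \<phi>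
  proof -
    obtain b where b: "\<And>s. length s = ?N \<Longrightarrow> b s \<in> multiples V (selected_union es s)"
      and b\<phi>: "\<And>s. length s = ?N \<Longrightarrow> weight s = j \<Longrightarrow> taylor_diff b s = \<phi> (to_nat s)"
      using taylor_exact[of es "\<lambda>s. \<phi> (to_nat s)" V j, OF PF(1)[OF \<phi>] cycle ideal] by blast
    define \<psi> where "\<psi> k = (if k \<in> to_nat ` strings ?N (Suc j) then b (from_nat k) else 0)" for k
    have "\<psi> \<in> carrier (?P (Suc j))"
      by (rule carrier_taylor_moduleI) (use b in \<open>auto simp: \<psi>_def strings_def\<close>)
    moreover have "?\<delta> j \<psi> k = \<phi> k" for k
    proof (cases "k \<in> to_nat ` strings ?N j")
      case True
      then obtain s where k: "k = to_nat s" and s: "s \<in> strings ?N j"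
        by blast
      have "taylor_diff (\<lambda>s. \<psi> (to_nat s)) s = taylor_diff b s"
        by (rule taylor_diff_cong) (use s in \<open>auto simp: \<psi>_def strings_def\<close>)
      also have "\<dots> = \<phi> k"
        unfolding k by (rule b\<phi>) (use s in \<open>auto simp: strings_def\<close>)
      finally show ?thesis
        using \<delta>_eq[OF s] k by simp
    next
      case False
      then show ?thesis
        using \<delta>_0 P0[OF \<phi>] by simp
    qed
    ultimately show ?thesis
      by blast
  qed
  have F: "?F \<in> strings ?N 0"
    by (simp add: strings_def weight_eq_0_iff)
  have \<epsilon>_zero: "?\<epsilon> \<phi> = \<zero>\<^bsub>?M\<^esub> \<longleftrightarrow> \<phi> (to_nat ?F) \<in> I" if "\<phi> \<in> carrier (?P 0)" for \<phi>
  proof -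
    have c: "\<phi> (to_nat ?F) \<in> carrier ?R"
      using PF(2)[OF that] by simp
    have "\<zero>\<^bsub>?M\<^esub> = I +>\<^bsub>?R\<^esub> 0"
      using h.hom_zero by simp
    then show ?thesis
      using a_r_coset_eq_iff[OF R.ring_axioms ideal c R.zero_closed]
        a_minus_mpoly_ring[OF R.zero_closed] by simp
  qed
  have \<epsilon>_hom: "?\<epsilon> \<in> mod_hom ?R (?P 0) ?M"
    unfolding mod_hom_def
  proof (intro CollectI conjI ballI)
    show "?\<epsilon> \<in> carrier (?P 0) \<rightarrow> carrier ?M"
      using PF(2) by (auto intro!: h.hom_closed)
    fix \<phi> \<psi> assume "\<phi> \<in> carrier (?P 0)" "\<psi> \<in> carrier (?P 0)"
    then show "?\<epsilon> (\<phi> \<oplus>\<^bsub>?P 0\<^esub> \<psi>) = ?\<epsilon> \<phi> \<oplus>\<^bsub>?M\<^esub> ?\<epsilon> \<psi>"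
      using h.hom_add[OF PF(2) PF(2), of \<phi> 0 ?F \<psi> 0 ?F] by simp
  next
    fix r \<phi> assume "r \<in> carrier ?R" "\<phi> \<in> carrier (?P 0)"
    then show "?\<epsilon> (r \<odot>\<^bsub>?P 0\<^esub> \<phi>) = r \<odot>\<^bsub>?M\<^esub> ?\<epsilon> \<phi>"
      using h.hom_mult[OF _ PF(2), of r \<phi> 0 ?F] by simp
  qed
  have \<epsilon>_surj: "?\<epsilon> ` carrier (?P 0) = carrier ?M"
  proof
    show "?\<epsilon> ` carrier (?P 0) \<subseteq> carrier ?M"
      using PF(2) by (auto intro!: h.hom_closed)
    show "carrier ?M \<subseteq> ?\<epsilon> ` carrier (?P 0)"
    proof
      fix x assume "x \<in> carrier ?M"
      then obtain q where q: "q \<in> carrier ?R" "x = I +>\<^bsub>?R\<^esub> q"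
        unfolding quotient_module_simps carrier_FactRing by blast
      have s: "s = ?F" if "s \<in> strings ?N 0" for s
        using that weight_eq_0_iff[of s] unfolding strings_def by (metis (mono_tags) mem_Collect_eq)
      have "selected_union es (replicate (length es) False) = {}" for es :: "'v set list"
        by (induction es) auto
      then have "(\<lambda>k. if k = to_nat ?F then q else 0) \<in> carrier (?P 0)"
        using q(1) F by (intro carrier_taylor_moduleI)
          (auto simp: multiples_def carrier_mpoly_ring dest: s)
      then show "x \<in> ?\<epsilon> ` carrier (?P 0)"
        using q(2) by (intro image_eqI) auto
    qed
  qed
  have ker_\<epsilon>: "?\<delta> 0 ` carrier (?P 1) = mod_ker (?P 0) ?M ?\<epsilon>"
  proof
    show "?\<delta> 0 ` carrier (?P 1) \<subseteq> mod_ker (?P 0) ?M ?\<epsilon>"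
    proof
      fix \<psi> assume "\<psi> \<in> ?\<delta> 0 ` carrier (?P 1)"
      then obtain \<phi> where \<phi>: "\<phi> \<in> carrier (?P 1)" and \<psi>: "\<psi> = ?\<delta> 0 \<phi>"
        by blast
      have \<psi>P: "\<psi> \<in> carrier (?P 0)"
        using \<delta>_closed[of \<phi> 0] \<phi> \<psi> by simp
      have "\<exists>e \<in> set es. e \<subseteq> vars t" if "t \<in> monoms (\<psi> (to_nat ?F))" for t
        using taylor_diff_weight_0[of es "\<lambda>s. \<phi> (to_nat s)" V t, OF PF(1)[OF \<phi>]] that \<delta>_eq[OF F]
        by (simp add: \<psi>)
      then have "\<psi> (to_nat ?F) \<in> I"
        using PF(2)[OF \<psi>P, of ?F] by (simp add: I_iff)
      then show "\<psi> \<in> mod_ker (?P 0) ?M ?\<epsilon>"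
        using \<epsilon>_zero[OF \<psi>P] \<psi>P by (simp only: mod_ker_def mem_Collect_eq simp_thms)
    qed
    show "mod_ker (?P 0) ?M ?\<epsilon> \<subseteq> ?\<delta> 0 ` carrier (?P 1)"
    proof
      fix \<phi> assume "\<phi> \<in> mod_ker (?P 0) ?M ?\<epsilon>"
      then have \<phi>: "\<phi> \<in> carrier (?P 0)" and "?\<epsilon> \<phi> = \<zero>\<^bsub>?M\<^esub>"
        by (simp_all only: mod_ker_def mem_Collect_eq)
      then have "\<phi> (to_nat ?F) \<in> I"
        using \<epsilon>_zero[OF \<phi>] by (simp only:)
      then have "\<exists>e \<in> set es. e \<subseteq> vars t" if "t \<in> monoms (\<phi> (to_nat ?F))" for t
        using that unfolding I_iff by blast
      then have "\<exists>\<psi> \<in> carrier (?P (Suc 0)). ?\<delta> 0 \<psi> = \<phi>"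
        by (intro exact[OF \<phi>]) simp_all
      then show "\<phi> \<in> ?\<delta> 0 ` carrier (?P 1)"
        unfolding One_nat_def by blast
    qed
  qed
  have ker_\<delta>: "?\<delta> (Suc i) ` carrier (?P (Suc (Suc i))) = mod_ker (?P (Suc i)) (?P i) (?\<delta> i)" for i
  proof
    show "?\<delta> (Suc i) ` carrier (?P (Suc (Suc i))) \<subseteq> mod_ker (?P (Suc i)) (?P i) (?\<delta> i)"
    proof
      fix \<psi> assume "\<psi> \<in> ?\<delta> (Suc i) ` carrier (?P (Suc (Suc i)))"
      then obtain \<phi> where \<phi>: "\<phi> \<in> carrier (?P (Suc (Suc i)))" and \<psi>: "\<psi> = ?\<delta> (Suc i) \<phi>"
        by blast
      have "?\<delta> i \<psi> k = 0" for k
      proof (cases "k \<in> to_nat ` strings ?N i")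
        case True
        then obtain s where k: "k = to_nat s" and s: "s \<in> strings ?N i"
          by blast
        have "taylor_diff (\<lambda>s. \<psi> (to_nat s)) s = taylor_diff (taylor_diff (\<lambda>s. \<phi> (to_nat s))) s"
          by (rule taylor_diff_cong) (use s in \<open>auto simp: \<psi> \<delta>_eq strings_def\<close>)
        then show ?thesis
          using \<delta>_eq[OF s] by (simp add: k taylor_diff_taylor_diff)
      qed (rule \<delta>_0)
      then show "\<psi> \<in> mod_ker (?P (Suc i)) (?P i) (?\<delta> i)"
        using \<delta>_closed[OF \<phi>] by (simp add: mod_ker_def \<psi> fun_eq_iff)
    qed
    show "mod_ker (?P (Suc i)) (?P i) (?\<delta> i) \<subseteq> ?\<delta> (Suc i) ` carrier (?P (Suc (Suc i)))"
    proof
      fix \<phi> assume "\<phi> \<in> mod_ker (?P (Suc i)) (?P i) (?\<delta> i)"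
      then have \<phi>: "\<phi> \<in> carrier (?P (Suc i))" and \<delta>\<phi>: "?\<delta> i \<phi> = (\<lambda>_. 0)"
        by (simp_all add: mod_ker_def)
      have "\<exists>\<psi> \<in> carrier (?P (Suc (Suc i))). ?\<delta> (Suc i) \<psi> = \<phi>"
      proof (rule exact[OF \<phi>])
        fix s :: "bool list" assume "length s = ?N" "Suc (weight s) = Suc i"
        then show "taylor_diff (\<lambda>s. \<phi> (to_nat s)) s = 0"
          using \<delta>_eq[of s i \<phi>] fun_cong[OF \<delta>\<phi>, of "to_nat s"] by (simp add: strings_def)
      qed simp
      then show "\<phi> \<in> ?\<delta> (Suc i) ` carrier (?P (Suc (Suc i)))"
        by blast
    qed
  qed
  have "\<forall>e \<in> set es. finite e \<and> e \<subseteq> V"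
    using E by (auto simp: nsets_def)
  note proj = projective_taylor_module[OF this]
  show ?thesis
    unfolding projective_resolution_def
    by (intro conjI allI proj \<epsilon>_hom \<epsilon>_surj \<delta>_hom ker_\<epsilon> ker_\<delta>)
qed

text \<open>Unless the dimension is finite, \<open>the_enat\<close> carries no information. Strings
  have bounded weight, so the Taylor resolution is finite, the set of lengths is nonempty, and its
  infimum is attained.\<close>

lemma projective_dimension_edge_ideal:
  fixes V :: "'v set" and E
  defines "M \<equiv> quotient_module (mpoly_ring V :: (('v \<Rightarrow>\<^sub>0 nat) \<Rightarrow>\<^sub>0 'k::comm_ring_1) ring) (edge_ideal V E)"
  assumes V: "finite V" and E: "E \<subseteq> nsets V 2"
  obtains P :: "nat \<Rightarrow> (_, nat \<Rightarrow> ('v \<Rightarrow>\<^sub>0 nat) \<Rightarrow>\<^sub>0 'k::comm_ring_1) module" and \<delta> \<epsilon>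
  where "projective_resolution (mpoly_ring V) M P \<delta> \<epsilon>"
    and "\<And>i. i > the_enat (projective_dimension (mpoly_ring V) M) \<Longrightarrow> carrier (P i) = {\<zero>\<^bsub>P i\<^esub>}"
proof -
  let ?R = "mpoly_ring V :: (('v \<Rightarrow>\<^sub>0 nat) \<Rightarrow>\<^sub>0 'k) ring"
  let ?L = "{enat l | l. \<exists>(P :: nat \<Rightarrow> (_, nat \<Rightarrow> ('v \<Rightarrow>\<^sub>0 nat) \<Rightarrow>\<^sub>0 'k) module) \<delta> \<epsilon>.
       projective_resolution ?R M P \<delta> \<epsilon> \<and> (\<forall>i > l. carrier (P i) = {\<zero>\<^bsub>P i\<^esub>})}"
  have "finite (nsets V 2)"
    using V by (rule finite_imp_finite_nsets)
  then obtain es where es: "set es = E"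
    using E finite_list finite_subset by metis
  have empty: "strings (length es) i = {}" if "i > length es" for i
  proof -
    have "weight s \<noteq> i" if "length s = length es" for s
      using \<open>i > length es\<close> that weight_le_length[of s] by simp
    then show ?thesis
      unfolding strings_def by blast
  qed
  have "carrier (taylor_module V es i :: (_, nat \<Rightarrow> ('v \<Rightarrow>\<^sub>0 nat) \<Rightarrow>\<^sub>0 'k) module) = {\<zero>\<^bsub>taylor_module V es i\<^esub>}"
    if "i > length es" for i
  proof -
    have "to_nat ` strings (length es) i = {}"
      using empty[OF that] by simp
    then show ?thesis
      by (auto simp: carrier_taylor_module)
  qed
  then have "enat (length es) \<in> ?L"
    using taylor_resolution[OF es E] unfolding M_def by blast
  then have "Inf ?L \<in> ?L"
    unfolding Inf_enat_def by (smt (verit) LeastI empty_iff)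
  then have "projective_dimension ?R M \<in> ?L"
    by (simp only: projective_dimension_def)
  then obtain l P \<delta> \<epsilon> where l: "projective_dimension ?R M = enat l"
    and "projective_resolution ?R M (P :: nat \<Rightarrow> (_, nat \<Rightarrow> ('v \<Rightarrow>\<^sub>0 nat) \<Rightarrow>\<^sub>0 'k) module) \<delta> \<epsilon>"
      "\<forall>i > l. carrier (P i) = {\<zero>\<^bsub>P i\<^esub>}"
    by blast
  then show ?thesis
    by (intro that[of P \<delta> \<epsilon>]) simp_all
qed

section \<open>Cliques in chordal graphs\<close>

text \<open>Phrased by bipartitions so that its failure hands over directly the two sides needed for
  the Koszul cocycle. The empty set counts as connected.\<close>

definition connected_on :: "'v set set \<Rightarrow> 'v set \<Rightarrow> bool" where
  "connected_on E W \<longleftrightarrow> (\<forall>A B. A \<union> B = W \<and> A \<inter> B = {} \<and> A \<noteq> {} \<and> B \<noteq> {} \<longrightarrow>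
     (\<exists>a \<in> A. \<exists>b \<in> B. {a, b} \<in> E))"

lemma connected_onE:
  assumes "connected_on E W" "A \<subseteq> W" "A \<noteq> {}" "A \<noteq> W"
  obtains a b where "a \<in> A" "b \<in> W - A" "{a, b} \<in> E"
proof -
  have "A \<union> (W - A) = W" "A \<inter> (W - A) = {}" "W - A \<noteq> {}"
    using assms by auto
  then have "\<exists>a \<in> A. \<exists>b \<in> W - A. {a, b} \<in> E"
    using assms(1,3) unfolding connected_on_def by (elim allE[of _ A] allE[of _ "W - A"]) simp
  then show ?thesis
    by (elim bexE) (rule that)
qed

lemma connected_on_insert:
  assumes "connected_on E S" "s \<in> S" "w \<notin> S" "{s, w} \<in> E"
  shows "connected_on E (insert w S)"
  unfolding connected_on_def
proof (intro allI impI, elim conjE)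
  fix A B assume AB: "A \<union> B = insert w S" "A \<inter> B = {}" "A \<noteq> {}" "B \<noteq> {}"
  have sw: "s \<in> A \<or> s \<in> B" "w \<in> A \<or> w \<in> B"
    using AB(1) assms(2) by auto
  show "\<exists>a\<in>A. \<exists>b\<in>B. {a, b} \<in> E"
  proof (cases "A \<inter> S = {} \<or> A \<inter> S = S")
    case True
    then have "A = {w} \<or> B = {w}"
      using AB by auto
    then show ?thesis
      using sw AB(2) assms by (auto simp: insert_commute)
  next
    case False
    then obtain a b where "a \<in> A \<inter> S" "b \<in> S - A \<inter> S" "{a, b} \<in> E"
      using connected_onE[OF assms(1), of "A \<inter> S"] by blast
    moreover from this have "a \<in> A" "b \<in> B"
      using AB(1) by auto
    ultimately show ?thesis
      by auto
  qed
qed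

text \<open>The set of ends of walks starting in \<open>A\<close> cannot be left along an edge,
  hence is all of \<open>S\<close>.\<close>

lemma connected_on_walk:
  assumes conn: "connected_on E S" and A: "A \<subseteq> S" "A \<noteq> {}" and B: "B \<subseteq> S" "B \<noteq> {}"
  shows "\<exists>us. us \<noteq> [] \<and> set us \<subseteq> S \<and> hd us \<in> A \<and> last us \<in> B \<and> successively (\<lambda>x y. {x, y} \<in> E) us"
proof -
  define R where "R = {last us | us. us \<noteq> [] \<and> set us \<subseteq> S \<and> hd us \<in> A \<and> successively (\<lambda>x y. {x, y} \<in> E) us}"
  have sub: "R \<subseteq> S"
    unfolding R_def using last_in_set by blast
  have "A \<subseteq> R"
  proof
    fix a assume "a \<in> A"
    then show "a \<in> R"
      unfolding R_def using A by (intro CollectI exI[of _ "[a]"]) auto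
  qed
  then have "R \<noteq> {}" using A by blast
  have "R = S"
  proof (rule ccontr)
    assume "R \<noteq> S"
    then obtain a b where a: "a \<in> R" and b: "b \<in> S - R" "{a, b} \<in> E"
      using connected_onE[OF conn sub \<open>R \<noteq> {}\<close>] by blast
    obtain us where us: "a = last us" "us \<noteq> []" "set us \<subseteq> S" "hd us \<in> A" "successively (\<lambda>x y. {x, y} \<in> E) us"
      using a unfolding R_def by blast
    have "b \<in> R"
      unfolding R_def using us b by (intro CollectI exI[of _ "us @ [b]"]) (auto simp: successively_append_iff)
    then show False using b by blast
  qed
  obtain b where "b \<in> B"
    using B by blast
  then have "b \<in> R"
    using B \<open>R = S\<close> by blast
  then obtain us where "b = last us" "us \<noteq> []" "set us \<subseteq> S" "hd us \<in> A" "successively (\<lambda>x y. {x, y} \<in> E) us"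
    unfolding R_def by blast
  then show ?thesis
    using \<open>b \<in> B\<close> by (intro exI[of _ us]) simp
qed

text \<open>A shortest walk between two components of the neighbourhood closes up, through \<open>v\<close>, to a
  chordless cycle.\<close>

lemma chordal_neighbourhood_connected:
  assumes chordal: "chordal E" and conn: "connected_on E S" and v: "v \<notin> S"
  shows "connected_on E {u \<in> S. {u, v} \<in> E}"
  unfolding connected_on_def
proof (intro allI impI, elim conjE, rule ccontr)
  fix A B assume AB: "A \<union> B = {u \<in> S. {u, v} \<in> E}" "A \<inter> B = {}" "A \<noteq> {}" "B \<noteq> {}"
    and no_edge: "\<not> (\<exists>a\<in>A. \<exists>b\<in>B. {a, b} \<in> E)"
  let ?succ = "successively (\<lambda>x y. {x, y} \<in> E)"
  define walk where "walk us \<longleftrightarrow> us \<noteq> [] \<and> set us \<subseteq> S \<and> hd us \<in> A \<and> last us \<in> B \<and> ?succ us" for us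
  have "\<exists>us. walk us"
    unfolding walk_def using connected_on_walk[OF conn _ AB(3) _ AB(4)] AB(1) by blast
  then have "\<exists>us. walk us \<and> (\<forall>ws. walk ws \<longrightarrow> length us \<le> length ws)"
    using ex_has_least_nat[of walk _ length] by (elim exE)
  then obtain us where us: "walk us" and minimal: "\<And>ws. walk ws \<Longrightarrow> length us \<le> length ws"
    by (elim exE conjE) simp
  define k where "k = length us"
  have ne: "us \<noteq> []" and sub: "set us \<subseteq> S" and hd: "hd us \<in> A" and last: "last us \<in> B" and succ: "?succ us"
    using us by (auto simp: walk_def)
  have k: "k > 0" and hd': "us ! 0 \<in> A" and last': "us ! (k - 1) \<in> B"
    using ne hd last by (auto simp: k_def hd_conv_nth last_conv_nth)
  have edge: "{us ! i, us ! Suc i} \<in> E" if "Suc i < k" for i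
    using succ that by (simp add: successively_conv_nth k_def)
  \<comment> \<open>Cutting out a nonempty middle piece would give a shorter walk from
    \<open>A\<close> to \<open>B\<close>.\<close>
  have join: "\<not> (hd ys \<in> A \<and> last zs \<in> B \<and> {last ys, hd zs} \<in> E)"
    if "us = ys @ ms @ zs" "ys \<noteq> []" "zs \<noteq> []" "ms \<noteq> []" for ys ms zs
  proof
    assume "hd ys \<in> A \<and> last zs \<in> B \<and> {last ys, hd zs} \<in> E"
    then have "walk (ys @ zs)"
      using that sub succ by (auto simp: walk_def successively_append_iff)
    from minimal[OF this] show False
      using that by simp
  qed
  have suffix: "drop i us = us \<or> us ! i \<notin> A" if "i < k" for i
  proof (rule ccontr)
    assume *: "\<not> ?thesis"
    then have "walk (drop i us)"
      using that sub succ last set_drop_subset[of i us] successively_append_iff[of _ "take i us" "drop i us"]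
      by (auto simp: walk_def k_def hd_drop_conv_nth)
    from minimal[OF this] show False
      using * that by (cases i) (auto simp: k_def)
  qed
  have prefix: "us ! i \<notin> B" if "Suc i < k" for i
  proof
    assume *: "us ! i \<in> B"
    have "last (take (Suc i) us) = us ! i"
      using that by (simp add: k_def take_Suc_conv_app_nth)
    then have "walk (take (Suc i) us)"
      using * that sub succ hd ne set_take_subset[of "Suc i" us]
        successively_append_iff[of _ "take (Suc i) us" "drop (Suc i) us"]
      by (auto simp: walk_def k_def)
    from minimal[OF this] show False
      using that by (simp add: k_def)
  qed
  have interior: "us ! i \<notin> A \<union> B" if "0 < i" "Suc i < k" for i
  proof -
    have "length (drop i us) < length us"
      using that by (simp add: k_def)
    then have "drop i us \<noteq> us" by (metis less_irrefl)
    then show ?thesis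
      using suffix[of i] prefix[of i] that by auto
  qed
  have shortcut: "{us ! i, us ! j} \<notin> E" if "Suc i < j" "j < k" for i j
  proof
    assume e: "{us ! i, us ! j} \<in> E"
    have "us = take (Suc i) us @ take (j - Suc i) (drop (Suc i) us) @ drop j us"
      using that by (metis append_take_drop_id drop_drop le_add_diff_inverse2 less_imp_le)
    moreover have "last (take (Suc i) us) = us ! i" "hd (drop j us) = us ! j"
      using that by (simp_all add: k_def take_Suc_conv_app_nth hd_drop_conv_nth)
    ultimately show False
      using join[of "take (Suc i) us" "take (j - Suc i) (drop (Suc i) us)" "drop j us"] that e hd last ne
      by (auto simp: k_def)
  qed
  \<comment> \<open>A repetition at \<open>j\<close> would give a shortcut from \<open>i\<close> to
    \<open>j + 1\<close>, or an earlier visit to \<open>B\<close> if \<open>j\<close> is the last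
    position.\<close>
  have inj: "us ! i \<noteq> us ! j" if "i < j" "j < k" for i j
  proof
    assume eq: "us ! i = us ! j"
    show False
    proof (cases "Suc j < k")
      case True
      then show False
        using shortcut[of i "Suc j"] edge[of j] eq that by simp
    next
      case False
      then have "j = k - 1" using that by simp
      then show False
        using prefix[of i] that last' eq by simp
    qed
  qed
  \<comment> \<open>One vertex would lie in both \<open>A\<close> and \<open>B\<close>, two would
    form a forbidden edge. So the cycle through \<open>v\<close> has length at least 4, as
    chordality requires.\<close>
  have "k \<noteq> 1"
    using hd' last' AB(2) by auto
  moreover have "k \<noteq> 2"
    using hd' last' no_edge edge[of 0] by (auto simp: numeral_2_eq_2)
  ultimately have k3: "k \<ge> 3"
    using k by simp
  let ?vs = "v # us"
  have v_nbr: "{us ! 0, v} \<in> E" "{us ! (k - 1), v} \<in> E"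
    using hd' last' AB(1) by auto
  have "is_cycle E ?vs"
    unfolding is_cycle_def
  proof (intro conjI allI impI)
    show "3 \<le> length ?vs" using k3 by (simp add: k_def)
    have "distinct us"
      unfolding distinct_conv_nth using inj by (metis k_def nat_neq_iff)
    then show "distinct ?vs" using v sub by auto
    fix i assume i: "i < length ?vs"
    show "{?vs ! i, ?vs ! (Suc i mod length ?vs)} \<in> E"
    proof (cases i)
      case 0
      then show ?thesis using v_nbr(1) ne by (simp add: insert_commute)
    next
      case (Suc m)
      show ?thesis
      proof (cases "Suc m < k")
        case True
        then show ?thesis using Suc edge[of m] by (simp add: k_def)
      next
        case False
        then have "Suc m = k" using i Suc by (simp add: k_def)
        then show ?thesis using Suc v_nbr(2) by (simp add: k_def[symmetric])
      qed
    qed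
  qed
  moreover have "length ?vs > 3"
    using k3 by (simp add: k_def)
  ultimately have "has_chord E ?vs"
    using chordal unfolding chordal_def by blast
  then obtain i j where ij: "i < Suc k" "j < Suc k" "i \<noteq> j" "j \<noteq> Suc i mod Suc k" "i \<noteq> Suc j mod Suc k"
    "{?vs ! i, ?vs ! j} \<in> E"
    unfolding has_chord_def by (auto simp: k_def)
  \<comment> \<open>Position 0 of the cycle is \<open>v\<close> and shifts the walk by one. A chord
    at \<open>v\<close> would make an interior vertex of the walk a neighbour of \<open>v\<close>;
    any other chord is a shortcut.\<close>
  have no_chord: False if ij: "i < j" "j < Suc k" "j \<noteq> Suc i mod Suc k" "i \<noteq> Suc j mod Suc k" "{?vs ! i, ?vs ! j} \<in> E" for i j
  proof -
    obtain m where m: "j = Suc m" using ij(1) by (cases j) auto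
    show False
    proof (cases i)
      case 0
      then have "m \<noteq> 0" "Suc m \<noteq> k"
        using ij m k3 by auto
      moreover have "us ! m \<in> A \<union> B"
        unfolding AB(1) using ij m 0 sub by (auto simp: insert_commute k_def)
      ultimately show False
        using interior[of m] ij m by simp
    next
      case (Suc l)
      then have "Suc l < m"
        using ij m by (auto simp: less_Suc_eq)
      then show False
        using shortcut[of l m] ij m Suc by simp
    qed
  qed
  show False
    using no_chord[of i j] no_chord[of j i] ij by (cases i j rule: linorder_cases) (auto simp: insert_commute)
qed

text \<open>A proper connected subset of maximal size is left by some edge; adding the far end keeps
  it connected, so it must be everything.\<close>

lemma exists_non_cut_vertex:
  assumes "finite W" "connected_on E W" "card W \<ge> 2"
  obtains S w where "W = insert w S" "w \<notin> S" "S \<noteq> {}" "connected_on E S"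
proof -
  define Q where "Q S \<longleftrightarrow> S \<subseteq> W \<and> S \<noteq> W \<and> S \<noteq> {} \<and> connected_on E S" for S
  obtain w0 where w0: "w0 \<in> W"
    using assms(3) by fastforce
  have "connected_on E {w0}"
    unfolding connected_on_def by (auto simp: Un_singleton_iff)
  then have "Q {w0}"
    using w0 assms(3) by (auto simp: Q_def)
  moreover have "\<forall>S. Q S \<longrightarrow> card S < Suc (card W)"
    using assms(1) by (auto simp: Q_def less_Suc_eq_le intro: card_mono)
  ultimately have "\<exists>S. Q S \<and> (\<forall>T. Q T \<longrightarrow> card T \<le> card S)"
    by (rule ex_has_greatest_nat)
  then obtain S where S: "Q S" and maximal: "\<And>T. Q T \<Longrightarrow> card T \<le> card S"
    by (elim exE conjE) simp
  obtain s w where sw: "s \<in> S" "w \<in> W - S" "{s, w} \<in> E"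
    using connected_onE[OF assms(2), of S] S by (auto simp: Q_def)
  have finS: "finite S"
    using S assms(1) by (auto simp: Q_def intro: finite_subset)
  have "insert w S = W"
  proof (rule ccontr)
    assume "insert w S \<noteq> W"
    then have "Q (insert w S)"
      using S sw connected_on_insert[of E S s w] unfolding Q_def by simp
    from maximal[OF this] show False
      using sw finS by simp
  qed
  then show ?thesis
    using that[of w S] S sw by (auto simp: Q_def)
qed

text \<open>Cliques containing \<open>w\<close> are cliques of its neighbourhood with
  \<open>w\<close> added, which flips the sign. The sum for \<open>W\<close> is therefore the sum
  for \<open>S\<close> minus that for the neighbourhood.\<close>

lemma chordal_euler_characteristic:
  assumes "finite W" "chordal E" "connected_on E W" "W \<noteq> {}"
  shows "(\<Sum>F | F \<subseteq> W \<and> clique F E. (- 1) ^ card F :: 'a::ring_1) = 0"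
  using assms
proof (induction "card W" arbitrary: W rule: less_induct)
  case less
  show ?case
  proof (cases "card W \<ge> 2")
    case False
    then have "card W = 1"
      using less.prems by (metis One_nat_def Suc_leI card_gt_0_iff le_antisym not_less_eq_eq numeral_2_eq_2)
    then obtain w where "W = {w}"
      by (auto simp: card_1_singleton_iff)
    then have "{F. F \<subseteq> W \<and> clique F E} = {{}, {w}}"
      by (auto simp: clique_def)
    then show ?thesis by simp
  next
    case True
    then obtain S w where W: "W = insert w S" "w \<notin> S" and S: "S \<noteq> {}" "connected_on E S"
      using exists_non_cut_vertex[of W E] less.prems by metis
    let ?N = "{u \<in> S. {u, w} \<in> E}"
    have fin: "finite S" "finite ?N"
      using less.prems W by auto
    obtain s where "s \<in> S" "{s, w} \<in> E"
      using connected_onE[OF less.prems(3), of S] W S by blast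
    then have N: "?N \<noteq> {}" by blast
    have "connected_on E ?N"
      by (rule chordal_neighbourhood_connected[OF less.prems(2) S(2) W(2)])
    moreover have "card S < card W" "card ?N < card W"
      using W fin card_mono[of S ?N] by auto
    ultimately have IH: "(\<Sum>F | F \<subseteq> S \<and> clique F E. (- 1) ^ card F :: 'a) = 0"
      "(\<Sum>F | F \<subseteq> ?N \<and> clique F E. (- 1) ^ card F :: 'a) = 0"
      using less.hyps fin S N less.prems(2) by blast+
    have split: "{F. F \<subseteq> W \<and> clique F E} = {F. F \<subseteq> S \<and> clique F E} \<union> insert w ` {F. F \<subseteq> ?N \<and> clique F E}"
      (is "_ = ?A \<union> insert w ` ?B")
    proof (intro equalityI subsetI)
      fix F assume F: "F \<in> {F. F \<subseteq> W \<and> clique F E}"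
      show "F \<in> ?A \<union> insert w ` ?B"
      proof (cases "w \<in> F")
        case False
        then show ?thesis using F W by auto
      next
        case True
        have "{u, w} \<in> E" if "u \<in> F - {w}" for u
          using F True that by (auto simp: clique_def)
        then have "F - {w} \<in> ?B"
          using F W by (auto simp: clique_def)
        moreover have "F = insert w (F - {w})"
          using True by auto
        ultimately show ?thesis
          by blast
      qed
    next
      fix F assume "F \<in> ?A \<union> insert w ` ?B"
      then show "F \<in> {F. F \<subseteq> W \<and> clique F E}"
        using W by (auto simp: clique_def insert_commute)
    qed
    have finAB: "finite ?A" "finite ?B"
      using fin by (auto intro: finite_subset[OF _ finite_Pow_iff[THEN iffD2]])
    have inj: "inj_on (insert w) ?B"
      using W(2) by (auto simp: inj_on_def)
    have "(\<Sum>F\<in>insert w ` ?B. (- 1) ^ card F :: 'a) = (\<Sum>F\<in>?B. (- 1) ^ card (insert w F))"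
      by (simp add: sum.reindex[OF inj])
    also have "\<dots> = (\<Sum>F\<in>?B. - ((- 1) ^ card F))"
    proof (rule sum.cong[OF refl])
      fix F assume "F \<in> ?B"
      then have "w \<notin> F" "finite F"
        using W(2) fin(2) by (auto intro: finite_subset)
      then show "(- 1) ^ card (insert w F) = - ((- 1) ^ card F :: 'a)"
        by simp
    qed
    also have "\<dots> = 0"
      using IH(2) by (simp add: sum_negf)
    finally have "(\<Sum>F\<in>insert w ` ?B. (- 1) ^ card F :: 'a) = 0" .
    moreover have "?A \<inter> insert w ` ?B = {}"
      using W(2) by auto
    ultimately show ?thesis
      unfolding split using IH(1) finAB by (simp add: sum.union_disjoint)
  qed
qed

section \<open>Clique counts and induced subgraphs of fixed size\<close>

lemma card_supersets:
  assumes "finite V" "F \<subseteq> V" "card F \<le> m"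
  shows "card {W. F \<subseteq> W \<and> W \<subseteq> V \<and> card W = m} = (card V - card F) choose (m - card F)"
proof -
  have finF: "finite F"
    using assms finite_subset by blast
  have "bij_betw (\<lambda>U. U \<union> F) {U. U \<subseteq> V - F \<and> card U = m - card F} {W. F \<subseteq> W \<and> W \<subseteq> V \<and> card W = m}"
  proof (rule bij_betw_byWitness[of _ "\<lambda>W. W - F"])
    show "(\<lambda>U. U \<union> F) ` {U. U \<subseteq> V - F \<and> card U = m - card F} \<subseteq> {W. F \<subseteq> W \<and> W \<subseteq> V \<and> card W = m}"
    proof clarify
      fix U assume U: "U \<subseteq> V - F" "card U = m - card F"
      have "finite U" using U assms finite_subset by blast
      then have "card (U \<union> F) = card U + card F"
        using U finF by (intro card_Un_disjoint) auto
      then show "F \<subseteq> U \<union> F \<and> U \<union> F \<subseteq> V \<and> card (U \<union> F) = m"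
        using U assms by auto
    qed
    show "(\<lambda>W. W - F) ` {W. F \<subseteq> W \<and> W \<subseteq> V \<and> card W = m} \<subseteq> {U. U \<subseteq> V - F \<and> card U = m - card F}"
      using finF by (auto simp: card_Diff_subset)
  qed auto
  then have "card {W. F \<subseteq> W \<and> W \<subseteq> V \<and> card W = m} = card {U. U \<subseteq> V - F \<and> card U = m - card F}"
    by (simp add: bij_betw_same_card)
  also have "\<dots> = card (V - F) choose (m - card F)"
    using assms by (intro n_subsets) auto
  finally show ?thesis
    using assms finF by (simp add: card_Diff_subset)
qed

text \<open>The left-hand side is, up to sign, the coefficient of \<open>t\<^sup>m\<close> in the numerator of the Hilbert
  series of the Stanley-Reisner ring of the clique complex.\<close>

lemma chordal_k_polynomial_coeff_zero:
  assumes V: "finite V" and chordal: "chordal E" and "m > 0"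
    and conn: "\<And>W. W \<subseteq> V \<Longrightarrow> card W = m \<Longrightarrow> connected_on E W"
  shows "(\<Sum>k\<le>m. (- 1) ^ k * of_nat (card {F. F \<subseteq> V \<and> clique F E \<and> card F = k}) *
    of_nat ((card V - k) choose (m - k)) :: 'a::comm_ring_1) = 0"
proof -
  let ?C = "{F. F \<subseteq> V \<and> clique F E}"
  let ?Wm = "{W. W \<subseteq> V \<and> card W = m}"
  have fin: "finite ?C" "finite ?Wm"
    using V by auto
  have "0 = (\<Sum>W\<in>?Wm. \<Sum>F | F \<subseteq> W \<and> clique F E. (- 1) ^ card F :: 'a)"
  proof (rule sum.neutral[symmetric], rule ballI)
    fix W assume W: "W \<in> ?Wm"
    then have "finite W" "W \<noteq> {}"
      using V \<open>m > 0\<close> by (auto intro: finite_subset)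
    then show "(\<Sum>F | F \<subseteq> W \<and> clique F E. (- 1) ^ card F :: 'a) = 0"
      using W conn by (intro chordal_euler_characteristic chordal) auto
  qed
  also have "\<dots> = (\<Sum>W\<in>?Wm. \<Sum>F\<in>{F \<in> ?C. F \<subseteq> W}. (- 1) ^ card F)"
    by (intro sum.cong) auto
  \<comment> \<open>Double counting: each clique is now weighted by the number of
    \<open>m\<close>-element vertex sets above it, which is a binomial coefficient.\<close>
  also have "\<dots> = (\<Sum>F\<in>?C. \<Sum>W\<in>{W \<in> ?Wm. F \<subseteq> W}. (- 1) ^ card F)"
    by (rule sum.swap_restrict[OF fin(2,1)])
  also have "\<dots> = (\<Sum>F\<in>?C. of_nat (card {W. F \<subseteq> W \<and> W \<subseteq> V \<and> card W = m}) * (- 1) ^ card F)"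
  proof (intro sum.cong refl)
    fix F
    have "{W \<in> ?Wm. F \<subseteq> W} = {W. F \<subseteq> W \<and> W \<subseteq> V \<and> card W = m}" by auto
    then show "(\<Sum>W\<in>{W \<in> ?Wm. F \<subseteq> W}. (- 1) ^ card F) =
        of_nat (card {W. F \<subseteq> W \<and> W \<subseteq> V \<and> card W = m}) * (- 1 :: 'a) ^ card F"
      by simp
  qed
  also have "\<dots> = (\<Sum>F\<in>{F \<in> ?C. card F \<le> m}. of_nat ((card V - card F) choose (m - card F)) * (- 1) ^ card F)"
  proof (rule sum.mono_neutral_cong_right[OF fin(1)])
    show "\<forall>F\<in>?C - {F \<in> ?C. card F \<le> m}. of_nat (card {W. F \<subseteq> W \<and> W \<subseteq> V \<and> card W = m}) * (- 1 :: 'a) ^ card F = 0"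
    proof
      fix F assume F: "F \<in> ?C - {F \<in> ?C. card F \<le> m}"
      have "card F \<le> card W" if "F \<subseteq> W" "W \<subseteq> V" for W
        using that V by (intro card_mono) (auto intro: finite_subset)
      then have empty: "{W. F \<subseteq> W \<and> W \<subseteq> V \<and> card W = m} = {}"
        using F by fastforce
      show "of_nat (card {W. F \<subseteq> W \<and> W \<subseteq> V \<and> card W = m}) * (- 1 :: 'a) ^ card F = 0"
        unfolding empty by simp
    qed
  next
    fix F assume "F \<in> {F \<in> ?C. card F \<le> m}"
    then have "card {W. F \<subseteq> W \<and> W \<subseteq> V \<and> card W = m} = (card V - card F) choose (m - card F)"
      using card_supersets[OF V, of F m] by simp
    then show "of_nat (card {W. F \<subseteq> W \<and> W \<subseteq> V \<and> card W = m}) * (- 1 :: 'a) ^ card F =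
        of_nat ((card V - card F) choose (m - card F)) * (- 1) ^ card F"
      by (simp only:)
  qed blast
  also have "\<dots> = (\<Sum>k\<le>m. \<Sum>F\<in>{F \<in> {F \<in> ?C. card F \<le> m}. card F = k}. of_nat ((card V - card F) choose (m - card F)) * (- 1) ^ card F)"
    by (intro sum.group[symmetric]) (use fin(1) in \<open>auto intro: finite_subset[OF _ fin(1)]\<close>)
  also have "\<dots> = (\<Sum>k\<le>m. (- 1) ^ k * of_nat (card {F. F \<subseteq> V \<and> clique F E \<and> card F = k}) *
    of_nat ((card V - k) choose (m - k)))"
  proof (intro sum.cong refl)
    fix k assume "k \<in> {..m}"
    then have "{F \<in> {F \<in> ?C. card F \<le> m}. card F = k} = {F. F \<subseteq> V \<and> clique F E \<and> card F = k}"
      by auto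
    then show "(\<Sum>F\<in>{F \<in> {F \<in> ?C. card F \<le> m}. card F = k}. of_nat ((card V - card F) choose (m - card F)) * (- 1) ^ card F) =
      (- 1) ^ k * of_nat (card {F. F \<subseteq> V \<and> clique F E \<and> card F = k}) * (of_nat ((card V - k) choose (m - k)) :: 'a)"
      by (simp add: mult_ac)
  qed
  finally show ?thesis
    by simp
qed

section \<open>The numerical identities\<close>

text \<open>Up to sign this is the \<open>N\<close>-th finite difference of a polynomial of degree
  \<open>j < N\<close>. Pascal's rule splits off one difference, in which the leading power cancels,
  so only exponents below \<open>j\<close> reach the induction hypothesis. The shift
  \<open>x\<close> will be a clique size.\<close>

lemma sum_alternating_binomial_power:
  fixes x :: "'a::comm_ring_1"
  assumes "j < N"
  shows "(\<Sum>i\<le>N. (- 1) ^ i * of_nat (N choose i) * (x + of_nat i) ^ j) = 0"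
  using assms
proof (induction N arbitrary: j x)
  case (Suc N)
  let ?S = "\<lambda>j. \<Sum>i\<le>N. (- 1) ^ i * of_nat (N choose i) * (x + of_nat i) ^ j"
  have expand: "(x + of_nat (Suc i)) ^ j = (x + of_nat i) ^ j + (\<Sum>l<j. of_nat (j choose l) * (x + of_nat i) ^ l)" for i
  proof -
    have "(x + of_nat (Suc i)) ^ j = ((x + of_nat i) + 1) ^ j"
      by (simp add: algebra_simps)
    also have "\<dots> = (\<Sum>l\<le>j. of_nat (j choose l) * (x + of_nat i) ^ l)"
      by (subst binomial_ring) simp
    finally show ?thesis
      by (simp add: lessThan_Suc_atMost[symmetric] add.commute)
  qed
  have "(\<Sum>i\<le>Suc N. (- 1) ^ i * of_nat (Suc N choose i) * (x + of_nat i) ^ j) =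
      x ^ j + (\<Sum>i\<le>N. (- 1) ^ Suc i * of_nat (N choose Suc i) * (x + of_nat (Suc i)) ^ j) +
      (\<Sum>i\<le>N. (- 1) ^ Suc i * of_nat (N choose i) * (x + of_nat (Suc i)) ^ j)"
    by (simp only: sum.atMost_Suc_shift binomial_Suc_Suc)
      (simp add: algebra_simps sum.distrib sum_negf sum_subtractf)
  also have "x ^ j + (\<Sum>i\<le>N. (- 1) ^ Suc i * of_nat (N choose Suc i) * (x + of_nat (Suc i)) ^ j) =
      (\<Sum>i\<le>Suc N. (- 1) ^ i * of_nat (N choose i) * (x + of_nat i) ^ j)"
    by (simp only: sum.atMost_Suc_shift) simp
  also have "\<dots> = ?S j"
    by (simp add: binomial_eq_0)
  also have "(\<Sum>i\<le>N. (- 1) ^ Suc i * of_nat (N choose i) * (x + of_nat (Suc i)) ^ j) =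
      - ?S j - (\<Sum>l<j. of_nat (j choose l) * ?S l)"
  proof -
    have "(\<Sum>l<j. of_nat (j choose l) * ?S l) =
        (\<Sum>i\<le>N. (- 1) ^ i * of_nat (N choose i) * (\<Sum>l<j. of_nat (j choose l) * (x + of_nat i) ^ l))"
      unfolding sum_distrib_left by (subst sum.swap) (simp add: mult_ac)
    then show ?thesis
      by (simp only: expand) (simp add: algebra_simps sum.distrib sum_negf sum_subtractf)
  qed
  also have "(\<Sum>l<j. of_nat (j choose l) * ?S l) = 0"
    using Suc by (intro sum.neutral) auto
  finally show ?case
    by simp
qed simp

text \<open>The coefficient of t^m in the sum of a_k t^k (1 - t)^(n - k). Generalized binomials
  match those in the identities, whose upper arguments may be negative.\<close>

definition k_coeff :: "nat \<Rightarrow> (nat \<Rightarrow> rat) \<Rightarrow> nat \<Rightarrow> rat" where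
  "k_coeff n a m = (\<Sum>k\<le>m. (- 1) ^ (m - k) * a k * ((of_nat n - of_nat k) gchoose (m - k)))"

lemma sum_swap_triangle:
  "(\<Sum>m=l..M. \<Sum>k=l..m. g m k) = (\<Sum>k=l..M. \<Sum>m=k..(M::nat). g m k :: 'a::comm_monoid_add)"
proof -
  have "(\<Sum>m=l..M. \<Sum>k=l..m. g m k) = (\<Sum>m\<in>{l..M}. \<Sum>k\<in>{k \<in> {l..M}. k \<le> m}. g m k)"
    by (intro sum.cong) auto
  also have "\<dots> = (\<Sum>k\<in>{l..M}. \<Sum>m\<in>{m \<in> {l..M}. k \<le> m}. g m k)"
    by (rule sum.swap_restrict) auto
  also have "\<dots> = (\<Sum>k=l..M. \<Sum>m=k..M. g m k)"
    by (intro sum.cong) auto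
  finally show ?thesis .
qed

text \<open>After exchanging the sums, \<open>a k\<close> multiplies a finite difference of order
  \<open>n - k\<close> of a power with exponent \<open>j < n - k\<close>. This is the divisibility
  by a power of 1 - t without polynomials.\<close>

lemma k_coeff_moment:
  assumes a: "\<And>k. a k \<noteq> 0 \<Longrightarrow> k + j < n" and zero: "\<And>m. m > M \<Longrightarrow> k_coeff n a m = 0"
  shows "(\<Sum>m\<le>M. k_coeff n a m * of_nat m ^ j) = 0"
proof -
  \<comment> \<open>Large enough to add only zero coefficients beyond \<open>M\<close> and to make
    every binomial sum complete.\<close>
  define L where "L = max M n"
  have inner: "a k * (\<Sum>m=k..L. (- 1) ^ (m - k) * ((of_nat n - of_nat k) gchoose (m - k)) * of_nat m ^ j) = 0" for k
  proof (cases "a k = 0")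
    case False
    then have k: "k + j < n" by (rule a)
    have "(\<Sum>m=k..L. (- 1) ^ (m - k) * ((of_nat n - of_nat k) gchoose (m - k)) * of_nat m ^ j :: rat) =
        (\<Sum>i\<le>L-k. (- 1) ^ i * of_nat ((n - k) choose i) * (of_nat k + of_nat i) ^ j)"
      by (rule sum.reindex_bij_witness[of _ "\<lambda>i. k + i" "\<lambda>m. m - k"])
        (use k in \<open>auto simp: L_def binomial_gbinomial of_nat_diff\<close>)
    also have "\<dots> = (\<Sum>i\<le>n-k. (- 1) ^ i * of_nat ((n - k) choose i) * (of_nat k + of_nat i) ^ j)"
      by (rule sum.mono_neutral_right) (auto simp: L_def binomial_eq_0)
    also have "\<dots> = 0"
      by (rule sum_alternating_binomial_power) (use k in simp)
    finally show ?thesis by simp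
  qed simp
  have "(\<Sum>m\<le>M. k_coeff n a m * of_nat m ^ j) = (\<Sum>m\<le>L. k_coeff n a m * of_nat m ^ j)"
    by (rule sum.mono_neutral_left) (auto simp: L_def zero)
  also have "\<dots> = (\<Sum>m=0..L. \<Sum>k=0..m. (- 1) ^ (m - k) * a k * ((of_nat n - of_nat k) gchoose (m - k)) * of_nat m ^ j)"
    by (simp add: k_coeff_def sum_distrib_right atLeast0AtMost)
  also have "\<dots> = (\<Sum>k=0..L. \<Sum>m=k..L. (- 1) ^ (m - k) * a k * ((of_nat n - of_nat k) gchoose (m - k)) * of_nat m ^ j)"
    by (rule sum_swap_triangle)
  also have "\<dots> = (\<Sum>k=0..L. a k * (\<Sum>m=k..L. (- 1) ^ (m - k) * ((of_nat n - of_nat k) gchoose (m - k)) * of_nat m ^ j))"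
    by (simp add: sum_distrib_left mult_ac)
  also have "\<dots> = 0"
    by (simp only: inner) simp
  finally show ?thesis .
qed

text \<open>The terms for \<open>k = 0\<close> and \<open>k = 1\<close> merge by absorption, n
  C(n-1, m-1) = m C(n, m). This is the origin of the factor 1 - m.\<close>

lemma k_coeff_eq:
  assumes "a 0 = 1" "a 1 = of_nat n"
  shows "k_coeff n a m = (- 1) ^ m * (1 - of_nat m) * (of_nat n gchoose m) +
    (\<Sum>k=2..m. (- 1) ^ (m - k) * a k * ((of_nat n - of_nat k) gchoose (m - k)))"
proof (cases m)
  case 0
  then show ?thesis using assms by (simp add: k_coeff_def)
next
  case (Suc l)
  have absorb: "of_nat n * ((of_nat n - 1) gchoose l) = of_nat (Suc l) * (of_nat n gchoose Suc l :: rat)"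
    by (rule gbinomial_absorption[symmetric])
  have "{..m} = insert 0 (insert 1 {2..m})"
    using Suc by auto
  then have "k_coeff n a m = (- 1) ^ m * (of_nat n gchoose m) + (- 1) ^ l * (of_nat n * ((of_nat n - 1) gchoose l)) +
     (\<Sum>k=2..m. (- 1) ^ (m - k) * a k * ((of_nat n - of_nat k) gchoose (m - k)))"
    using assms Suc by (simp add: k_coeff_def)
  then show ?thesis
    unfolding absorb using Suc by (simp add: algebra_simps)
qed

section \<open>Rearrangement into sums over the f-vector\<close>

lemma sum_atMost_add_2:
  fixes g :: "nat \<Rightarrow> 'a::comm_monoid_add"
  shows "(\<Sum>m\<le>p+2. g m) = g 0 + (g 1 + (\<Sum>i=0..p. g (i + 2)))"
proof -
  have "{..p+2} = insert 0 (insert 1 {2..p+2})"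
    by auto
  moreover have "(\<Sum>m=2..p+2. g m) = (\<Sum>i=0..p. g (i + 2))"
    using sum.shift_bounds_cl_nat_ivl[of g 0 2 p] by (simp only: add_0)
  ultimately show ?thesis by simp
qed

lemma sum_shift_1:
  fixes g :: "nat \<Rightarrow> 'a::comm_monoid_add"
  shows "(\<Sum>k=2..p+2. g k) = (\<Sum>k=1..p+1. g (k + 1))"
  by (rule sum.reindex_bij_witness[of _ "\<lambda>i. i + 1" "\<lambda>m. m - 1"]) auto

lemma k_coeff_moment_expanded:
  assumes a: "a 0 = 1" "a 1 = of_nat n" and zero: "\<And>m. m > p + 2 \<Longrightarrow> k_coeff n a m = 0"
    and small: "\<And>k. a k \<noteq> 0 \<Longrightarrow> k + j < n"
  shows "(\<Sum>m\<le>p+2. (- 1) ^ m * (1 - of_nat m) * (of_nat n gchoose m) * of_nat m ^ j) +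
    (\<Sum>k=2..p+2. \<Sum>m=k..p+2. (- 1) ^ (m - k) * a k * ((of_nat n - of_nat k) gchoose (m - k)) * of_nat m ^ j) = 0"
proof -
  let ?t = "\<lambda>m k. (- 1) ^ (m - k) * a k * ((of_nat n - of_nat k) gchoose (m - k))"
  let ?u = "\<lambda>m. (- 1) ^ m * (1 - of_nat m) * (of_nat n gchoose m) :: rat"
  have "0 = (\<Sum>m\<le>p+2. k_coeff n a m * of_nat m ^ j)"
    by (rule k_coeff_moment[symmetric]) (use small zero in auto)
  also have "\<dots> = (\<Sum>m\<le>p+2. ?u m * of_nat m ^ j) + (\<Sum>m\<le>p+2. \<Sum>k=2..m. ?t m k * of_nat m ^ j)"
    by (simp only: k_coeff_eq[OF a] distrib_right sum.distrib sum_distrib_right)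
  also have "(\<Sum>m\<le>p+2. \<Sum>k=2..m. ?t m k * of_nat m ^ j) = (\<Sum>m=2..p+2. \<Sum>k=2..m. ?t m k * of_nat m ^ j)"
    by (rule sum.mono_neutral_right) auto
  also have "\<dots> = (\<Sum>k=2..p+2. \<Sum>m=k..p+2. ?t m k * of_nat m ^ j)"
    by (rule sum_swap_triangle)
  finally show ?thesis by simp
qed

text \<open>The moment of exponent 0, where the double sum collapses to a single one. The index
  shift in \<open>f\<close> reflects that a face of dimension i has i + 1 vertices.\<close>

lemma f_vector_identity:
  fixes a :: "nat \<Rightarrow> rat" and n p :: nat
  defines "f \<equiv> \<lambda>i. a (Suc i)"
  assumes a: "a 0 = 1" "a 1 = of_nat n" and zero: "\<And>m. m > p + 2 \<Longrightarrow> k_coeff n a m = 0"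
    and small: "\<And>k. a k \<noteq> 0 \<Longrightarrow> k < n"
  shows "- (\<Sum>i=1..p+1. (-1) ^ i * of_nat i * (f 0 gchoose (i + 1)))
           + (\<Sum>j=1..p+1. (-1) ^ (j + p) * f j * ((f 0 - of_nat j - 2) gchoose (p + 1 - j))) = 1"
proof -
  have f0: "f 0 = of_nat n"
    using a by (simp add: f_def)
  let ?t = "\<lambda>m k. (- 1) ^ (m - k) * a k * ((of_nat n - of_nat k) gchoose (m - k))"
  let ?u = "\<lambda>m. (- 1) ^ m * (1 - of_nat m) * (of_nat n gchoose m) :: rat"
  \<comment> \<open>A partial alternating sum of binomials telescopes: up to r it equals (-1)^r C(N
    - 1, r), with N = n - k and r = p + 2 - k.\<close>
  have "(\<Sum>m=k..p+2. ?t m k) = (- 1) ^ (p + 2 - k) * a k * ((of_nat n - of_nat k - 1) gchoose (p + 2 - k))"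
    if "k \<le> p + 2" for k
  proof -
    have "(\<Sum>m=k..p+2. ?t m k) = a k * (\<Sum>i\<le>p+2-k. ((of_nat n - of_nat k) gchoose i) * (- 1) ^ i)"
      unfolding sum_distrib_left
      by (rule sum.reindex_bij_witness[of _ "\<lambda>i. k + i" "\<lambda>m. m - k"]) (use that in auto)
    then show ?thesis
      by (simp add: gbinomial_sum_lower_neg)
  qed
  then have "(\<Sum>k=2..p+2. \<Sum>m=k..p+2. ?t m k) =
      (\<Sum>k=2..p+2. (- 1) ^ (p + 2 - k) * a k * ((of_nat n - of_nat k - 1) gchoose (p + 2 - k)))"
    by (intro sum.cong) auto
  also have "\<dots> = - (\<Sum>j=1..p+1. (-1) ^ (j + p) * f j * ((f 0 - of_nat j - 2) gchoose (p + 1 - j)))"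
    unfolding sum_shift_1 sum_negf[symmetric]
  proof (intro sum.cong refl)
    fix j assume j: "j \<in> {1..p+1}"
    have "(- 1 :: rat) ^ (p + 1 - j) = - ((- 1) ^ (j + p))"
    proof -
      have "j + p + 1 = (p + 1 - j) + 2 * j" using j by auto
      then have "(- 1 :: rat) ^ (j + p + 1) = (- 1) ^ (p + 1 - j)"
        by (simp only: power_add power_mult) simp
      then show ?thesis by simp
    qed
    then show "(- 1) ^ (p + 2 - (j + 1)) * a (j + 1) * ((of_nat n - of_nat (j + 1) - 1) gchoose (p + 2 - (j + 1))) =
        - ((-1) ^ (j + p) * f j * ((f 0 - of_nat j - 2) gchoose (p + 1 - j)))"
      using f0 by (simp add: f_def algebra_simps)
  qed
  finally have t: "(\<Sum>k=2..p+2. \<Sum>m=k..p+2. ?t m k) =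
    - (\<Sum>j=1..p+1. (-1) ^ (j + p) * f j * ((f 0 - of_nat j - 2) gchoose (p + 1 - j)))" .
  \<comment> \<open>The right-hand side 1 of the identity is the term \<open>m = 0\<close>; the term
    \<open>m = 1\<close> has the factor 0.\<close>
  have "(\<Sum>m\<le>p+2. ?u m) = 1 + (\<Sum>i=0..p. ?u (i + 2))"
    by (subst sum_atMost_add_2) simp
  also have "(\<Sum>i=0..p. ?u (i + 2)) = (\<Sum>i=1..p+1. (-1) ^ i * of_nat i * (f 0 gchoose (i + 1)))"
    by (rule sum.reindex_bij_witness[of _ "\<lambda>i. i - 1" "\<lambda>m. m + 1"])
      (auto simp: f0 algebra_simps)
  finally show ?thesis
    using k_coeff_moment_expanded[OF a zero, of p 0] small unfolding power_0 mult_1_right t by simp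
qed

lemma f_vector_moment_identity:
  fixes a :: "nat \<Rightarrow> rat" and n p j :: nat
  defines "f \<equiv> \<lambda>i. a (Suc i)"
  assumes a: "a 0 = 1" "a 1 = of_nat n" and zero: "\<And>m. m > p + 2 \<Longrightarrow> k_coeff n a m = 0"
    and j: "1 \<le> j" and small: "\<And>k. a k \<noteq> 0 \<Longrightarrow> k + j < n"
  shows "(\<Sum>k=1..p+1. (-1) ^ k * f k *
              (\<Sum>i=k-1..p. (-1) ^ i * of_nat (2 + i) ^ j *
                 ((f 0 - of_nat k - 1) gchoose (i + 1 - k))))
           + (\<Sum>i=0..p. (-1) ^ i * of_nat (2 + i) ^ j * of_nat (i + 1) * (f 0 gchoose (i + 2))) = 0"
proof -
  have f0: "f 0 = of_nat n"
    using a by (simp add: f_def)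
  let ?t = "\<lambda>m k. (- 1) ^ (m - k) * a k * ((of_nat n - of_nat k) gchoose (m - k))"
  let ?u = "\<lambda>m. (- 1) ^ m * (1 - of_nat m) * (of_nat n gchoose m) :: rat"
  \<comment> \<open>For positive \<open>j\<close> the term \<open>m = 0\<close> vanishes as well,
    hence the right-hand side 0.\<close>
  have "(\<Sum>m\<le>p+2. ?u m * of_nat m ^ j) = (\<Sum>i=0..p. ?u (i + 2) * of_nat (i + 2) ^ j)"
    using j by (subst sum_atMost_add_2) simp
  also have "\<dots> = - (\<Sum>i=0..p. (-1) ^ i * of_nat (2 + i) ^ j * of_nat (i + 1) * (f 0 gchoose (i + 2)))"
    unfolding sum_negf[symmetric] by (intro sum.cong) (auto simp: f0 algebra_simps)
  finally have u: "(\<Sum>m\<le>p+2. ?u m * of_nat m ^ j) =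
    - (\<Sum>i=0..p. (-1) ^ i * of_nat (2 + i) ^ j * of_nat (i + 1) * (f 0 gchoose (i + 2)))" .
  have "(\<Sum>k=2..p+2. \<Sum>m=k..p+2. ?t m k * of_nat m ^ j) =
     (\<Sum>k=1..p+1. - ((-1) ^ k * f k * (\<Sum>i=k-1..p. (-1) ^ i * of_nat (2 + i) ^ j * ((f 0 - of_nat k - 1) gchoose (i + 1 - k)))))"
    unfolding sum_shift_1
  proof (intro sum.cong refl)
    fix k assume k: "k \<in> {1..p+1}"
    have "(\<Sum>m=k+1..p+2. ?t m (k + 1) * of_nat m ^ j) = (\<Sum>i=k-1..p. ?t (i + 2) (k + 1) * of_nat (i + 2) ^ j)"
      by (rule sum.reindex_bij_witness[of _ "\<lambda>i. i + 2" "\<lambda>m. m - 2"]) (use k in auto)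
    also have "\<dots> = (\<Sum>i=k-1..p. - ((-1) ^ k * f k * ((-1) ^ i * of_nat (2 + i) ^ j * ((f 0 - of_nat k - 1) gchoose (i + 1 - k)))))"
    proof (intro sum.cong refl)
      fix i assume i: "i \<in> {k-1..p}"
      have "i + k + 1 = (i + 1 - k) + 2 * k" using i k by auto
      then have "(- 1 :: rat) ^ (i + k + 1) = (- 1) ^ (i + 1 - k)"
        by (simp only: power_add power_mult) simp
      then have "(- 1 :: rat) ^ (i + 1 - k) = - ((- 1) ^ k * (- 1) ^ i)"
        by (simp add: power_add mult_ac)
      moreover have "i + 2 - (k + 1) = i + 1 - k" by simp
      ultimately show "?t (i + 2) (k + 1) * of_nat (i + 2) ^ j =
        - ((-1) ^ k * f k * ((-1) ^ i * of_nat (2 + i) ^ j * ((f 0 - of_nat k - 1) gchoose (i + 1 - k))))"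
        using f0 by (simp add: f_def algebra_simps)
    qed
    finally show "(\<Sum>m=k+1..p+2. ?t m (k + 1) * of_nat m ^ j) =
       - ((-1) ^ k * f k * (\<Sum>i=k-1..p. (-1) ^ i * of_nat (2 + i) ^ j * ((f 0 - of_nat k - 1) gchoose (i + 1 - k))))"
      by (simp only: sum_negf sum_distrib_left)
  qed
  then show ?thesis
    using k_coeff_moment_expanded[of a n p j, OF a zero small] unfolding u sum_negf by linarith
qed

theorem theorem1p3:
  fixes n p :: nat
    and E :: "nat set set"
    and R :: "((nat \<Rightarrow>\<^sub>0 nat) \<Rightarrow>\<^sub>0 rat) ring"
    and \<Gamma> :: "nat set set"
    and d :: int
    and f :: "nat \<Rightarrow> rat"
  assumes "simple_graph {1..n} E"
    and "chordal E"
    and not_complete: "graph_complement {1..n} E \<noteq> {}"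
  defines "\<Gamma> \<equiv> clique_complex {1..n} E"
    and "d \<equiv> complex_dim \<Gamma> + 1"
    and "f \<equiv> \<lambda>i. of_nat (face_number \<Gamma> (int i))"
    and "R \<equiv> mpoly_ring {1..n}"
    and "p \<equiv> the_enat (projective_dimension R
               (quotient_module R (edge_ideal {1..n} (graph_complement {1..n} E))))"
  shows "- (\<Sum>i=1..p+1. (-1) ^ i * of_nat i * (f 0 gchoose (i + 1)))
           + (\<Sum>j=1..p+1. (-1) ^ (j + p) * f j * ((f 0 - of_nat j - 2) gchoose (p + 1 - j))) = 1
       \<and> (\<forall>j::nat. 1 \<le> j \<and> int j \<le> int n - d - 1 \<longrightarrow>
           (\<Sum>k=1..p+1. (-1) ^ k * f k *
              (\<Sum>i=k-1..p. (-1) ^ i * of_nat (2 + i) ^ j *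
                 ((f 0 - of_nat k - 1) gchoose (i + 1 - k))))
           + (\<Sum>i=0..p. (-1) ^ i * of_nat (2 + i) ^ j * of_nat (i + 1) * (f 0 gchoose (i + 2))) = 0)"
proof -
  let ?V = "{1..n}"
  let ?E' = "graph_complement ?V E"
  have E': "?E' \<subseteq> nsets ?V 2"
    by (auto simp: graph_complement_def)
  define a :: "nat \<Rightarrow> rat" where "a k = of_nat (card {F. F \<subseteq> ?V \<and> clique F E \<and> card F = k})" for k
  have f: "f = (\<lambda>i. a (Suc i))"
  proof
    fix i
    have "{F \<in> \<Gamma>. face_dim F = int i} = {F. F \<subseteq> ?V \<and> clique F E \<and> card F = Suc i}"
      by (auto simp: \<Gamma>_def clique_complex_def face_dim_def)
    then show "f i = a (Suc i)"
      by (simp add: f_def face_number_def a_def)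
  qed
  have "{F. F \<subseteq> ?V \<and> clique F E \<and> card F = 0} = {{}}"
  proof -
    have "F = {}" if "F \<subseteq> ?V" "card F = 0" for F
      using that finite_subset[of F ?V] by simp
    then show ?thesis
      by (auto simp: clique_def)
  qed
  then have a0: "a 0 = 1"
    by (simp add: a_def)
  have "{F. F \<subseteq> ?V \<and> clique F E \<and> card F = 1} = (\<lambda>v. {v}) ` ?V"
    by (auto simp: clique_def card_1_singleton_iff)
  then have a1: "a 1 = of_nat n"
    by (simp add: a_def card_image)
  have face: "\<exists>F. F \<subseteq> ?V \<and> clique F E \<and> card F = k" if "a k \<noteq> 0" for k
  proof (rule ccontr)
    assume "\<not> ?thesis"
    then have "{F. F \<subseteq> ?V \<and> clique F E \<and> card F = k} = {}"
      by blast
    then show False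
      using that by (simp only: a_def) simp
  qed
  \<comment> \<open>A clique on all \<open>n\<close> vertices would make the graph complete. The
    strict inequality is the smallness condition for exponent 0.\<close>
  have le_n: "k < n" if ak: "a k \<noteq> 0" for k
  proof -
    obtain F where F: "F \<subseteq> ?V" "clique F E" "card F = k"
      using face[OF ak] by blast
    have "F \<noteq> ?V"
    proof
      assume "F = ?V"
      then have "{u, v} \<in> E" if "u \<in> ?V" "v \<in> ?V" "u \<noteq> v" for u v
        using F(2) that by (simp add: clique_def)
      then have "nsets ?V 2 \<subseteq> E"
        by (auto simp: nsets_def card_2_iff)
      then show False
        using not_complete by (auto simp: graph_complement_def)
    qed
    then have "card F < card ?V"
      using F(1) by (intro psubset_card_mono) auto
    then show ?thesis
      using F(3) by simp
  qed
  have le_d: "int k \<le> d" if ak: "a k \<noteq> 0" for k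
  proof -
    obtain F where F: "F \<subseteq> ?V" "clique F E" "card F = k"
      using face[OF ak] by blast
    have "finite \<Gamma>"
      by (auto simp: \<Gamma>_def clique_complex_def)
    moreover have "F \<in> \<Gamma>"
      using F by (simp add: \<Gamma>_def clique_complex_def)
    ultimately have "face_dim F \<le> complex_dim \<Gamma>"
      unfolding complex_dim_def by (intro Max_ge) auto
    then show ?thesis
      using F(3) by (simp add: face_dim_def d_def)
  qed
  obtain P :: "nat \<Rightarrow> ((nat \<Rightarrow>\<^sub>0 nat) \<Rightarrow>\<^sub>0 rat, nat \<Rightarrow> (nat \<Rightarrow>\<^sub>0 nat) \<Rightarrow>\<^sub>0 rat) module" and \<delta> \<epsilon>
    where res: "projective_resolution R (quotient_module R (edge_ideal ?V ?E')) P \<delta> \<epsilon>"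
      and trivial: "\<And>i. i > p \<Longrightarrow> carrier (P i) = {\<zero>\<^bsub>P i\<^esub>}"
    using projective_dimension_edge_ideal[OF finite_atLeastAtMost E'] unfolding R_def p_def by blast
  have zero: "k_coeff n a m = 0" if m: "m > p + 2" for m
  proof -
    have "connected_on E W" if W: "W \<subseteq> ?V" "card W = m" for W
    proof (rule ccontr)
      assume "\<not> connected_on E W"
      then obtain A B where AB: "A \<union> B = W" "A \<inter> B = {}" "A \<noteq> {}" "B \<noteq> {}"
        and no_edge: "\<And>a b. a \<in> A \<Longrightarrow> b \<in> B \<Longrightarrow> {a, b} \<notin> E"
        unfolding connected_on_def by blast
      have "{a, b} \<in> ?E'" if "a \<in> A" "b \<in> B" for a b
      proof -
        have "a \<noteq> b" "a \<in> ?V" "b \<in> ?V"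
          using that AB W(1) by auto
        then show ?thesis
          using no_edge[OF that] by (auto simp: graph_complement_def nsets_def card_2_iff)
      qed
      moreover have "A \<subseteq> ?V" "B \<subseteq> ?V" "finite A" "finite B"
        using AB(1) W(1) finite_subset[OF _ finite_atLeastAtMost] by auto
      ultimately have "card (A \<union> B) \<le> p + 1"
        using AB by (intro resolution_length_ge[OF E' _ _ _ _ _ _ _ _ res[unfolded R_def] trivial])
      then show False
        using AB(1) W(2) m by simp
    qed
    then have "0 = (- 1) ^ m * (\<Sum>k\<le>m. (- 1) ^ k * a k * of_nat ((n - k) choose (m - k)))"
      using chordal_k_polynomial_coeff_zero[of ?V E m, where 'a = rat] assms(2) m by (simp add: a_def)
    \<comment> \<open>Ordinary and generalized binomials agree since \<open>k < n\<close> whenever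
      \<open>a k\<close> is nonzero; the other terms vanish on both sides.\<close>
    also have "\<dots> = k_coeff n a m"
      unfolding k_coeff_def sum_distrib_left
    proof (intro sum.cong refl)
      fix k assume k: "k \<in> {..m}"
      have sign: "(- 1 :: rat) ^ m * (- 1) ^ k = (- 1) ^ (m - k)"
      proof -
        have "m + k = (m - k) + 2 * k" using k by simp
        then have "(- 1 :: rat) ^ (m + k) = (- 1) ^ (m - k)"
          by (simp only: power_add power_mult) simp
        then show ?thesis by (simp add: power_add)
      qed
      show "(- 1) ^ m * ((- 1) ^ k * a k * of_nat ((n - k) choose (m - k))) =
          (- 1) ^ (m - k) * a k * ((of_nat n - of_nat k) gchoose (m - k))"
      proof (cases "a k = 0")
        case False
        then show ?thesis
          using le_n[OF False] sign by (simp add: binomial_gbinomial of_nat_diff mult.assoc[symmetric])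
      qed simp
    qed
    finally show ?thesis by simp
  qed
  show ?thesis
  proof (intro conjI allI impI)
    fix j :: nat assume j: "1 \<le> j \<and> int j \<le> int n - d - 1"
    have "k + j < n" if "a k \<noteq> 0" for k
      using le_d[OF that] j by linarith
    with j show "(\<Sum>k=1..p+1. (-1) ^ k * f k *
              (\<Sum>i=k-1..p. (-1) ^ i * of_nat (2 + i) ^ j *
                 ((f 0 - of_nat k - 1) gchoose (i + 1 - k))))
           + (\<Sum>i=0..p. (-1) ^ i * of_nat (2 + i) ^ j * of_nat (i + 1) * (f 0 gchoose (i + 2))) = 0"
      unfolding f by (intro f_vector_moment_identity[OF a0 a1 zero]) simp_all
  next
    show "- (\<Sum>i=1..p+1. (-1) ^ i * of_nat i * (f 0 gchoose (i + 1)))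
           + (\<Sum>j=1..p+1. (-1) ^ (j + p) * f j * ((f 0 - of_nat j - 2) gchoose (p + 1 - j))) = 1"
      unfolding f by (rule f_vector_identity[OF a0 a1 zero le_n])
  qed
qed

end
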